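(* Let $d\ge2$, $\rho\in(0,1)$, and let $\Pi(\mathrm{d}x)=\pi(x)\,\mathrm{d}x$ be a probability distribution on $\mathbb{R}^d$ whose density $\pi$ is a strictly positive, continuous, symmetrically regularly varying function. Then the MpCN kernel (with parameter $\rho$) with target $\Pi$ is geometrically ergodic if and only if $\int_{\mathbb{R}^d}\|x\|^\delta\,\Pi(\mathrm{d}x)<\infty$ for some $\delta>0$.
   Context: $\|\cdot\|$ is the Euclidean norm, $S^{d-1}$ the unit sphere, $N_d(0,I_d)$ the standard normal law on $\mathbb{R}^d$. Symmetrically regularly varying: a positive valued function $h$ on $\mathbb{R}^d$ is symmetrically regularly varying if there is $\lambda:\mathbb{R}^d\setminus\{0\}\to(0,\infty)$ with $\lambda(x)=1$ for all $x\in S^{d-1}$ such that $h(rx)/h(re)\to\lambda(x)$ as $r\to\infty$, locally uniformly in $x\in\mathbb{R}^d\setminus\{0\}$ (each point has a compact neighbourhood on which the convergence is uniform), where $e=(1,\ldots,1)/\sqrt d$. Then $\lambda(x)=\|x\|^{-\alpha}$ for some $\alpha\in\mathbb{R}$. MpCN kernel: let $Q(x,\cdot)$ be the law of $x^*=\rho^{1/2}x+(1-\rho)^{1/2}\|x\|\,w/\|\tilde w\|$ with $w,\tilde w\sim N_d(0,I_d)$ independent (equivalently, $x^*=\rho^{1/2}x+(1-\rho)^{1/2}r^{-1/2}w$ with $r$ independent of $w$ and Gamma distributed with density proportional to $t^{d/2-1}\exp(-\|x\|^2t/2)$). The kernel is $$P(x,\mathrm{d}y)=Q(x,\mathrm{d}y)a(x,y)+\delta_x(\mathrm{d}y)\Big(1-\int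 Q(x,\mathrm{d}z)a(x,z)\Big),\qquad a(x,y)=\min\Big\{1,\frac{\pi(y)\|y\|^{d}}{\pi(x)\|x\|^{d}}\Big\}\quad (x\neq0),$$ and $P(0,\cdot)=\delta_0$. Geometric ergodicity: a $\Pi$-invariant transition kernel $P$ on $E$ is geometrically ergodic if there exist a measurable $V:E\to[1,\infty]$ with $V<\infty$ $\Pi$-a.s., $\gamma\in(0,1)$ and $c<\infty$ such that $\|P^n(x,\cdot)-\Pi\|_V\le c\gamma^nV(x)$ for all $x\in E$, $n\ge1$, where $\|\nu\|_V=\sup_{|f|\le V}|\int f\,\mathrm{d}\nu|$. *)

theory Defs
  imports "HOL-Probability.Probability"
begin

definition unit_diag :: "real ^ 'd" where
  "unit_diag = (\<chi> i. 1 / sqrt (real CARD('d)))"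

text \<open>The limit \<open>l\<close> is a function on the punctured space: its value at \<open>0\<close> is never used.\<close>

definition symmetrically_regularly_varying :: "(real ^ 'd \<Rightarrow> real) \<Rightarrow> bool" where
  "symmetrically_regularly_varying h \<longleftrightarrow>
     (\<forall>x. 0 < h x) \<and>
     (\<exists>l :: real ^ 'd \<Rightarrow> real.
        (\<forall>x. x \<noteq> 0 \<longrightarrow> 0 < l x) \<and>
        (\<forall>x \<in> sphere 0 1. l x = 1) \<and>
        (\<forall>x. x \<noteq> 0 \<longrightarrow>
           (\<exists>K. compact K \<and> 0 \<notin> K \<and> x \<in> interior K \<and>
              uniform_limit K (\<lambda>r y. h (r *\<^sub>R y) / h (r *\<^sub>R unit_diag)) l at_top)))"

definition std_normal_vec :: "(real ^ 'd) measure" where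
  "std_normal_vec = density lborel (\<lambda>x. ennreal (\<Prod>i\<in>UNIV. std_normal_density (x $ i)))"

text \<open>Division by zero only occurs on the null event that the second normal vector vanishes.\<close>

definition mpcn_proposal :: "real \<Rightarrow> real ^ 'd \<Rightarrow> (real ^ 'd) measure" where
  "mpcn_proposal \<rho> x =
     distr (std_normal_vec \<Otimes>\<^sub>M std_normal_vec) borel
       (\<lambda>(w, w'). sqrt \<rho> *\<^sub>R x + (sqrt (1 - \<rho>) * norm x / norm (w' :: real ^ 'd)) *\<^sub>R w)"

definition mpcn_accept :: "(real ^ 'd \<Rightarrow> real) \<Rightarrow> real ^ 'd \<Rightarrow> real ^ 'd \<Rightarrow> real" where
  "mpcn_accept p x y = min 1 ((p y * norm y ^ CARD('d)) / (p x * norm x ^ CARD('d)))"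

definition mpcn_kernel ::
    "real \<Rightarrow> (real ^ 'd \<Rightarrow> real) \<Rightarrow> real ^ 'd \<Rightarrow> (real ^ 'd) measure" where
  "mpcn_kernel \<rho> p x =
     (if x = 0 then return borel 0
      else measure_of UNIV (sets borel)
        (\<lambda>A. (\<integral>\<^sup>+ y\<in>A. ennreal (mpcn_accept p x y) \<partial>mpcn_proposal \<rho> x)
           + indicator A x * (1 - (\<integral>\<^sup>+ z. ennreal (mpcn_accept p x z) \<partial>mpcn_proposal \<rho> x))))"

text \<open>The set function given to \<^const>\<open>measure_of\<close> is indeed a measure.\<close>

lemma emeasure_mpcn_kernel:
  fixes p :: "real ^ 'd \<Rightarrow> real"
  assumes p [measurable]: "p \<in> borel_measurable borel" and x: "x \<noteq> 0" and A: "A \<in> sets borel"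
  shows "emeasure (mpcn_kernel \<rho> p x) A =
    (\<integral>\<^sup>+ y\<in>A. ennreal (mpcn_accept p x y) \<partial>mpcn_proposal \<rho> x)
      + indicator A x * (1 - (\<integral>\<^sup>+ z. ennreal (mpcn_accept p x z) \<partial>mpcn_proposal \<rho> x))"
proof -
  let ?Q = "mpcn_proposal \<rho> x" and ?a = "\<lambda>y. ennreal (mpcn_accept p x y)"
  let ?c = "1 - (\<integral>\<^sup>+ z. ?a z \<partial>?Q)"
  have sQ: "sets ?Q = sets borel"
    by (simp add: mpcn_proposal_def)
  have a [measurable]: "?a \<in> borel_measurable ?Q"
    unfolding measurable_cong_sets[OF sQ refl] mpcn_accept_def by measurable
  have eq: "(\<integral>\<^sup>+ y\<in>B. ?a y \<partial>?Q) + indicator B x * ?c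
      = emeasure (density ?Q ?a) B + emeasure (density (return borel x) (\<lambda>_. ?c)) B"
    if "B \<in> sets borel" for B
    using that by (simp add: emeasure_density sQ nn_integral_return nn_integral_cmult mult.commute)
  have ca: "countably_additive (sets borel) (\<lambda>B. (\<integral>\<^sup>+ y\<in>B. ?a y \<partial>?Q) + indicator B x * ?c)"
  proof (rule countably_additiveI)
    fix F :: "nat \<Rightarrow> (real ^ 'd) set"
    assume F: "range F \<subseteq> sets borel" "disjoint_family F" "\<Union> (range F) \<in> sets borel"
    have Fi: "F i \<in> sets borel" for i using F(1) by auto
    have "(\<Sum>i. (\<integral>\<^sup>+ y\<in>F i. ?a y \<partial>?Q) + indicator (F i) x * ?c)
        = (\<Sum>i. emeasure (density ?Q ?a) (F i))
          + (\<Sum>i. emeasure (density (return borel x) (\<lambda>_. ?c)) (F i))"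
      by (simp add: eq[OF Fi] suminf_add)
    also have "\<dots> = emeasure (density ?Q ?a) (\<Union> (range F))
        + emeasure (density (return borel x) (\<lambda>_. ?c)) (\<Union> (range F))"
      using F by (simp add: suminf_emeasure sQ)
    finally show "(\<Sum>i. (\<integral>\<^sup>+ y\<in>F i. ?a y \<partial>?Q) + indicator (F i) x * ?c)
        = (\<integral>\<^sup>+ y\<in>\<Union> (range F). ?a y \<partial>?Q) + indicator (\<Union> (range F)) x * ?c"
      using F(3) by (simp add: eq)
  qed
  have sig: "sigma_sets UNIV (sets (borel :: (real ^ 'd) measure)) = sets borel"
    using sets.sigma_sets_eq[of "borel :: (real ^ 'd) measure"] by simp
  show ?thesis
    by (rule emeasure_measure_of[where \<Omega> = UNIV and A = "sets borel"
        and \<mu> = "\<lambda>B. (\<integral>\<^sup>+ y\<in>B. ?a y \<partial>?Q) + indicator B x * ?c"])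
      (use x A ca in \<open>auto simp: mpcn_kernel_def positive_def sig\<close>)
qed

definition kernel_power :: "'a measure \<Rightarrow> ('a \<Rightarrow> 'a measure) \<Rightarrow> nat \<Rightarrow> 'a \<Rightarrow> 'a measure" where
  "kernel_power M P n x = ((\<lambda>\<mu>. \<mu> \<bind> P) ^^ n) (return M x)"

text \<open>
  The \<open>V\<close>-norm of the signed measure \<open>\<mu> - \<nu>\<close>. The test functions range over those with a
  well-defined finite integral against \<open>\<mu> - \<nu>\<close>. They include all bounded ones, so the supremum is
  \<open>\<integral> V d|\<mu> - \<nu>|\<close>, also when this is infinite.
\<close>

definition V_norm_diff :: "('a \<Rightarrow> ennreal) \<Rightarrow> 'a measure \<Rightarrow> 'a measure \<Rightarrow> ennreal" where
  "V_norm_diff V \<mu> \<nu> =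
     (SUP f \<in> {f :: 'a \<Rightarrow> real. integrable \<mu> f \<and> integrable \<nu> f \<and>
                 (\<forall>x\<in>space \<nu>. ennreal \<bar>f x\<bar> \<le> V x)}.
        ennreal \<bar>(\<integral>x. f x \<partial>\<mu>) - (\<integral>x. f x \<partial>\<nu>)\<bar>)"

text \<open>Being an \<open>M\<close>-invariant transition kernel on the measurable space underlying \<open>M\<close> is part of the
  notion.\<close>

definition geometrically_ergodic :: "'a measure \<Rightarrow> ('a \<Rightarrow> 'a measure) \<Rightarrow> bool" where
  "geometrically_ergodic M P \<longleftrightarrow>
     P \<in> M \<rightarrow>\<^sub>M prob_algebra M \<and> M \<bind> P = M \<and>
     (\<exists>V \<in> borel_measurable M. \<exists>\<gamma>::real. \<exists>c::ennreal.
        (\<forall>x\<in>space M. 1 \<le> V x) \<and> (AE x in M. V x < \<infinity>) \<and>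
        0 < \<gamma> \<and> \<gamma> < 1 \<and> c < \<infinity> \<and>
        (\<forall>x\<in>space M. \<forall>n\<ge>1.
           V_norm_diff V (kernel_power M P n x) M \<le> c * ennreal (\<gamma> ^ n) * V x))"

end

theory Submission
  imports Defs
begin

text \<open>
  The proposal has the density \<open>c \<parallel>x\<parallel>\<^sup>d / (\<parallel>x\<parallel>\<^sup>2 + \<parallel>y\<parallel>\<^sup>2 - 2 \<surd>\<rho> \<langle>x, y\<rangle>)\<^sup>d\<close>. The denominator is symmetric,
  so the kernel is reversible, and it is homogeneous, so that in the coordinates \<open>y = \<parallel>x\<parallel> z\<close> the
  proposal depends only on the direction of \<open>x\<close>.

  If the chain is geometrically ergodic, then \<open>n \<mapsto> \<parallel>P\<^sup>n f - \<Pi> f\<parallel>\<^sup>2\<close> (norm of \<open>L\<^sup>2(\<Pi>)\<close>) is log-convex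
  and decays at a geometric rate, the same for all bounded \<open>f\<close> supported on a sublevel set of \<open>V\<close>.
  This yields a spectral gap, hence a lower bound on the flow out of \<open>{\<parallel>x\<parallel> > R}\<close>.
  A proposal from \<open>x\<close> enters the ball of radius \<open>R\<close>
  with probability \<open>O((R / \<parallel>x\<parallel>)\<^sup>d)\<close>, so the tail \<open>\<Pi>{\<parallel>x\<parallel> > R}\<close> shrinks by a fixed factor when \<open>R\<close> is
  multiplied by a large constant, and a moment is finite.

  Conversely, a finite moment of order \<open>\<delta>'\<close> forces \<open>\<pi>(r z) \<parallel>r z\<parallel>\<^sup>d / \<pi>(r \<theta>) r\<^sup>d\<close> to have a limit of at
  most \<open>\<parallel>z\<parallel>\<close> to the power \<open>-\<delta>'\<close> for \<open>\<parallel>z\<parallel> > 1\<close>. With the Lyapunov function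
  \<open>\<parallel>x\<parallel>\<^sup>\<delta> + 1 / \<parallel>x\<parallel>\<^sup>\<delta>\<close>, the relative drift converges, as \<open>\<parallel>x\<parallel>\<close> tends to \<open>\<infinity>\<close> or to \<open>0\<close>, to an integral
  which is negative because the limiting proposal is invariant under the inversion
  \<open>z \<mapsto> z / \<parallel>z\<parallel>\<^sup>2\<close>: the contributions of \<open>z\<close> and of its image add up to a negative number. Harris's
  theorem in the form of Hairer and Mattingly, stated for bounded test functions, concludes.
\<close>

section \<open>Invariant kernels acting on bounded functions\<close>

text \<open>The origin is the obstacle: it is absorbing, and close to it the kernel almost commutes
  with dilations, so it acts as a second end of the space beside infinity. Harris's theorem is
  therefore run off the origin, with \<open>V\<close> infinite at \<open>0\<close>, and the Lyapunov
  function has to be large at both ends. The two ends share one argument with different limits. A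
  point with Lyapunov ratio a and acceptance ratio b is paired with its inverse, which has 1/a and
  1/b; the pair contributes a negative amount as soon as a and ab lie on opposite sides of 1. For
  \<open>1 < norm z\<close>, at infinity a is \<open>norm z powr \<delta>\<close> and the moment
  makes b smaller than 1/a; at the origin a is \<open>norm z powr - \<delta>\<close> and b is
  \<open>norm z ^ CARD('d)\<close>, because \<pi> is nearly constant there. So \<delta> is taken
  below the order of the given moment and below 1. Directions need not converge, hence the passage
  to subsequences in the compact sphere. For the converse, the constant in front of \<gamma>^n
  depends on the level of \<open>V\<close>; log-convexity discards this constant and keeps the
  rate.\<close>

definition kernel_op :: "('a \<Rightarrow> 'a measure) \<Rightarrow> ('a \<Rightarrow> real) \<Rightarrow> 'a \<Rightarrow> real" where
  "kernel_op P f x = (\<integral>y. f y \<partial>P x)"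

definition bdd_measurable :: "'a measure \<Rightarrow> ('a \<Rightarrow> real) set" where
  "bdd_measurable M = {f \<in> borel_measurable M. \<exists>B. \<forall>x\<in>space M. \<bar>f x\<bar> \<le> B}"

lemma bdd_measurableI:
  "f \<in> borel_measurable M \<Longrightarrow> (\<And>x. x \<in> space M \<Longrightarrow> \<bar>f x\<bar> \<le> B) \<Longrightarrow> f \<in> bdd_measurable M"
  by (auto simp: bdd_measurable_def)

lemma bdd_measurable_measurable [measurable_dest]: "f \<in> bdd_measurable M \<Longrightarrow> f \<in> borel_measurable M"
  by (simp add: bdd_measurable_def)

lemma bdd_measurableD:
  assumes "f \<in> bdd_measurable M"
  shows "\<exists>B\<ge>0. \<forall>x\<in>space M. \<bar>f x\<bar> \<le> B"
proof -
  from assms obtain B where "\<forall>x\<in>space M. \<bar>f x\<bar> \<le> B"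
    by (auto simp: bdd_measurable_def)
  then have "\<forall>x\<in>space M. \<bar>f x\<bar> \<le> \<bar>B\<bar>"
    by force
  then show ?thesis
    by (intro exI[of _ "\<bar>B\<bar>"]) auto
qed

lemma bdd_measurable_diff:
  assumes "f \<in> bdd_measurable M" "g \<in> bdd_measurable M"
  shows "(\<lambda>x. f x - g x) \<in> bdd_measurable M"
proof -
  obtain B where B: "0 \<le> B" "\<And>x. x \<in> space M \<Longrightarrow> \<bar>f x\<bar> \<le> B"
    using bdd_measurableD[OF assms(1)] by blast
  obtain C where C: "0 \<le> C" "\<And>x. x \<in> space M \<Longrightarrow> \<bar>g x\<bar> \<le> C"
    using bdd_measurableD[OF assms(2)] by blast
  show ?thesis
  proof (rule bdd_measurableI)
    show "\<bar>f x - g x\<bar> \<le> B + C" if "x \<in> space M" for x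
      using B(2)[OF that] C(2)[OF that] by linarith
  qed (use assms in \<open>auto simp: bdd_measurable_def\<close>)
qed

lemma bdd_measurable_mult:
  assumes "f \<in> bdd_measurable M" "g \<in> bdd_measurable M"
  shows "(\<lambda>x. f x * g x) \<in> bdd_measurable M"
proof -
  obtain B where B: "0 \<le> B" "\<And>x. x \<in> space M \<Longrightarrow> \<bar>f x\<bar> \<le> B"
    using bdd_measurableD[OF assms(1)] by blast
  obtain C where C: "0 \<le> C" "\<And>x. x \<in> space M \<Longrightarrow> \<bar>g x\<bar> \<le> C"
    using bdd_measurableD[OF assms(2)] by blast
  show ?thesis
  proof (rule bdd_measurableI)
    show "\<bar>f x * g x\<bar> \<le> B * C" if "x \<in> space M" for x
      using B C that by (auto simp: abs_mult intro!: mult_mono)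
  qed (use assms in \<open>auto simp: bdd_measurable_def\<close>)
qed

lemma bdd_measurable_const [simp]: "(\<lambda>_. c) \<in> bdd_measurable M"
  by (rule bdd_measurableI[where B = "\<bar>c\<bar>"]) auto

lemma bdd_measurable_indicator: "A \<in> sets M \<Longrightarrow> indicator A \<in> bdd_measurable M"
  by (rule bdd_measurableI[where B = 1]) (auto simp: indicator_def)

lemma bdd_measurable_integrable:
  assumes "f \<in> bdd_measurable M" "finite_measure N" "sets N = sets M"
  shows "integrable N f"
proof -
  obtain B where B: "\<And>x. x \<in> space M \<Longrightarrow> \<bar>f x\<bar> \<le> B"
    using bdd_measurableD[OF assms(1)] by blast
  have "f \<in> borel_measurable N"
    using assms(1) measurable_cong_sets[OF assms(3) refl] by (auto simp: bdd_measurable_def)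
  then show ?thesis
    using B sets_eq_imp_space_eq[OF assms(3)]
    by (intro finite_measure.integrable_const_bound[OF assms(2), where B = B]) auto
qed

locale invariant_kernel = prob_space M for M :: "'a measure" +
  fixes P :: "'a \<Rightarrow> 'a measure"
  assumes kernel [measurable]: "P \<in> M \<rightarrow>\<^sub>M prob_algebra M"
    and invariant: "M \<bind> P = M"
begin

lemma kernel_subprob [measurable]: "P \<in> M \<rightarrow>\<^sub>M subprob_algebra M"
  using kernel by (rule measurable_prob_algebraD)

lemma sets_P: "x \<in> space M \<Longrightarrow> sets (P x) = sets M"
  and prob_space_P: "x \<in> space M \<Longrightarrow> prob_space (P x)"
  using measurable_space[OF kernel] by (auto simp: space_prob_algebra)

lemma space_P: "x \<in> space M \<Longrightarrow> space (P x) = space M"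
  using sets_P sets_eq_imp_space_eq by blast

lemma integrable_P: "f \<in> bdd_measurable M \<Longrightarrow> x \<in> space M \<Longrightarrow> integrable (P x) f"
  by (rule bdd_measurable_integrable[OF _ prob_space.finite_measure[OF prob_space_P] sets_P])

lemma integrable_M: "f \<in> bdd_measurable M \<Longrightarrow> integrable M f"
  by (rule bdd_measurable_integrable[OF _ finite_measure_axioms refl])

lemma kernel_op_le:
  assumes "f \<in> bdd_measurable M" "x \<in> space M" "\<And>y. y \<in> space M \<Longrightarrow> f y \<le> B"
  shows "kernel_op P f x \<le> B"
  unfolding kernel_op_def
  using assms space_P[OF assms(2)] by (intro prob_space.integral_le_const prob_space_P integrable_P) auto

lemma kernel_op_ge:
  assumes "f \<in> bdd_measurable M" "x \<in> space M" "\<And>y. y \<in> space M \<Longrightarrow> B \<le> f y"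
  shows "B \<le> kernel_op P f x"
  unfolding kernel_op_def
  using assms space_P[OF assms(2)] by (intro prob_space.integral_ge_const prob_space_P integrable_P) auto

lemma kernel_op_bdd:
  assumes f: "f \<in> bdd_measurable M"
  shows "kernel_op P f \<in> bdd_measurable M"
proof -
  obtain B where B: "\<And>x. x \<in> space M \<Longrightarrow> \<bar>f x\<bar> \<le> B"
    using bdd_measurableD[OF f] by blast
  note [measurable] = f
  show ?thesis
  proof (rule bdd_measurableI)
    show "kernel_op P f \<in> borel_measurable M"
      unfolding kernel_op_def by measurable
    show "\<bar>kernel_op P f x\<bar> \<le> B" if "x \<in> space M" for x
      using kernel_op_le[OF f that, of B] kernel_op_ge[OF f that, of "-B"] B
      by (meson abs_le_D1 abs_le_D2 abs_leI minus_le_iff)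
  qed
qed

lemma kernel_op_iter_bdd: "f \<in> bdd_measurable M \<Longrightarrow> (kernel_op P ^^ n) f \<in> bdd_measurable M"
  by (induction n) (auto intro: kernel_op_bdd)

lemma kernel_op_diff:
  "f \<in> bdd_measurable M \<Longrightarrow> g \<in> bdd_measurable M \<Longrightarrow> x \<in> space M \<Longrightarrow>
    kernel_op P (\<lambda>x. f x - g x) x = kernel_op P f x - kernel_op P g x"
  unfolding kernel_op_def by (intro Bochner_Integration.integral_diff integrable_P)

lemma kernel_op_const: "x \<in> space M \<Longrightarrow> kernel_op P (\<lambda>_. c) x = c"
  using prob_space.prob_space[OF prob_space_P] by (simp add: kernel_op_def)

lemma kernel_op_cong:
  "x \<in> space M \<Longrightarrow> (\<And>y. y \<in> space M \<Longrightarrow> f y = g y) \<Longrightarrow> kernel_op P f x = kernel_op P g x"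
  unfolding kernel_op_def using space_P by (intro Bochner_Integration.integral_cong) auto

section \<open>Integrals against iterates of the kernel\<close>

lemma integral_bind_bdd:
  assumes f: "f \<in> bdd_measurable M" and \<mu>: "\<mu> \<in> space (prob_algebra M)"
  shows "(\<integral>x. f x \<partial>(\<mu> \<bind> P)) = (\<integral>x. kernel_op P f x \<partial>\<mu>)"
proof -
  obtain B where B: "\<And>x. x \<in> space M \<Longrightarrow> \<bar>f x\<bar> \<le> B"
    using bdd_measurableD[OF f] by blast
  have s: "sets \<mu> = sets M" and p: "prob_space \<mu>" using \<mu> by (auto simp: space_prob_algebra)
  have [measurable]: "P \<in> \<mu> \<rightarrow>\<^sub>M subprob_algebra M"
    using kernel_subprob measurable_cong_sets[OF s refl] by blast
  have "emeasure (P x) (space (P x)) \<le> ennreal 1" if "x \<in> space \<mu>" for x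
    using that prob_space.emeasure_space_1[OF prob_space_P, of x] sets_eq_imp_space_eq[OF s] by simp
  then show ?thesis
    unfolding kernel_op_def using f B p
    by (intro integral_bind[where K = M and B = B and B' = 1])
       (auto simp: bdd_measurable_def prob_space.finite_measure)
qed

lemma integral_kernel_op: "f \<in> bdd_measurable M \<Longrightarrow> (\<integral>x. kernel_op P f x \<partial>M) = (\<integral>x. f x \<partial>M)"
  using integral_bind_bdd[of f M] invariant prob_space_axioms by (simp add: space_prob_algebra)

lemma integral_kernel_op_iter:
  "f \<in> bdd_measurable M \<Longrightarrow> (\<integral>x. (kernel_op P ^^ n) f x \<partial>M) = (\<integral>x. f x \<partial>M)"
  by (induction n) (auto simp: integral_kernel_op kernel_op_iter_bdd)

lemma bind_prob_algebra:
  assumes "\<mu> \<in> space (prob_algebra M)"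
  shows "\<mu> \<bind> P \<in> space (prob_algebra M)"
  using prob_space_bind'[OF assms kernel] sets_bind'[OF assms kernel]
  by (simp add: space_prob_algebra)

lemma kernel_power_prob_algebra:
  "\<mu> \<in> space (prob_algebra M) \<Longrightarrow> ((\<lambda>\<mu>. \<mu> \<bind> P) ^^ n) \<mu> \<in> space (prob_algebra M)"
  by (induction n) (auto intro: bind_prob_algebra)

lemma integral_kernel_power:
  assumes f: "f \<in> bdd_measurable M" and x: "x \<in> space M"
  shows "(\<integral>y. f y \<partial>kernel_power M P n x) = (kernel_op P ^^ n) f x"
proof -
  have \<mu>: "return M x \<in> space (prob_algebra M)"
    using x by (auto simp: space_prob_algebra intro: prob_space_return)
  have "(\<integral>y. f y \<partial>(((\<lambda>\<mu>. \<mu> \<bind> P) ^^ n) (return M x))) = (\<integral>y. (kernel_op P ^^ n) f y \<partial>return M x)"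
    using f
  proof (induction n arbitrary: f)
    case (Suc n)
    have "(\<integral>y. f y \<partial>(((\<lambda>\<mu>. \<mu> \<bind> P) ^^ Suc n) (return M x)))
        = (\<integral>y. kernel_op P f y \<partial>(((\<lambda>\<mu>. \<mu> \<bind> P) ^^ n) (return M x)))"
      using integral_bind_bdd[OF Suc.prems kernel_power_prob_algebra[OF \<mu>, of n]] by simp
    also have "\<dots> = (\<integral>y. (kernel_op P ^^ n) (kernel_op P f) y \<partial>return M x)"
      by (intro Suc.IH kernel_op_bdd Suc.prems)
    finally show ?case
      by (simp only: funpow_Suc_right comp_def)
  qed simp
  also have "\<dots> = (kernel_op P ^^ n) f x"
    using x kernel_op_iter_bdd[OF f] by (intro integral_return) (auto simp: bdd_measurable_def)
  finally show ?thesis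
    by (simp add: kernel_power_def)
qed

lemma kernel_power_sets_prob:
  assumes "x \<in> space M"
  shows "sets (kernel_power M P n x) = sets M" "prob_space (kernel_power M P n x)"
  using kernel_power_prob_algebra[of "return M x" n] assms
  by (auto simp: space_prob_algebra kernel_power_def intro: prob_space_return)

text \<open>Reduces the possibly unbounded test functions of \<open>V_norm_diff\<close> to bounded
  ones: clipping at -k and k keeps |f| below \<open>V\<close>, and dominated convergence under both
  measures carries the bound \<open>C\<close> to the limit.\<close>

lemma V_norm_diff_kernel_power_le:
  assumes x: "x \<in> space M"
    and le: "\<And>f. f \<in> bdd_measurable M \<Longrightarrow> (\<And>y. y \<in> space M \<Longrightarrow> ennreal \<bar>f y\<bar> \<le> V y) \<Longrightarrow>
      \<bar>(kernel_op P ^^ n) f x - (\<integral>y. f y \<partial>M)\<bar> \<le> C"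
  shows "V_norm_diff V (kernel_power M P n x) M \<le> ennreal C"
  unfolding V_norm_diff_def
proof (rule SUP_least, clarsimp)
  let ?N = "kernel_power M P n x"
  fix f :: "'a \<Rightarrow> real"
  assume f1: "integrable ?N f" and f2: "integrable M f"
    and V: "\<forall>x\<in>space M. ennreal \<bar>f x\<bar> \<le> V x"
  define g where "g k y = max (- real k) (min (real k) (f y))" for k y
  have fm [measurable]: "f \<in> borel_measurable M" using f2 by auto
  have gb: "g k \<in> bdd_measurable M" for k
    by (rule bdd_measurableI[where B = "real k"]) (auto simp: g_def[abs_def])
  have gf: "\<bar>g k y\<bar> \<le> \<bar>f y\<bar>" for k y by (auto simp: g_def)
  have gl: "(\<lambda>k. g k y) \<longlonglongrightarrow> f y" for y
  proof (rule tendsto_eventually)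
    obtain K :: nat where K: "\<bar>f y\<bar> \<le> real K" using real_arch_simple by blast
    show "\<forall>\<^sub>F k in sequentially. g k y = f y"
      using eventually_ge_at_top[of K] by eventually_elim (use K in \<open>auto simp: g_def\<close>)
  qed
  have lim: "(\<lambda>k. \<integral>y. g k y \<partial>N) \<longlonglongrightarrow> (\<integral>y. f y \<partial>N)"
    if "integrable N f" "sets N = sets M" for N
  proof (rule integral_dominated_convergence[where w = "\<lambda>y. \<bar>f y\<bar>"])
    show "g k \<in> borel_measurable N" for k
      using gb[of k] measurable_cong_sets[OF that(2) refl] by (auto simp: bdd_measurable_def)
  qed (use that gf gl in auto)
  have l1: "(\<lambda>k. \<bar>(\<integral>y. g k y \<partial>?N) - (\<integral>y. g k y \<partial>M)\<bar>) \<longlonglongrightarrow> \<bar>(\<integral>y. f y \<partial>?N) - (\<integral>y. f y \<partial>M)\<bar>"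
    by (intro tendsto_intros lim f1 f2 refl kernel_power_sets_prob x)
  have l2: "\<bar>(\<integral>y. g k y \<partial>?N) - (\<integral>y. g k y \<partial>M)\<bar> \<le> C" for k
  proof -
    have "ennreal \<bar>g k y\<bar> \<le> V y" if "y \<in> space M" for y
      using V that gf[of k y] by (meson ennreal_leI order_trans)
    from le[OF gb this] show ?thesis
      by (simp add: integral_kernel_power[OF gb x])
  qed
  have "\<bar>(\<integral>y. f y \<partial>?N) - (\<integral>y. f y \<partial>M)\<bar> \<le> C"
    by (rule LIMSEQ_le_const2[OF l1]) (use l2 in auto)
  then show "ennreal \<bar>(\<integral>y. f y \<partial>?N) - (\<integral>y. f y \<partial>M)\<bar> \<le> ennreal C"
    by (rule ennreal_leI)
qed

end

section \<open>Harris's theorem\<close>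

text \<open>Nonnegativity is asked only up to null sets of the larger measure, which are null for
  the smaller one too. This is the form available in the minorization step, where bounds hold only
  on the set \<open>S\<close> that carries the kernel.\<close>

lemma integral_le_of_emeasure_le:
  fixes g :: "'a \<Rightarrow> real"
  assumes s: "sets N = sets Q" and le: "\<And>A. A \<in> sets Q \<Longrightarrow> emeasure N A \<le> emeasure Q A"
    and g: "integrable Q g" and nn: "AE x in Q. 0 \<le> g x"
  shows "integrable N g" "(\<integral>x. g x \<partial>N) \<le> (\<integral>x. g x \<partial>Q)"
proof -
  have NQ: "N \<le> Q" using s le by (simp add: le_measure)
  have [measurable]: "g \<in> borel_measurable Q" using g by auto
  have gN [measurable]: "g \<in> borel_measurable N" using g measurable_cong_sets[OF s refl, of borel] by auto
  have mono: "integral\<^sup>N N h \<le> integral\<^sup>N Q h" for h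
    by (rule nn_integral_mono_measure[OF s NQ])
  show int: "integrable N g"
    using g mono[of "\<lambda>x. ennreal (norm (g x))"] gN
    by (auto simp: integrable_iff_bounded intro: le_less_trans)
  have sp: "space N = space Q" using s by (rule sets_eq_imp_space_eq)
  have "{x\<in>space Q. \<not> 0 \<le> g x} \<in> null_sets Q"
    using AE_iff_null_sets[of "{x\<in>space Q. \<not> 0 \<le> g x}" Q] nn by (auto elim: AE_mp)
  then have "{x\<in>space N. \<not> 0 \<le> g x} \<in> null_sets N"
    using le[of "{x\<in>space Q. \<not> 0 \<le> g x}"] s by (auto simp: null_sets_def sp)
  then have nnN: "AE x in N. 0 \<le> g x"
    by (rule AE_I') auto
  have "ennreal (\<integral>x. g x \<partial>N) \<le> ennreal (\<integral>x. g x \<partial>Q)"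
    using mono[of "\<lambda>x. ennreal (g x)"] nn_integral_eq_integral[OF int nnN] nn_integral_eq_integral[OF g nn]
    by simp
  then show "(\<integral>x. g x \<partial>N) \<le> (\<integral>x. g x \<partial>Q)"
    using integral_nonneg_AE[OF nn] by simp
qed

text \<open>Any c between the supremum of f - g and the infimum of f + g will do, and the
  oscillation bound says exactly that the former does not exceed the latter. A weighted oscillation
  bound thus becomes a weighted uniform bound after subtracting a constant.\<close>

lemma ex_centering:
  fixes f g :: "'a \<Rightarrow> real"
  assumes "S \<noteq> {}" and osc: "\<And>x y. x \<in> S \<Longrightarrow> y \<in> S \<Longrightarrow> f x - f y \<le> g x + g y"
  shows "\<exists>c. \<forall>x\<in>S. \<bar>f x - c\<bar> \<le> g x"
proof -
  obtain x0 where x0: "x0 \<in> S" using assms(1) by blast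
  let ?c = "SUP z\<in>S. f z - g z"
  have bdd: "bdd_above ((\<lambda>z. f z - g z) ` S)"
    using osc[OF _ x0] by (intro bdd_aboveI2[where M = "f x0 + g x0"]) (simp add: algebra_simps)
  show ?thesis
  proof (intro exI[of _ ?c] ballI)
    fix x assume x: "x \<in> S"
    have "f x - g x \<le> ?c" using bdd x by (intro cSUP_upper)
    moreover have "?c \<le> f x + g x"
      using osc[OF _ x] assms(1) by (intro cSUP_least) (auto simp: algebra_simps)
    ultimately show "\<bar>f x - ?c\<bar> \<le> g x" by linarith
  qed
qed

context invariant_kernel
begin

text \<open>One step of the Hairer-Mattingly contraction for the oscillation weighted by 1 + \<beta>
  W. If \<open>W x + W y\<close> is at least \<open>R\<close>, the drift alone shrinks the weight
  (\<open>far\<close>). Otherwise both points lie in the sublevel set, and the common part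
  \<open>N\<close> of \<open>P x\<close> and \<open>P y\<close> removes 2a from the constant term
  (\<open>near\<close>).\<close>

lemma harris_contraction:
  fixes W :: "'a \<Rightarrow> real"
  assumes S: "S \<subseteq> space M" and PS: "\<And>x. x \<in> S \<Longrightarrow> AE y in P x. y \<in> S"
    and W [measurable]: "W \<in> borel_measurable M" and W0: "\<And>x. 0 \<le> W x"
    and \<gamma>: "0 \<le> \<gamma>" "\<gamma> \<le> \<kappa>" "0 \<le> K" "0 < \<beta>"
    and drift: "\<And>x. x \<in> S \<Longrightarrow> (\<integral>\<^sup>+y. W y \<partial>P x) \<le> ennreal (\<gamma> * W x + K)"
    and N: "sets N = sets M" "finite_measure N" "a \<le> measure N (space N)"
    and minor: "\<And>x A. x \<in> S \<Longrightarrow> W x \<le> R \<Longrightarrow> A \<in> sets M \<Longrightarrow> emeasure N A \<le> emeasure (P x) A"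
    and far: "2 + \<beta> * \<gamma> * R + 2 * \<beta> * K \<le> \<kappa> * (2 + \<beta> * R)"
    and near: "2 + 2 * \<beta> * K - 2 * a \<le> 2 * \<kappa>"
    and f: "f \<in> bdd_measurable M" and L: "0 \<le> L"
    and osc: "\<And>x y. x \<in> S \<Longrightarrow> y \<in> S \<Longrightarrow> \<bar>f x - f y\<bar> \<le> L * (2 + \<beta> * (W x + W y))"
    and xy: "x \<in> S" "y \<in> S"
  shows "kernel_op P f x - kernel_op P f y \<le> \<kappa> * L * (2 + \<beta> * (W x + W y))"
proof -
  define \<phi> where "\<phi> z = L * (1 + \<beta> * W z)" for z
  have [measurable]: "\<phi> \<in> borel_measurable M" unfolding \<phi>_def by measurable
  obtain c where c: "\<And>z. z \<in> S \<Longrightarrow> \<bar>f z - c\<bar> \<le> \<phi> z"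
  proof -
    have "f u - f v \<le> \<phi> u + \<phi> v" if "u \<in> S" "v \<in> S" for u v
      using osc[OF that] by (auto simp: \<phi>_def algebra_simps)
    with ex_centering[of S f \<phi>] xy that show ?thesis by blast
  qed
  define h where "h z = f z - c" for z
  have hb: "h \<in> bdd_measurable M"
    unfolding h_def by (intro bdd_measurable_diff f bdd_measurable_const)
  have hop: "kernel_op P f z = (\<integral>u. h u \<partial>P z) + c" if "z \<in> S" for z
  proof -
    have z: "z \<in> space M" using S that by blast
    have "(\<integral>u. h u \<partial>P z) = kernel_op P f z - kernel_op P (\<lambda>_. c) z"
      using kernel_op_diff[OF f bdd_measurable_const z, of c] by (simp add: kernel_op_def h_def)
    then show ?thesis by (simp add: kernel_op_const[OF z])
  qed
  have W_int: "integrable (P z) W" and W_le: "(\<integral>u. W u \<partial>P z) \<le> \<gamma> * W z + K" if "z \<in> S" for z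
  proof -
    have z: "z \<in> space M" using S that by blast
    have m: "W \<in> borel_measurable (P z)"
      using W measurable_cong_sets[OF sets_P[OF z] refl] by blast
    show int: "integrable (P z) W"
      using drift[OF that] m W0 by (intro integrableI_nonneg) (auto intro: le_less_trans)
    have "ennreal (\<integral>u. W u \<partial>P z) \<le> ennreal (\<gamma> * W z + K)"
      using drift[OF that] nn_integral_eq_integral[OF int] W0 by simp
    then show "(\<integral>u. W u \<partial>P z) \<le> \<gamma> * W z + K"
      using W0 \<gamma> by (subst (asm) ennreal_le_iff) auto
  qed
  have \<phi>_int: "integrable (P z) \<phi>" and \<phi>_le: "(\<integral>u. \<phi> u \<partial>P z) \<le> L * (1 + \<beta> * (\<gamma> * W z + K))" if "z \<in> S" for z
  proof -
    have z: "z \<in> space M" using S that by blast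
    interpret Pz: prob_space "P z" using z by (rule prob_space_P)
    show "integrable (P z) \<phi>"
      unfolding \<phi>_def using W_int[OF that] by auto
    have "(\<integral>u. \<phi> u \<partial>P z) = L * (1 + \<beta> * (\<integral>u. W u \<partial>P z))"
      unfolding \<phi>_def using W_int[OF that] by (simp add: Pz.prob_space)
    then show "(\<integral>u. \<phi> u \<partial>P z) \<le> L * (1 + \<beta> * (\<gamma> * W z + K))"
      using W_le[OF that] L \<gamma> by (auto intro!: mult_left_mono)
  qed
  have h_int: "integrable (P z) h" if "z \<in> S" for z
    using integrable_P[OF hb] S that by blast
  have AE_abs: "AE u in P z. \<bar>h u\<bar> \<le> \<phi> u" if "z \<in> S" for z
    using PS[OF that] by eventually_elim (use c in \<open>auto simp: h_def\<close>)
  have sum_le: "(\<integral>u. \<phi> u \<partial>P x) + (\<integral>u. \<phi> u \<partial>P y) \<le> L * (2 + \<beta> * \<gamma> * (W x + W y) + 2 * \<beta> * K)"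
    using \<phi>_le[OF xy(1)] \<phi>_le[OF xy(2)] by (simp add: algebra_simps)
  show ?thesis
  proof (cases "R \<le> W x + W y")
    case True
    have "(\<integral>u. h u \<partial>P x) \<le> (\<integral>u. \<phi> u \<partial>P x)"
      using AE_abs[OF xy(1)] by (intro integral_mono_AE h_int \<phi>_int xy) auto
    moreover have "(\<integral>u. - h u \<partial>P y) \<le> (\<integral>u. \<phi> u \<partial>P y)"
      using AE_abs[OF xy(2)] by (intro integral_mono_AE integrable_minus h_int \<phi>_int xy) auto
    ultimately have "kernel_op P f x - kernel_op P f y \<le> L * (2 + \<beta> * \<gamma> * (W x + W y) + 2 * \<beta> * K)"
      using sum_le hop xy by simp
    also have "\<dots> \<le> L * (\<kappa> * (2 + \<beta> * (W x + W y)))"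
    proof (rule mult_left_mono[OF _ L])
      \<comment> \<open>\<open>far\<close> is the claim at W x + W y = R. Beyond R the left side
        grows with slope \<beta> \<gamma> and the right side with the slope \<beta> \<kappa>, which
        is at least as large.\<close>
      have "\<beta> * \<gamma> * (W x + W y - R) \<le> \<beta> * \<kappa> * (W x + W y - R)"
        using True \<gamma> by (intro mult_right_mono mult_left_mono) auto
      then show "2 + \<beta> * \<gamma> * (W x + W y) + 2 * \<beta> * K \<le> \<kappa> * (2 + \<beta> * (W x + W y))"
        using far by (simp add: algebra_simps)
    qed
    finally show ?thesis by (simp add: algebra_simps)
  next
    case False
    then have Wxy: "W x \<le> R" "W y \<le> R" using W0[of x] W0[of y] by auto
    have xyM: "x \<in> space M" "y \<in> space M" using S xy by auto
    have sN: "sets N = sets (P z)" if "z \<in> S" for z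
      using N(1) sets_P S that by auto
    have mx: "emeasure N A \<le> emeasure (P x) A" if "A \<in> sets (P x)" for A
      using minor[OF xy(1) Wxy(1)] that sets_P[OF xyM(1)] by simp
    have my: "emeasure N A \<le> emeasure (P y) A" if "A \<in> sets (P y)" for A
      using minor[OF xy(2) Wxy(2)] that sets_P[OF xyM(2)] by simp
    have ix: "integrable (P x) (\<lambda>u. \<phi> u - h u)" "AE u in P x. 0 \<le> \<phi> u - h u"
      using \<phi>_int h_int xy AE_abs[OF xy(1)] by auto
    have iy: "integrable (P y) (\<lambda>u. \<phi> u + h u)" "AE u in P y. 0 \<le> \<phi> u + h u"
      using \<phi>_int h_int xy AE_abs[OF xy(2)] by auto
    note rx = integral_le_of_emeasure_le[OF sN[OF xy(1)] mx ix]
    note ry = integral_le_of_emeasure_le[OF sN[OF xy(2)] my iy]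
    interpret N: finite_measure N by fact
    \<comment> \<open>Passing from \<open>P x\<close> and \<open>P y\<close> to \<open>N\<close> can
      only decrease the integrals of the nonnegative functions \<phi> - h and \<phi> + h. Over
      \<open>N\<close> the two h cancel and the sum 2\<phi> is at least 2L.\<close>
    have "2 * (L * a) \<le> (\<integral>u. 2 * L \<partial>N)"
      using mult_left_mono[OF N(3) L] by (simp add: mult_ac)
    also have "\<dots> \<le> (\<integral>u. (\<phi> u - h u) + (\<phi> u + h u) \<partial>N)"
    proof (rule integral_mono)
      show "integrable N (\<lambda>u. (\<phi> u - h u) + (\<phi> u + h u))"
        using rx(1) ry(1) by (rule Bochner_Integration.integrable_add)
      show "2 * L \<le> (\<phi> u - h u) + (\<phi> u + h u)" for u
        using W0[of u] L \<gamma> by (simp add: \<phi>_def algebra_simps)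
    qed auto
    also have "\<dots> = (\<integral>u. \<phi> u - h u \<partial>N) + (\<integral>u. \<phi> u + h u \<partial>N)"
      using rx(1) ry(1) by (rule Bochner_Integration.integral_add)
    also have "\<dots> \<le> (\<integral>u. \<phi> u - h u \<partial>P x) + (\<integral>u. \<phi> u + h u \<partial>P y)"
      using rx(2) ry(2) by (rule add_mono)
    also have "\<dots> = (\<integral>u. \<phi> u \<partial>P x) - (\<integral>u. h u \<partial>P x) + ((\<integral>u. \<phi> u \<partial>P y) + (\<integral>u. h u \<partial>P y))"
      using \<phi>_int h_int xy by simp
    finally have "kernel_op P f x - kernel_op P f y
        \<le> L * (2 + \<beta> * \<gamma> * (W x + W y) + 2 * \<beta> * K) - 2 * (L * a)"
      using sum_le hop xy by simp
    also have "\<dots> = L * ((2 + 2 * \<beta> * K - 2 * a) + \<beta> * \<gamma> * (W x + W y))"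
      by (simp add: algebra_simps)
    also have "\<dots> \<le> L * (2 * \<kappa> + \<beta> * \<kappa> * (W x + W y))"
      using near \<gamma> W0 by (intro mult_left_mono[OF _ L] add_mono mult_right_mono mult_left_mono) auto
    finally show ?thesis by (simp add: algebra_simps)
  qed
qed

text \<open>The level at which the minorization is used is dictated by the drift constants, hence
  the assumption for every \<open>R\<close>. Iterated on pairs of points, the contraction compares
  P^n f at x and y; averaging over y against \<open>M\<close> replaces the value at y by the mean of
  f, and integrability of \<open>W\<close> keeps this average finite.\<close>

theorem harris:
  fixes W :: "'a \<Rightarrow> real"
  assumes S: "S \<in> sets M" "AE x in M. x \<in> S"
    and PS: "\<And>x. x \<in> S \<Longrightarrow> AE y in P x. y \<in> S"
    and W [measurable]: "W \<in> borel_measurable M" and W0: "\<And>x. 0 \<le> W x" and Wint: "integrable M W"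
    and \<gamma>: "0 \<le> \<gamma>" "\<gamma> < 1" "0 \<le> K"
    and drift: "\<And>x. x \<in> S \<Longrightarrow> (\<integral>\<^sup>+y. W y \<partial>P x) \<le> ennreal (\<gamma> * W x + K)"
    and minor: "\<And>R. \<exists>N. sets N = sets M \<and> finite_measure N \<and> 0 < measure N (space N) \<and>
      (\<forall>x\<in>S. W x \<le> R \<longrightarrow> (\<forall>A\<in>sets M. emeasure N A \<le> emeasure (P x) A))"
  shows "geometrically_ergodic M P"
proof -
  have SM: "S \<subseteq> space M" using S(1) by (rule sets.sets_into_space)
  \<comment> \<open>Each of the two points contributes a \<open>K\<close>, so the drift gains at W x
    + W y = R only if (1 - \<gamma>) R exceeds 2K. The summand 1 makes the inequality
    strict.\<close>
  define R where "R = 2 * K / (1 - \<gamma>) + 1"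
  have R: "(1 - \<gamma>) * R > 2 * K" "R > 0"
  proof -
    have "(1 - \<gamma>) * R = 2 * K + (1 - \<gamma>)"
      using \<gamma> by (simp add: R_def distrib_left)
    then show "(1 - \<gamma>) * R > 2 * K" using \<gamma> by simp
    show "R > 0" unfolding R_def using \<gamma> by (auto intro: add_nonneg_pos)
  qed
  obtain N where N: "sets N = sets M" "finite_measure N" "0 < measure N (space N)"
    and minorN: "\<And>x A. x \<in> S \<Longrightarrow> W x \<le> R \<Longrightarrow> A \<in> sets M \<Longrightarrow> emeasure N A \<le> emeasure (P x) A"
    using minor[of R] by blast
  \<comment> \<open>If the sublevel set is empty, the minorization does not limit the mass of
    \<open>N\<close>; the cap keeps 1 - a / 2 positive.\<close>
  define a where "a = min 1 (measure N (space N))"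
  have a: "0 < a" "a \<le> 1" "a \<le> measure N (space N)" using N by (auto simp: a_def)
  \<comment> \<open>Small enough that the drift error 2 \<beta> K consumes at most half of the gain
    2a in \<open>near\<close>; the summand 1 covers K = 0.\<close>
  define \<beta> where "\<beta> = a / (2 * K + 1)"
  have \<beta>: "0 < \<beta>" "2 * \<beta> * K \<le> a"
    using a \<gamma> by (auto simp: \<beta>_def field_simps)
  define \<kappa> where "\<kappa> = max ((2 + \<beta> * \<gamma> * R + 2 * \<beta> * K) / (2 + \<beta> * R)) (max (1 - a / 2) \<gamma>)"
  have pos: "2 + \<beta> * R > 0" using \<beta> R by (simp add: add_pos_pos)
  have "\<beta> * (\<gamma> * R + 2 * K) < \<beta> * R"
    using R \<beta> by (intro mult_strict_left_mono) (auto simp: algebra_simps)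
  then have \<kappa>1: "\<kappa> < 1"
    using \<gamma> a pos by (auto simp: \<kappa>_def divide_less_eq algebra_simps)
  have \<kappa>: "0 < \<kappa>" "\<gamma> \<le> \<kappa>" "1 - a / 2 \<le> \<kappa>"
    using a by (auto simp: \<kappa>_def less_max_iff_disj)
  have far: "2 + \<beta> * \<gamma> * R + 2 * \<beta> * K \<le> \<kappa> * (2 + \<beta> * R)"
  proof -
    have "(2 + \<beta> * \<gamma> * R + 2 * \<beta> * K) / (2 + \<beta> * R) \<le> \<kappa>" by (simp add: \<kappa>_def)
    then show ?thesis using pos by (simp add: pos_divide_le_eq)
  qed
  have near: "2 + 2 * \<beta> * K - 2 * a \<le> 2 * \<kappa>" using \<kappa>(3) \<beta>(2) by linarith
  have contr: "kernel_op P g u - kernel_op P g v \<le> \<kappa> * L * (2 + \<beta> * (W u + W v))"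
    if "g \<in> bdd_measurable M" "0 \<le> L" "u \<in> S" "v \<in> S"
      and "\<And>x y. x \<in> S \<Longrightarrow> y \<in> S \<Longrightarrow> \<bar>g x - g y\<bar> \<le> L * (2 + \<beta> * (W x + W y))" for g L u v
    by (rule harris_contraction[where S = S and K = K and \<gamma> = \<gamma> and R = R and N = N and a = a])
      (fact SM PS W W0 \<gamma> \<kappa> \<beta> drift N a minorN far near that)+
  define m where "m = (\<integral>x. W x \<partial>M)"
  have m: "0 \<le> m" unfolding m_def by (rule Bochner_Integration.integral_nonneg) (rule W0)
  \<comment> \<open>The value \<infinity> makes the claim trivial off \<open>S\<close>, where
    neither drift nor minorization is known; it is finite almost everywhere because \<open>S\<close>
    has full measure.\<close>
  define V where "V x = (if x \<in> S then ennreal (1 + \<beta> * W x) else \<infinity>)" for x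
  have V [measurable]: "V \<in> borel_measurable M"
    unfolding V_def[abs_def] using S by measurable
  \<comment> \<open>The factor starts at 1 because |f| is at most 1 + \<beta> W on \<open>S\<close>;
    then \<open>contr\<close> is applied with L = \<kappa>^n.\<close>
  have osc: "\<bar>(kernel_op P ^^ n) f x - (kernel_op P ^^ n) f y\<bar> \<le> \<kappa> ^ n * (2 + \<beta> * (W x + W y))"
    if f: "f \<in> bdd_measurable M" and fV: "\<And>y. y \<in> space M \<Longrightarrow> ennreal \<bar>f y\<bar> \<le> V y"
      and xy: "x \<in> S" "y \<in> S" for f n x y
    using xy
  proof (induction n arbitrary: x y)
    case 0
    have "\<bar>f z\<bar> \<le> 1 + \<beta> * W z" if "z \<in> S" for z
    proof -
      have "ennreal \<bar>f z\<bar> \<le> ennreal (1 + \<beta> * W z)"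
        using fV[of z] SM that by (auto simp: V_def simp del: ennreal_plus)
      then show ?thesis
        using W0[of z] \<beta> by (subst (asm) ennreal_le_iff) auto
    qed
    from this[OF \<open>x \<in> S\<close>] this[OF \<open>y \<in> S\<close>] show ?case by (simp add: algebra_simps)
  next
    case (Suc n)
    have "kernel_op P ((kernel_op P ^^ n) f) u - kernel_op P ((kernel_op P ^^ n) f) v
        \<le> \<kappa> * \<kappa> ^ n * (2 + \<beta> * (W u + W v))" if "u \<in> S" "v \<in> S" for u v
      by (rule contr[OF kernel_op_iter_bdd[OF f] _ that Suc.IH]) (use \<kappa> in auto)
    from this[OF Suc.prems] this[OF Suc.prems(2) Suc.prems(1)] show ?case
      by (simp add: abs_le_iff add.commute)
  qed
  have bound: "V_norm_diff V (kernel_power M P n x) M \<le> ennreal (2 + \<beta> * m) * ennreal (\<kappa> ^ n) * V x"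
    if x: "x \<in> space M" for n x
  proof (cases "x \<in> S")
    case False
    then show ?thesis using \<kappa> m \<beta> 
      by (simp add: V_def ennreal_mult_eq_top_iff add_pos_nonneg less_imp_le ennreal_mult_top)
  next
    case True
    have "V_norm_diff V (kernel_power M P n x) M \<le> ennreal (\<kappa> ^ n * (2 + \<beta> * W x + \<beta> * m))"
    proof (rule V_norm_diff_kernel_power_le[OF x])
      fix f assume f: "f \<in> bdd_measurable M" and fV: "\<And>y. y \<in> space M \<Longrightarrow> ennreal \<bar>f y\<bar> \<le> V y"
      let ?u = "(kernel_op P ^^ n) f"
      have ub: "?u \<in> bdd_measurable M" by (rule kernel_op_iter_bdd[OF f])
      have "\<bar>?u x - (\<integral>y. f y \<partial>M)\<bar> = \<bar>\<integral>y. ?u x - ?u y \<partial>M\<bar>"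
        using integrable_M[OF ub] integral_kernel_op_iter[OF f, of n]
        by (simp add: prob_space)
      also have "\<dots> \<le> (\<integral>y. \<bar>?u x - ?u y\<bar> \<partial>M)"
        by (rule integral_abs_bound)
      also have "\<dots> \<le> (\<integral>y. \<kappa> ^ n * (2 + \<beta> * (W x + W y)) \<partial>M)"
      proof (rule integral_mono_AE)
        show "AE y in M. \<bar>?u x - ?u y\<bar> \<le> \<kappa> ^ n * (2 + \<beta> * (W x + W y))"
          using S(2) by eventually_elim (rule osc[OF f fV True])
      qed (use Wint integrable_M[OF ub] in auto)
      also have "\<dots> = \<kappa> ^ n * (2 + \<beta> * W x + \<beta> * m)"
        using Wint by (simp add: m_def prob_space algebra_simps)
      finally show "\<bar>?u x - (\<integral>y. f y \<partial>M)\<bar> \<le> \<kappa> ^ n * (2 + \<beta> * W x + \<beta> * m)" .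
    qed
    also have "\<dots> \<le> ennreal ((2 + \<beta> * m) * \<kappa> ^ n * (1 + \<beta> * W x))"
    proof (rule ennreal_leI)
      have "2 + \<beta> * W x + \<beta> * m \<le> (2 + \<beta> * m) * (1 + \<beta> * W x)"
        using \<beta> m W0[of x] by (simp add: algebra_simps)
      from mult_left_mono[OF this, of "\<kappa> ^ n"] \<kappa>
      show "\<kappa> ^ n * (2 + \<beta> * W x + \<beta> * m) \<le> (2 + \<beta> * m) * \<kappa> ^ n * (1 + \<beta> * W x)"
        by (simp add: mult_ac)
    qed
    also have "\<dots> = ennreal (2 + \<beta> * m) * ennreal (\<kappa> ^ n) * V x"
      using True \<kappa> \<beta> m W0[of x] by (simp add: V_def ennreal_mult)
    finally show ?thesis .
  qed
  show ?thesis
    unfolding geometrically_ergodic_def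
  proof (intro conjI kernel invariant bexI[of _ V] exI[of _ \<kappa>] exI[of _ "ennreal (2 + \<beta> * m)"] ballI allI impI)
    show "1 \<le> V x" for x using W0[of x] \<beta> by (auto simp: V_def)
    show "AE x in M. V x < \<infinity>" using S(2) by eventually_elim (simp add: V_def)
  qed (use \<kappa> \<kappa>1 bound V in auto)
qed

end

section \<open>Conductance of reversible kernels\<close>

text \<open>Log-convexity makes the successive ratios nondecreasing. If the first ratio t exceeded
  q, then c n would be at least t^n c 0 and outgrow B q^n. The conclusion is free of
  \<open>B\<close>: only the rate survives.\<close>

lemma log_convex_ratio_bound:
  fixes c :: "nat \<Rightarrow> real"
  assumes c: "\<And>n. 0 \<le> c n" and lc: "\<And>n. (c (Suc n))\<^sup>2 \<le> c n * c (Suc (Suc n))"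
    and bound: "\<And>n. 1 \<le> n \<Longrightarrow> c n \<le> B * q ^ n" and q: "0 < q"
  shows "c 1 \<le> q * c 0"
proof (rule ccontr)
  assume "\<not> ?thesis"
  then have less: "q * c 0 < c 1" by simp
  have "c 0 \<noteq> 0"
    using lc[of 0] less by auto
  then have c0: "0 < c 0" using c[of 0] by simp
  define t where "t = c 1 / c 0"
  have t: "q < t" using less c0 by (simp add: t_def field_simps)
  have step: "0 < c n \<and> t * c n \<le> c (Suc n)" for n
  proof (induction n)
    case 0
    show ?case using c0 by (simp add: t_def)
  next
    case (Suc n)
    have p: "0 < c (Suc n)"
      using Suc t q by (meson less_le_trans mult_pos_pos order_less_trans)
    have "t * c n * c (Suc n) \<le> c (Suc n) * c (Suc n)"
      using Suc p by (intro mult_right_mono) auto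
    also have "\<dots> \<le> c n * c (Suc (Suc n))"
      using lc[of n] by (simp add: power2_eq_square)
    finally have "c n * (t * c (Suc n)) \<le> c n * c (Suc (Suc n))"
      by (simp add: mult_ac)
    then show ?case using Suc p by simp
  qed
  have growth: "t ^ n * c 0 \<le> c n" for n
  proof (induction n)
    case (Suc n)
    have "t ^ Suc n * c 0 = t * (t ^ n * c 0)" by (simp add: mult_ac)
    also have "\<dots> \<le> t * c n" using Suc t q by (intro mult_left_mono) auto
    also have "\<dots> \<le> c (Suc n)" using step by blast
    finally show ?case .
  qed simp
  have "\<exists>n\<ge>1. B / c 0 < (t / q) ^ n"
  proof -
    have "1 < t / q" using t q by simp
    then obtain n where n: "max 1 (B / c 0) < (t / q) ^ n" using real_arch_pow by blast
    then have "n \<noteq> 0" by (intro notI) simp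
    with n show ?thesis by (intro exI[of _ n]) auto
  qed
  then obtain n where n: "1 \<le> n" "B / c 0 < (t / q) ^ n" by blast
  have "B * q ^ n < t ^ n * c 0"
    using n(2) c0 q by (simp add: field_simps)
  with growth[of n] bound[OF n(1)] show False by simp
qed

lemma (in prob_space) integral_mult_squared_le:
  fixes f g :: "'a \<Rightarrow> real"
  assumes "f \<in> bdd_measurable M" "g \<in> bdd_measurable M"
  shows "(\<integral>x. f x * g x \<partial>M)\<^sup>2 \<le> (\<integral>x. (f x)\<^sup>2 \<partial>M) * (\<integral>x. (g x)\<^sup>2 \<partial>M)"
proof -
  have i: "integrable M (\<lambda>x. u x * v x)" if "u \<in> bdd_measurable M" "v \<in> bdd_measurable M" for u v
    using bdd_measurable_integrable[OF bdd_measurable_mult[OF that] finite_measure_axioms refl] .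
  define F G H where "F = (\<integral>x. (f x)\<^sup>2 \<partial>M)" and "G = (\<integral>x. (g x)\<^sup>2 \<partial>M)" and "H = (\<integral>x. f x * g x \<partial>M)"
  have key: "0 \<le> s\<^sup>2 * F - 2 * s * t * H + t\<^sup>2 * G" for s t
  proof -
    have ff: "integrable M (\<lambda>x. (f x)\<^sup>2)" "integrable M (\<lambda>x. (g x)\<^sup>2)" "integrable M (\<lambda>x. f x * g x)"
      using i[OF assms(1) assms(1)] i[OF assms(2) assms(2)] i[OF assms] by (simp_all add: power2_eq_square)
    have "0 \<le> (\<integral>x. (s * f x - t * g x)\<^sup>2 \<partial>M)" by (rule Bochner_Integration.integral_nonneg) simp
    also have "\<dots> = (\<integral>x. s\<^sup>2 * (f x)\<^sup>2 - 2 * s * t * (f x * g x) + t\<^sup>2 * (g x)\<^sup>2 \<partial>M)"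
      by (intro Bochner_Integration.integral_cong) (auto simp: power2_eq_square algebra_simps)
    also have "\<dots> = s\<^sup>2 * F - 2 * s * t * H + t\<^sup>2 * G"
      using ff by (simp add: F_def G_def H_def)
    finally show ?thesis .
  qed
  have nn: "0 \<le> F" "0 \<le> G" using key[of 1 0] key[of 0 1] by simp_all
  have "H\<^sup>2 \<le> F * G"
  proof (cases "F = 0 \<and> G = 0")
    case True
    then show ?thesis using key[of 1 1] key[of 1 "-1"] by simp
  next
    case False
    \<comment> \<open>The form \<open>key\<close> at (G, H) equals G (F G - H^2), and at (H, F) it
      equals F (F G - H^2); one of the two prefactors is positive.\<close>
    have "0 \<le> G * (F * G - H\<^sup>2)" "0 \<le> F * (F * G - H\<^sup>2)"
      using key[of G H] key[of H F] by (simp_all add: power2_eq_square algebra_simps)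
    with False nn show ?thesis by (auto simp: zero_le_mult_iff)
  qed
  then show ?thesis by (simp add: F_def G_def H_def)
qed

context invariant_kernel
begin

text \<open>Functions bounded by 1 are admissible in the \<open>V\<close>-norm because
  \<open>V\<close> is at least 1.\<close>

lemma geometrically_ergodic_kernel_op:
  assumes "geometrically_ergodic M P"
  obtains V \<gamma> C where "V \<in> borel_measurable M" "AE x in M. V x < (\<infinity>::ennreal)" "0 < \<gamma>" "\<gamma> < 1" "0 \<le> C"
    and "\<And>f n x. f \<in> bdd_measurable M \<Longrightarrow> (\<And>x. x \<in> space M \<Longrightarrow> \<bar>f x\<bar> \<le> 1) \<Longrightarrow> x \<in> space M \<Longrightarrow> 1 \<le> n \<Longrightarrow>
      ennreal \<bar>(kernel_op P ^^ n) f x - (\<integral>y. f y \<partial>M)\<bar> \<le> ennreal C * ennreal (\<gamma> ^ n) * V x"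
proof -
  from assms obtain V \<gamma> c where V: "V \<in> borel_measurable M" "AE x in M. V x < (\<infinity>::ennreal)"
    and V1: "\<forall>x\<in>space M. 1 \<le> V x" and \<gamma>: "0 < (\<gamma>::real)" "\<gamma> < 1" and c: "c < (\<infinity>::ennreal)"
    and b: "\<forall>x\<in>space M. \<forall>n\<ge>1. V_norm_diff V (kernel_power M P n x) M \<le> c * ennreal (\<gamma> ^ n) * V x"
    unfolding geometrically_ergodic_def by blast
  have cr: "c = ennreal (enn2real c)" using c by simp
  show ?thesis
  proof (rule that[OF V \<gamma>, of "enn2real c"])
    fix f n x
    assume f: "f \<in> bdd_measurable M" and f1: "\<And>x. x \<in> space M \<Longrightarrow> \<bar>f x\<bar> \<le> 1"
      and x: "x \<in> space M" and n: "1 \<le> (n::nat)"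
    have "integrable (kernel_power M P n x) f"
      using kernel_power_sets_prob[OF x]
      by (intro bdd_measurable_integrable[OF f] prob_space.finite_measure) auto
    moreover have "\<forall>x\<in>space M. ennreal \<bar>f x\<bar> \<le> V x"
    proof
      fix x assume x: "x \<in> space M"
      have "ennreal \<bar>f x\<bar> \<le> ennreal 1" using f1[OF x] by (rule ennreal_leI)
      also have "ennreal 1 \<le> V x" using V1 x by simp
      finally show "ennreal \<bar>f x\<bar> \<le> V x" .
    qed
    ultimately have "ennreal \<bar>(\<integral>y. f y \<partial>kernel_power M P n x) - (\<integral>y. f y \<partial>M)\<bar>
        \<le> V_norm_diff V (kernel_power M P n x) M"
      unfolding V_norm_diff_def using integrable_M[OF f] by (intro SUP_upper) auto
    also have "\<dots> \<le> c * ennreal (\<gamma> ^ n) * V x" using b x n by blast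
    finally show "ennreal \<bar>(kernel_op P ^^ n) f x - (\<integral>y. f y \<partial>M)\<bar> \<le> ennreal (enn2real c) * ennreal (\<gamma> ^ n) * V x"
      using cr by (simp add: integral_kernel_power[OF f x])
  qed simp
qed

end

section \<open>Reversible kernels: from geometric decay to a spectral gap\<close>

locale reversible_kernel = invariant_kernel +
  assumes reversible: "f \<in> bdd_measurable M \<Longrightarrow> g \<in> bdd_measurable M \<Longrightarrow>
    (\<integral>x. f x * kernel_op P g x \<partial>M) = (\<integral>x. kernel_op P f x * g x \<partial>M)"
begin

lemma reversible_iter:
  assumes "f \<in> bdd_measurable M" "g \<in> bdd_measurable M"
  shows "(\<integral>x. f x * (kernel_op P ^^ n) g x \<partial>M) = (\<integral>x. (kernel_op P ^^ n) f x * g x \<partial>M)"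
  using assms
proof (induction n arbitrary: f g)
  case (Suc n)
  have "(\<integral>x. f x * (kernel_op P ^^ Suc n) g x \<partial>M) = (\<integral>x. kernel_op P f x * (kernel_op P ^^ n) g x \<partial>M)"
    using reversible[OF Suc.prems(1) kernel_op_iter_bdd[OF Suc.prems(2)]] by simp
  also have "\<dots> = (\<integral>x. (kernel_op P ^^ n) (kernel_op P f) x * g x \<partial>M)"
    by (rule Suc.IH[OF kernel_op_bdd[OF Suc.prems(1)] Suc.prems(2)])
  also have "\<dots> = (\<integral>x. (kernel_op P ^^ Suc n) f x * g x \<partial>M)"
    by (simp only: funpow_Suc_right comp_def)
  finally show ?case .
qed simp

lemma kernel_op_iter_diff:
  assumes "f \<in> bdd_measurable M" "x \<in> space M"
  shows "(kernel_op P ^^ n) (\<lambda>x. f x - c) x = (kernel_op P ^^ n) f x - c"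
  using assms(2)
proof (induction n arbitrary: x)
  case (Suc n)
  have "(kernel_op P ^^ Suc n) (\<lambda>x. f x - c) x = kernel_op P (\<lambda>x. (kernel_op P ^^ n) f x - c) x"
    using Suc by (auto intro: kernel_op_cong)
  also have "\<dots> = (kernel_op P ^^ Suc n) f x - c"
    using kernel_op_diff[OF kernel_op_iter_bdd[OF assms(1)] bdd_measurable_const Suc.prems]
    by (simp add: kernel_op_const[OF Suc.prems])
  finally show ?case .
qed simp

text \<open>By reversibility the squared L2 norm c n of P^n g, for the centred g, equals the pairing
  of g with P^(2n) g. It is log-convex by Cauchy-Schwarz and decays like \<gamma>^(2n), so
  \<open>log_convex_ratio_bound\<close> gives |Pg| \<le> \<gamma> |g| in L2, whatever the size of
  \<open>B\<close>. One more Cauchy-Schwarz bounds the pairing of g with Pg.\<close>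

lemma spectral_bound:
  assumes f: "f \<in> bdd_measurable M" and \<gamma>: "0 < \<gamma>"
    and decay: "\<And>n x. x \<in> space M \<Longrightarrow> 1 \<le> n \<Longrightarrow>
      \<bar>f x * ((kernel_op P ^^ n) f x - (\<integral>y. f y \<partial>M))\<bar> \<le> B * \<gamma> ^ n"
  defines "m \<equiv> \<integral>y. f y \<partial>M"
  shows "(\<integral>x. f x * kernel_op P f x \<partial>M) - m\<^sup>2 \<le> \<gamma> * ((\<integral>x. (f x)\<^sup>2 \<partial>M) - m\<^sup>2)"
proof -
  define g where "g x = f x - m" for x
  have g: "g \<in> bdd_measurable M" unfolding g_def by (intro bdd_measurable_diff f bdd_measurable_const)
  define U where "U n = (kernel_op P ^^ n) g" for n
  have U: "U n \<in> bdd_measurable M" for n unfolding U_def by (intro kernel_op_iter_bdd g)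
  have U_eq: "U n x = (kernel_op P ^^ n) f x - m" if "x \<in> space M" for n x
    unfolding U_def g_def using kernel_op_iter_diff[OF f that] .
  have pair: "(\<integral>x. U i x * U j x \<partial>M) = (\<integral>x. g x * U (i + j) x \<partial>M)" for i j
  proof -
    have "U (i + j) = (kernel_op P ^^ i) (U j)" by (simp add: U_def funpow_add)
    then show ?thesis using reversible_iter[OF g U[of j], of i] by (simp add: U_def)
  qed
  have int2: "integrable M (\<lambda>x. u x * v x)" if "u \<in> bdd_measurable M" "v \<in> bdd_measurable M" for u v
    using integrable_M[OF bdd_measurable_mult[OF that]] .
  \<comment> \<open>\<open>decay\<close> controls P^n f - m only after multiplication by f, that is,
    where f lives. Since U n has mean zero, the left factor g may be replaced by f.\<close>
  have g_pair: "(\<integral>x. g x * U n x \<partial>M) = (\<integral>x. f x * U n x \<partial>M)" for n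
  proof -
    have "(\<integral>x. U n x \<partial>M) = 0"
      using integral_kernel_op_iter[OF g] integrable_M[OF f]
      by (simp add: U_def g_def m_def prob_space)
    moreover have "(\<integral>x. g x * U n x \<partial>M) = (\<integral>x. f x * U n x - m * U n x \<partial>M)"
      by (simp add: g_def algebra_simps)
    ultimately show ?thesis
      using int2[OF f U[of n]] integrable_M[OF U[of n]] by simp
  qed
  define c where "c n = (\<integral>x. U n x * U n x \<partial>M)" for n
  have c0: "0 \<le> c n" for n unfolding c_def by (intro Bochner_Integration.integral_nonneg) simp
  have lc: "(c (Suc n))\<^sup>2 \<le> c n * c (Suc (Suc n))" for n
  proof -
    have "c (Suc n) = (\<integral>x. U n x * U (Suc (Suc n)) x \<partial>M)"
      using pair[of "Suc n" "Suc n"] pair[of n "Suc (Suc n)"] by (simp add: c_def)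
    then show ?thesis
      using integral_mult_squared_le[OF U[of n] U[of "Suc (Suc n)"]]
      by (simp add: c_def power2_eq_square)
  qed
  have bound: "c n \<le> B * (\<gamma>\<^sup>2) ^ n" if "1 \<le> n" for n
  proof -
    have "c n = (\<integral>x. f x * U (n + n) x \<partial>M)" by (simp add: c_def pair g_pair)
    also have "\<dots> \<le> (\<integral>x. B * \<gamma> ^ (n + n) \<partial>M)"
    proof (rule integral_mono)
      show "f x * U (n + n) x \<le> B * \<gamma> ^ (n + n)" if "x \<in> space M" for x
        using decay[OF that, of "n + n"] \<open>1 \<le> n\<close> U_eq[OF that, of "n + n"] by (auto simp: m_def)
    qed (use int2[OF f U] in auto)
    also have "\<dots> = B * (\<gamma>\<^sup>2) ^ n" by (simp add: prob_space power_add power2_eq_square power_mult_distrib)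
    finally show ?thesis .
  qed
  have c1: "c 1 \<le> \<gamma>\<^sup>2 * c 0"
    using log_convex_ratio_bound[OF c0 lc bound] \<gamma> by simp
  let ?s = "\<integral>x. g x * U 1 x \<partial>M"
  have "?s\<^sup>2 \<le> c 0 * c 1"
    using integral_mult_squared_le[OF g U[of 1]] by (simp add: c_def U_def power2_eq_square)
  also have "\<dots> \<le> c 0 * (\<gamma>\<^sup>2 * c 0)" using c1 c0 by (intro mult_left_mono) auto
  also have "\<dots> = (\<gamma> * c 0)\<^sup>2" by (simp add: power2_eq_square mult_ac)
  finally have s: "?s \<le> \<gamma> * c 0"
    by (rule power2_le_imp_le) (use c0[of 0] \<gamma> in auto)
  have "?s = (\<integral>x. f x * kernel_op P f x \<partial>M) - m\<^sup>2"
  proof -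
    have "?s = (\<integral>x. f x * kernel_op P f x - m * f x \<partial>M)"
      unfolding g_pair
    proof (intro Bochner_Integration.integral_cong refl)
      fix x assume "x \<in> space M"
      then have eq: "U 1 x = kernel_op P f x - m" using U_eq[of x 1] by simp
      show "f x * U 1 x = f x * kernel_op P f x - m * f x"
        unfolding eq by (simp add: algebra_simps)
    qed
    also have "\<dots> = (\<integral>x. f x * kernel_op P f x \<partial>M) - m * m"
      using int2[OF f kernel_op_bdd[OF f]] integrable_M[OF f] by (simp add: m_def)
    finally show ?thesis by (simp add: power2_eq_square)
  qed
  moreover have "c 0 = (\<integral>x. (f x)\<^sup>2 \<partial>M) - m\<^sup>2"
  proof -
    have "c 0 = (\<integral>x. f x * U 0 x \<partial>M)" using pair[of 0 0] g_pair[of 0] by (simp add: c_def)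
    also have "\<dots> = (\<integral>x. f x * f x - m * f x \<partial>M)"
      by (intro Bochner_Integration.integral_cong) (auto simp: U_def g_def algebra_simps)
    also have "\<dots> = (\<integral>x. f x * f x \<partial>M) - m * m"
      using int2[OF f f] integrable_M[OF f] by (simp add: m_def)
    finally show ?thesis by (simp add: power2_eq_square)
  qed
  ultimately show ?thesis using s by simp
qed

text \<open>The geometric bound is uniform only where \<open>V\<close> is bounded, so
  \<open>spectral_bound\<close> is applied to the indicators of the truncations \<open>D k\<close>
  of \<open>A\<close>, with constant C k. That constant does not enter the conclusion, so k can tend
  to infinity. The flow out of \<open>A\<close> is the mass of \<open>A\<close> minus the pairing of
  its indicator with its own image under the kernel.\<close>

theorem geometrically_ergodic_conductance:
  assumes ge: "geometrically_ergodic M P"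
  obtains \<gamma> where "0 < \<gamma>" "\<gamma> < 1" "\<And>A. A \<in> sets M \<Longrightarrow>
    (1 - \<gamma>) * prob A * (1 - prob A) \<le> (\<integral>x. indicator A x * measure (P x) (space M - A) \<partial>M)"
proof -
  show ?thesis
  proof (rule geometrically_ergodic_kernel_op[OF ge])
    fix V \<gamma> C
    assume V [measurable]: "V \<in> borel_measurable M" and Vfin: "AE x in M. V x < (\<infinity>::ennreal)"
      and \<gamma>: "0 < \<gamma>" "\<gamma> < 1" and C: "0 \<le> C"
      and decay: "\<And>f n x. f \<in> bdd_measurable M \<Longrightarrow> (\<And>x. x \<in> space M \<Longrightarrow> \<bar>f x\<bar> \<le> 1) \<Longrightarrow> x \<in> space M \<Longrightarrow> 1 \<le> n \<Longrightarrow>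
        ennreal \<bar>(kernel_op P ^^ n) f x - (\<integral>y. f y \<partial>M)\<bar> \<le> ennreal C * ennreal (\<gamma> ^ n) * V x"
    show ?thesis
    proof (rule that[OF \<gamma>])
      fix A assume A [measurable]: "A \<in> sets M"
      let ?i = "indicator :: 'a set \<Rightarrow> 'a \<Rightarrow> real"
      define D where "D k = A \<inter> {x\<in>space M. V x \<le> ennreal (real k)}" for k :: nat
      have D [measurable]: "D k \<in> sets M" for k unfolding D_def by measurable
      have Db: "?i (D k) \<in> bdd_measurable M" for k using D by (rule bdd_measurable_indicator)
      have Ab: "?i A \<in> bdd_measurable M" using A by (rule bdd_measurable_indicator)
      have DA: "?i (D k) x \<le> ?i A x" for k x by (auto simp: D_def indicator_def)
      have int2: "integrable M (\<lambda>x. u x * v x)" if "u \<in> bdd_measurable M" "v \<in> bdd_measurable M" for u v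
        using integrable_M[OF bdd_measurable_mult[OF that]] .
      have lim: "(\<lambda>k. prob (D k)) \<longlonglongrightarrow> prob A"
      proof -
        have "(\<lambda>k. prob (D k)) \<longlonglongrightarrow> prob (\<Union>k. D k)"
        proof (rule finite_Lim_measure_incseq)
          show "incseq D"
            unfolding D_def incseq_def by (auto intro: order_trans ennreal_leI)
        qed auto
        moreover have "prob (\<Union>k. D k) = prob A"
        proof (rule measure_eq_AE)
          show "AE x in M. (x \<in> (\<Union>k. D k)) = (x \<in> A)"
            using Vfin AE_space
          proof eventually_elim
            case (elim x)
            obtain k :: nat where "enn2real (V x) \<le> real k" using real_arch_simple by blast
            then have "ennreal (enn2real (V x)) \<le> ennreal (real k)"
              by (rule ennreal_leI)
            then have "V x \<le> ennreal (real k)"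
              using elim(1) by (subst (asm) ennreal_enn2real) auto
            with elim show ?case unfolding D_def by blast
          qed
        qed auto
        ultimately show ?thesis by simp
      qed
      have kA: "kernel_op P (?i A) x = 1 - measure (P x) (space M - A)" if "x \<in> space M" for x
      proof -
        interpret Px: prob_space "P x" using that by (rule prob_space_P)
        have "kernel_op P (?i A) x = measure (P x) (A \<inter> space (P x))" by (simp add: kernel_op_def)
        also have "\<dots> = 1 - measure (P x) (space M - A)"
          using Px.prob_compl[of A] A sets_P[OF that] space_P[OF that] sets.sets_into_space[OF A]
          by (simp add: Int_absorb2)
        finally show ?thesis .
      qed
      have kle1: "kernel_op P (?i B) x \<le> 1" if "B \<in> sets M" "x \<in> space M" for B x
        using that by (intro kernel_op_le bdd_measurable_indicator) (auto simp: indicator_def)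
      let ?E = "\<lambda>B. \<integral>x. ?i B x * kernel_op P (?i B) x \<partial>M"
      have gap: "?E (D k) - (prob (D k))\<^sup>2 \<le> \<gamma> * (prob (D k) - (prob (D k))\<^sup>2)" for k
      proof -
        have "?E (D k) - (\<integral>y. ?i (D k) y \<partial>M)\<^sup>2 \<le> \<gamma> * ((\<integral>x. (?i (D k) x)\<^sup>2 \<partial>M) - (\<integral>y. ?i (D k) y \<partial>M)\<^sup>2)"
        proof (rule spectral_bound[OF Db \<gamma>(1)])
          fix n x assume x: "x \<in> space M" and n: "1 \<le> (n::nat)"
          show "\<bar>?i (D k) x * ((kernel_op P ^^ n) (?i (D k)) x - (\<integral>y. ?i (D k) y \<partial>M))\<bar> \<le> (C * real k) * \<gamma> ^ n"
          proof (cases "x \<in> D k")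
            case True
            then have Vk: "V x \<le> ennreal (real k)" by (simp add: D_def)
            have "ennreal \<bar>(kernel_op P ^^ n) (?i (D k)) x - (\<integral>y. ?i (D k) y \<partial>M)\<bar> \<le> ennreal C * ennreal (\<gamma> ^ n) * V x"
              by (intro decay Db x n) (auto simp: indicator_def)
            also have "\<dots> \<le> ennreal C * ennreal (\<gamma> ^ n) * ennreal (real k)"
              using Vk by (rule mult_left_mono) simp
            also have "\<dots> = ennreal (C * real k * \<gamma> ^ n)"
              using C \<gamma> by (simp add: ennreal_mult[symmetric] mult_ac)
            finally show ?thesis
              using True C \<gamma> by (subst (asm) ennreal_le_iff) auto
          next
            case False
            then show ?thesis using C \<gamma> by simp
          qed
        qed
        moreover have "(\<lambda>x. (?i (D k) x)\<^sup>2) = ?i (D k)" by (auto simp: indicator_def)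
        ultimately show ?thesis by (simp add: Int_absorb2[OF sets.sets_into_space[OF D]])
      qed
      \<comment> \<open>The two factors are truncated one at a time. Reversibility turns the mixed
        pairing of \<open>D k\<close> with the image of \<open>A\<close> into that of
        \<open>A\<close> with the image of \<open>D k\<close>, so the second truncation costs the
        mass of A - D k like the first.\<close>
      have close: "?E A - ?E (D k) \<le> 2 * (prob A - prob (D k))" for k
      proof -
        let ?d = "\<lambda>x. ?i A x - ?i (D k) x"
        have db: "?d \<in> bdd_measurable M" by (intro bdd_measurable_diff Ab Db)
        have le: "(\<integral>x. ?d x * kernel_op P (?i B) x \<partial>M) \<le> (\<integral>x. ?d x \<partial>M)" if "B \<in> sets M" for B
        proof (rule integral_mono)
          show "integrable M (\<lambda>x. ?d x * kernel_op P (?i B) x)"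
            by (intro int2 db kernel_op_bdd bdd_measurable_indicator that)
          show "?d x * kernel_op P (?i B) x \<le> ?d x" if "x \<in> space M" for x
            using mult_left_mono[OF kle1[OF \<open>B \<in> sets M\<close> that], of "?d x"] DA[of k x] by simp
        qed (use integrable_M[OF db] in simp)
        have "?E A = (\<integral>x. ?d x * kernel_op P (?i A) x + ?i (D k) x * kernel_op P (?i A) x \<partial>M)"
          by (simp add: algebra_simps)
        also have "\<dots> = (\<integral>x. ?d x * kernel_op P (?i A) x \<partial>M) + (\<integral>x. ?i (D k) x * kernel_op P (?i A) x \<partial>M)"
          by (intro Bochner_Integration.integral_add int2 db kernel_op_bdd Ab Db)
        also have "(\<integral>x. ?i (D k) x * kernel_op P (?i A) x \<partial>M) = (\<integral>x. ?i A x * kernel_op P (?i (D k)) x \<partial>M)"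
          using reversible[OF Db Ab, of k] by (simp add: mult.commute)
        also have "\<dots> = (\<integral>x. ?d x * kernel_op P (?i (D k)) x + ?i (D k) x * kernel_op P (?i (D k)) x \<partial>M)"
          by (simp add: algebra_simps)
        also have "\<dots> = (\<integral>x. ?d x * kernel_op P (?i (D k)) x \<partial>M) + ?E (D k)"
          by (intro Bochner_Integration.integral_add int2 db kernel_op_bdd Ab Db)
        finally have "?E A - ?E (D k) \<le> 2 * (\<integral>x. ?d x \<partial>M)"
          using le[OF A] le[OF D, of k] by simp
        also have "(\<integral>x. ?d x \<partial>M) = prob A - prob (D k)"
          using integrable_M[OF Ab] integrable_M[OF Db, of k]
          by (simp add: Int_absorb2[OF sets.sets_into_space[OF D]] Int_absorb2[OF sets.sets_into_space[OF A]])
        finally show ?thesis by simp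
      qed
      have "?E A \<le> (prob A)\<^sup>2 + \<gamma> * (prob A - (prob A)\<^sup>2) + 2 * (prob A - prob A)"
      proof (rule LIMSEQ_le_const)
        show "(\<lambda>k. (prob (D k))\<^sup>2 + \<gamma> * (prob (D k) - (prob (D k))\<^sup>2) + 2 * (prob A - prob (D k)))
            \<longlonglongrightarrow> (prob A)\<^sup>2 + \<gamma> * (prob A - (prob A)\<^sup>2) + 2 * (prob A - prob A)"
          by (intro tendsto_intros lim)
        have "?E A \<le> (prob (D k))\<^sup>2 + \<gamma> * (prob (D k) - (prob (D k))\<^sup>2) + 2 * (prob A - prob (D k))" for k
          using gap[of k] close[of k] by linarith
        then show "\<exists>N. \<forall>n\<ge>N. ?E A \<le> (prob (D n))\<^sup>2 + \<gamma> * (prob (D n) - (prob (D n))\<^sup>2) + 2 * (prob A - prob (D n))"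
          by blast
      qed
      moreover have "?E A = prob A - (\<integral>x. ?i A x * measure (P x) (space M - A) \<partial>M)"
      proof -
        have "?i A x * measure (P x) (space M - A) = ?i A x - ?i A x * kernel_op P (?i A) x" if "x \<in> space M" for x
          unfolding kA[OF that] by (simp add: algebra_simps)
        then have "(\<integral>x. ?i A x * measure (P x) (space M - A) \<partial>M) = (\<integral>x. ?i A x - ?i A x * kernel_op P (?i A) x \<partial>M)"
          by (intro Bochner_Integration.integral_cong) auto
        also have "\<dots> = prob A - ?E A"
          using integrable_M[OF Ab] int2[OF Ab kernel_op_bdd[OF Ab]]
          by (simp add: Int_absorb2[OF sets.sets_into_space[OF A]])
        finally show ?thesis by simp
      qed
      ultimately show "(1 - \<gamma>) * prob A * (1 - prob A) \<le> (\<integral>x. ?i A x * measure (P x) (space M - A) \<partial>M)"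
        by (simp add: algebra_simps power2_eq_square)
    qed
  qed
qed

end

section \<open>The density of the proposal\<close>

lemma nn_integral_lborel_affine:
  fixes f :: "'a::euclidean_space \<Rightarrow> ennreal"
  assumes [measurable]: "f \<in> borel_measurable borel" and c: "0 < c"
  shows "(\<integral>\<^sup>+x. f x \<partial>lborel) = ennreal (c ^ DIM('a)) * (\<integral>\<^sup>+x. f (t + c *\<^sub>R x) \<partial>lborel)"
proof -
  have "(\<integral>\<^sup>+x. f x \<partial>lborel)
      = (\<integral>\<^sup>+x. f x \<partial>density (distr lborel borel (\<lambda>x. t + c *\<^sub>R x)) (\<lambda>_. ennreal (c ^ DIM('a))))"
    using lborel_affine[of c t] c by simp
  then show ?thesis
    using c by (simp add: nn_integral_density nn_integral_distr nn_integral_cmult)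
qed

lemma nn_integral_lborel_scale:
  fixes f :: "'a::euclidean_space \<Rightarrow> ennreal"
  assumes "f \<in> borel_measurable borel" and "0 < c"
  shows "(\<integral>\<^sup>+x. f x \<partial>lborel) = ennreal (c ^ DIM('a)) * (\<integral>\<^sup>+x. f (c *\<^sub>R x) \<partial>lborel)"
  using nn_integral_lborel_affine[OF assms, of 0] by simp

section \<open>The standard normal law on vectors\<close>

definition gauss_density :: "real ^ 'd \<Rightarrow> real" where
  "gauss_density x = (1 / sqrt (2 * pi)) ^ CARD('d) * exp (- (norm x)\<^sup>2 / 2)"

lemma gauss_density_pos: "0 < gauss_density x"
  by (simp add: gauss_density_def)

lemma gauss_density_nonneg [simp]: "0 \<le> gauss_density x"
  by (simp add: gauss_density_def)

lemma gauss_density_measurable [measurable]: "gauss_density \<in> borel_measurable borel"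
  unfolding gauss_density_def[abs_def] by measurable

lemma prod_std_normal_density:
  fixes x :: "real ^ 'd"
  shows "(\<Prod>i\<in>UNIV. std_normal_density (x $ i)) = gauss_density x"
proof -
  have "(norm x)\<^sup>2 = (\<Sum>i\<in>UNIV. (x $ i)\<^sup>2)"
    by (simp add: norm_vec_def L2_set_def sum_nonneg)
  then show ?thesis
    by (simp add: gauss_density_def std_normal_density_def prod.distrib exp_sum[symmetric]
        sum_divide_distrib sum_negf power_one_over prod_dividef)
qed

lemma std_normal_vec_eq: "std_normal_vec = density lborel (\<lambda>x. ennreal (gauss_density x))"
  by (simp add: std_normal_vec_def prod_std_normal_density)

lemma prob_space_std_normal_vec: "prob_space (std_normal_vec :: (real ^ 'd) measure)"
proof
  let ?n = "std_normal_density"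
  have one: "(\<integral>\<^sup>+x. ennreal (?n x) \<partial>lborel) = 1"
    using prob_space.emeasure_space_1[OF prob_space_normal_density[of 1 0]]
    by (simp add: emeasure_density)
  have axis_inj: "inj_on (\<lambda>i::'d. axis i (1::real)) UNIV"
    by (auto simp: inj_on_def axis_eq_axis)
  have Basis: "(Basis :: (real ^ 'd) set) = (\<lambda>i. axis i 1) ` UNIV"
    by (auto simp: Basis_vec_def)
  have "emeasure std_normal_vec (space (std_normal_vec :: (real ^ 'd) measure))
      = (\<integral>\<^sup>+x. ennreal (\<Prod>i\<in>UNIV. ?n ((x :: real ^ 'd) $ i)) \<partial>lborel)"
    by (simp add: std_normal_vec_def emeasure_density)
  also have "\<dots> = (\<integral>\<^sup>+x. (\<Prod>b\<in>Basis. ennreal (?n ((x :: real ^ 'd) \<bullet> b))) \<partial>lborel)"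
    unfolding Basis prod.reindex[OF axis_inj] by (simp add: prod_ennreal inner_axis)
  also have "\<dots> = (\<Prod>b\<in>(Basis :: (real ^ 'd) set). (\<integral>\<^sup>+x. ennreal (?n x) \<partial>lborel))"
    by (rule nn_integral_lborel_prod) auto
  finally show "emeasure std_normal_vec (space (std_normal_vec :: (real ^ 'd) measure)) = 1"
    by (simp add: one)
qed

lemma nn_integral_std_normal_vec:
  fixes f :: "real ^ 'd \<Rightarrow> ennreal"
  assumes [measurable]: "f \<in> borel_measurable borel"
  shows "(\<integral>\<^sup>+x. f x \<partial>std_normal_vec) = (\<integral>\<^sup>+x. ennreal (gauss_density x) * f x \<partial>lborel)"
  unfolding std_normal_vec_eq by (subst nn_integral_density) auto

section \<open>The quadratic form in the proposal density\<close>

definition mpcn_form :: "real \<Rightarrow> real ^ 'd \<Rightarrow> real ^ 'd \<Rightarrow> real" where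
  "mpcn_form \<rho> x y = (norm x)\<^sup>2 + (norm y)\<^sup>2 - 2 * sqrt \<rho> * (x \<bullet> y)"

lemma mpcn_form_commute: "mpcn_form \<rho> x y = mpcn_form \<rho> y x"
  by (simp add: mpcn_form_def inner_commute)

lemma mpcn_form_scale: "mpcn_form \<rho> (c *\<^sub>R x) (c *\<^sub>R y) = c\<^sup>2 * mpcn_form \<rho> x y"
  by (simp add: mpcn_form_def power_mult_distrib) (simp add: algebra_simps power2_eq_square)

lemma mpcn_form_eq:
  assumes "0 \<le> \<rho>"
  shows "mpcn_form \<rho> x y = (1 - \<rho>) * (norm x)\<^sup>2 + (norm (y - sqrt \<rho> *\<^sub>R x))\<^sup>2"
  using assms unfolding mpcn_form_def power2_norm_eq_inner
  by (simp add: inner_diff_left inner_diff_right inner_commute algebra_simps)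

text \<open>Together with \<open>mpcn_form_upper\<close>, this makes the form comparable to the
  squared norm of the pair, uniformly in the directions. The bounds on the proposal density below
  rest on these two estimates.\<close>

lemma mpcn_form_lower:
  assumes "0 \<le> \<rho>"
  shows "(1 - sqrt \<rho>) * ((norm x)\<^sup>2 + (norm y)\<^sup>2) \<le> mpcn_form \<rho> x y"
proof -
  have "2 * (x \<bullet> y) \<le> (norm x)\<^sup>2 + (norm y)\<^sup>2"
    using norm_cauchy_schwarz[of x y] sum_squares_bound[of "norm x" "norm y"] by linarith
  then have "sqrt \<rho> * (2 * (x \<bullet> y)) \<le> sqrt \<rho> * ((norm x)\<^sup>2 + (norm y)\<^sup>2)"
    using assms by (intro mult_left_mono) auto
  then show ?thesis by (simp add: mpcn_form_def algebra_simps)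
qed

lemma mpcn_form_upper:
  assumes "0 \<le> \<rho>" "\<rho> \<le> 1"
  shows "mpcn_form \<rho> x y \<le> 2 * ((norm x)\<^sup>2 + (norm y)\<^sup>2)"
proof -
  have "- (2 * (x \<bullet> y)) \<le> (norm x)\<^sup>2 + (norm y)\<^sup>2"
    using norm_cauchy_schwarz[of "-x" y] sum_squares_bound[of "norm x" "norm y"] by simp
  then have "sqrt \<rho> * (- (2 * (x \<bullet> y))) \<le> sqrt \<rho> * ((norm x)\<^sup>2 + (norm y)\<^sup>2)"
    using assms by (intro mult_left_mono) auto
  also have "\<dots> \<le> 1 * ((norm x)\<^sup>2 + (norm y)\<^sup>2)"
    using assms by (intro mult_right_mono) auto
  finally show ?thesis by (simp add: mpcn_form_def)
qed

lemma mpcn_form_pos: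
  assumes "0 \<le> \<rho>" "\<rho> < 1" "x \<noteq> 0"
  shows "0 < mpcn_form \<rho> x y"
proof -
  have "0 < (1 - sqrt \<rho>) * ((norm x)\<^sup>2 + (norm y)\<^sup>2)"
    using assms by (intro mult_pos_pos add_pos_nonneg) auto
  then show ?thesis using mpcn_form_lower[OF assms(1), of x y] by linarith
qed

lemma mpcn_form_measurable [measurable]:
  "case_prod (mpcn_form \<rho> :: real ^ 'd \<Rightarrow> _) \<in> borel_measurable (borel \<Otimes>\<^sub>M borel)"
  unfolding mpcn_form_def by measurable

text \<open>Up to normalisation, the multivariate Student density with d degrees of freedom, centred
  at \<open>sqrt \<rho> *\<^sub>R x\<close> and with scale proportional to
  \<open>norm x\<close>.\<close>

definition mpcn_density :: "real \<Rightarrow> real ^ 'd \<Rightarrow> real ^ 'd \<Rightarrow> real" where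
  "mpcn_density \<rho> x y = norm x ^ CARD('d) / mpcn_form \<rho> x y ^ CARD('d)"

text \<open>The two Gaussian exponents add up to |w|^2 (1 + |u|^2 / s^2) / 2. The dilation w -> c w
  with c = s / sqrt (s^2 + |u|^2) normalises this to |w|^2 / 2; the Jacobian c^d and the factor (c /
  s)^d multiply to the stated power, and the integral left over depends neither on u nor on
  s.\<close>

lemma gauss_pair_integral:
  fixes u :: "real ^ 'd"
  assumes s: "0 < s"
  shows "(\<integral>\<^sup>+(w :: real ^ 'd). ennreal (gauss_density w * (norm w / s) ^ CARD('d) * gauss_density ((norm w / s) *\<^sub>R u)) \<partial>lborel)
     = ennreal ((s / (s\<^sup>2 + (norm u)\<^sup>2)) ^ CARD('d)) *
        (\<integral>\<^sup>+w. ennreal (norm (w :: real ^ 'd) ^ CARD('d) * gauss_density w * (1 / sqrt (2 * pi)) ^ CARD('d)) \<partial>lborel)"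
proof -
  let ?d = "CARD('d)" and ?K = "(1 / sqrt (2 * pi)) ^ CARD('d)"
  define c where "c = s / sqrt (s\<^sup>2 + (norm u)\<^sup>2)"
  have q: "0 < s\<^sup>2 + (norm u)\<^sup>2" using s by (simp add: add_pos_nonneg)
  have c: "0 < c" using s q by (simp add: c_def)
  have c2: "c\<^sup>2 = s\<^sup>2 / (s\<^sup>2 + (norm u)\<^sup>2)" using q by (simp add: c_def power_divide)
  have pt: "gauss_density (c *\<^sub>R w) * (norm (c *\<^sub>R w) / s) ^ ?d * gauss_density ((norm (c *\<^sub>R w) / s) *\<^sub>R u)
      = (c / s) ^ ?d * (norm w ^ ?d * gauss_density w * ?K)" for w :: "real ^ 'd"
  proof -
    have "(norm (c *\<^sub>R w))\<^sup>2 / 2 + (norm ((norm (c *\<^sub>R w) / s) *\<^sub>R u))\<^sup>2 / 2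
        = (norm w)\<^sup>2 / 2 * (c\<^sup>2 * (1 + (norm u)\<^sup>2 / s\<^sup>2))"
      using c s by (simp add: power_mult_distrib power_divide field_simps)
    also have "c\<^sup>2 * (1 + (norm u)\<^sup>2 / s\<^sup>2) = 1"
    proof -
      have "1 + (norm u)\<^sup>2 / s\<^sup>2 = (s\<^sup>2 + (norm u)\<^sup>2) / s\<^sup>2"
        using s by (simp add: add_divide_distrib)
      then show ?thesis unfolding c2 using s q by simp
    qed
    finally have e: "exp (- (norm (c *\<^sub>R w))\<^sup>2 / 2) * exp (- (norm ((norm (c *\<^sub>R w) / s) *\<^sub>R u))\<^sup>2 / 2) = exp (- (norm w)\<^sup>2 / 2)"
      by (simp add: exp_add[symmetric] del: norm_scaleR)
    have "gauss_density (c *\<^sub>R w) * (norm (c *\<^sub>R w) / s) ^ ?d * gauss_density ((norm (c *\<^sub>R w) / s) *\<^sub>R u)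
        = ?K * ?K * (norm (c *\<^sub>R w) / s) ^ ?d *
          (exp (- (norm (c *\<^sub>R w))\<^sup>2 / 2) * exp (- (norm ((norm (c *\<^sub>R w) / s) *\<^sub>R u))\<^sup>2 / 2))"
      unfolding gauss_density_def by (simp only: mult_ac)
    also have "\<dots> = (c / s) ^ ?d * (norm w ^ ?d * gauss_density w * ?K)"
      unfolding e gauss_density_def using c by (simp add: power_mult_distrib power_divide mult_ac)
    finally show ?thesis .
  qed
  have "(\<integral>\<^sup>+(w :: real ^ 'd). ennreal (gauss_density w * (norm w / s) ^ ?d * gauss_density ((norm w / s) *\<^sub>R u)) \<partial>lborel)
      = ennreal (c ^ ?d) * (\<integral>\<^sup>+(w :: real ^ 'd). ennreal (gauss_density (c *\<^sub>R w) * (norm (c *\<^sub>R w) / s) ^ ?d *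
          gauss_density ((norm (c *\<^sub>R w) / s) *\<^sub>R u)) \<partial>lborel)"
  proof -
    have "(\<lambda>w. ennreal (gauss_density w * (norm w / s) ^ ?d * gauss_density ((norm w / s) *\<^sub>R u))) \<in> borel_measurable borel"
      by measurable
    from nn_integral_lborel_scale[OF this c] show ?thesis by simp
  qed
  also have "\<dots> = ennreal (c ^ ?d) *
        (\<integral>\<^sup>+w. ennreal ((c / s) ^ ?d) * ennreal (norm (w :: real ^ 'd) ^ ?d * gauss_density w * ?K) \<partial>lborel)"
    unfolding pt by (subst ennreal_mult') (use c s in auto)
  also have "\<dots> = ennreal (c ^ ?d) * ennreal ((c / s) ^ ?d) * 
        (\<integral>\<^sup>+w. ennreal (norm (w :: real ^ 'd) ^ ?d * gauss_density w * ?K) \<partial>lborel)"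
    by (subst nn_integral_cmult) (auto simp: mult.assoc)
  also have "ennreal (c ^ ?d) * ennreal ((c / s) ^ ?d) = ennreal ((s / (s\<^sup>2 + (norm u)\<^sup>2)) ^ ?d)"
  proof -
    have "c * (c / s) = s / (s\<^sup>2 + (norm u)\<^sup>2)"
      using c2 s by (simp add: power2_eq_square field_simps)
    then have "c ^ ?d * (c / s) ^ ?d = (s / (s\<^sup>2 + (norm u)\<^sup>2)) ^ ?d"
      by (simp only: power_mult_distrib[symmetric])
    then show ?thesis using c s by (subst ennreal_mult[symmetric]) auto
  qed
  finally show ?thesis .
qed

text \<open>Integrating out the numerator vector for a fixed denominator vector w' gives a Gaussian
  density in y; after Fubini, \<open>gauss_pair_integral\<close> integrates over w'. The completed
  square \<open>mpcn_form_eq\<close> identifies the result.\<close>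

lemma mpcn_proposal_density:
  assumes \<rho>: "0 < \<rho>" "\<rho> < 1"
  shows "\<exists>c>0. \<forall>x. x \<noteq> 0 \<longrightarrow>
    mpcn_proposal \<rho> x = density lborel (\<lambda>y :: real ^ 'd. ennreal (c * mpcn_density \<rho> x y)) \<and>
    (\<integral>\<^sup>+y. ennreal (c * mpcn_density \<rho> x y) \<partial>lborel) = 1"
proof -
  let ?d = "CARD('d)" and ?N = "std_normal_vec :: (real ^ 'd) measure"
  define C where "C = (\<integral>\<^sup>+w. ennreal (norm (w :: real ^ 'd) ^ ?d * gauss_density w * (1 / sqrt (2 * pi)) ^ ?d) \<partial>lborel)"
  define k where "k = sqrt (1 - \<rho>) ^ ?d"
  have k: "0 < k" using \<rho> by (simp add: k_def)
  interpret N: prob_space ?N by (rule prob_space_std_normal_vec)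
  interpret NN: pair_prob_space ?N ?N ..
  have sN [measurable_cong]: "sets ?N = sets borel" by (simp add: std_normal_vec_eq)
  have m [measurable]: "(\<lambda>(w, w'). sqrt \<rho> *\<^sub>R x + (sqrt (1 - \<rho>) * norm x / norm (w' :: real ^ 'd)) *\<^sub>R w)
      \<in> borel_measurable (?N \<Otimes>\<^sub>M ?N)" for x
    by measurable
  have dens_meas [measurable]: "(\<lambda>y. mpcn_density \<rho> x y) \<in> borel_measurable borel" for x :: "real ^ 'd"
    unfolding mpcn_density_def mpcn_form_def by measurable
  have main: "emeasure (mpcn_proposal \<rho> x) A = C * (\<integral>\<^sup>+y. ennreal (k * mpcn_density \<rho> x y) * indicator A y \<partial>lborel)"
    if x: "x \<noteq> 0" and A [measurable]: "A \<in> sets borel" for x :: "real ^ 'd" and A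
  proof -
    define s where "s = sqrt (1 - \<rho>) * norm x"
    have s: "0 < s" using \<rho> x by (simp add: s_def)
    let ?i = "\<lambda>z. indicator A z :: ennreal"
    have "emeasure (mpcn_proposal \<rho> x) A
        = (\<integral>\<^sup>+ww. ?i (sqrt \<rho> *\<^sub>R x + (s / norm (snd ww)) *\<^sub>R fst ww) \<partial>(?N \<Otimes>\<^sub>M ?N))"
      unfolding mpcn_proposal_def
      by (subst nn_integral_indicator[symmetric], simp, subst nn_integral_distr)
         (auto simp: case_prod_beta s_def intro!: nn_integral_cong)
    also have "\<dots> = (\<integral>\<^sup>+(w' :: real ^ 'd). \<integral>\<^sup>+w. ?i (sqrt \<rho> *\<^sub>R x + (s / norm w') *\<^sub>R w) \<partial>?N \<partial>?N)"
      by (subst NN.nn_integral_snd[symmetric]) auto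
    also have "\<dots> = (\<integral>\<^sup>+(w' :: real ^ 'd). ennreal (gauss_density w') *
        (\<integral>\<^sup>+w. ennreal (gauss_density w) * ?i (sqrt \<rho> *\<^sub>R x + (s / norm w') *\<^sub>R w) \<partial>lborel) \<partial>lborel)"
      by (subst nn_integral_std_normal_vec, measurable) (intro nn_integral_cong arg_cong2[where f = times] refl,
        subst nn_integral_std_normal_vec, auto)
    \<comment> \<open>For fixed nonzero w' the proposed point is affine in w. Using it as the new
      variable y puts the Jacobian \<open>(norm w' / s) ^ CARD('d)\<close> into the density.\<close>
    also have "\<dots> = (\<integral>\<^sup>+(w' :: real ^ 'd). (\<integral>\<^sup>+y. ennreal (gauss_density w' * (norm w' / s) ^ ?d * gauss_density ((norm w' / s) *\<^sub>R (y - sqrt \<rho> *\<^sub>R x))) * ?i y \<partial>lborel) \<partial>lborel)"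
    proof (rule nn_integral_cong_AE)
      have "AE w' in lborel. (w' :: real ^ 'd) \<noteq> 0" by (rule AE_lborel_singleton)
      then show "AE w' :: real ^ 'd in lborel. ennreal (gauss_density w') *
        (\<integral>\<^sup>+w. ennreal (gauss_density w) * ?i (sqrt \<rho> *\<^sub>R x + (s / norm w') *\<^sub>R w) \<partial>lborel)
        = (\<integral>\<^sup>+y. ennreal (gauss_density w' * (norm w' / s) ^ ?d * gauss_density ((norm w' / s) *\<^sub>R (y - sqrt \<rho> *\<^sub>R x))) * ?i y \<partial>lborel)"
      proof eventually_elim
        case (elim w')
        let ?c = "norm w' / s"
        have c: "0 < ?c" using s elim by simp
        have "(\<integral>\<^sup>+w. ennreal (gauss_density w) * ?i (sqrt \<rho> *\<^sub>R x + (s / norm w') *\<^sub>R w) \<partial>lborel)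
          = ennreal (?c ^ ?d) * (\<integral>\<^sup>+y. ennreal (gauss_density (- ((?c * sqrt \<rho>) *\<^sub>R x) + ?c *\<^sub>R y)) *
              ?i (sqrt \<rho> *\<^sub>R x + (s / norm w') *\<^sub>R (- ((?c * sqrt \<rho>) *\<^sub>R x) + ?c *\<^sub>R y)) \<partial>lborel)"
          by (subst nn_integral_lborel_affine[OF _ c, of _ "- ((?c * sqrt \<rho>) *\<^sub>R x)"]) auto
        also have "\<dots> = ennreal (?c ^ ?d) * (\<integral>\<^sup>+y. ennreal (gauss_density (?c *\<^sub>R (y - sqrt \<rho> *\<^sub>R x))) * ?i y \<partial>lborel)"
          using s elim by (simp add: scaleR_diff_right scaleR_add_right)
        finally have "ennreal (gauss_density w') *
            (\<integral>\<^sup>+w. ennreal (gauss_density w) * ?i (sqrt \<rho> *\<^sub>R x + (s / norm w') *\<^sub>R w) \<partial>lborel)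
          = ennreal (gauss_density w' * ?c ^ ?d) * (\<integral>\<^sup>+y. ennreal (gauss_density (?c *\<^sub>R (y - sqrt \<rho> *\<^sub>R x))) * ?i y \<partial>lborel)"
          using s gauss_density_pos[of w'] by (simp add: ennreal_mult mult.assoc less_imp_le)
        also have "\<dots> = (\<integral>\<^sup>+y. ennreal (gauss_density w' * ?c ^ ?d * gauss_density (?c *\<^sub>R (y - sqrt \<rho> *\<^sub>R x))) * ?i y \<partial>lborel)"
          using s gauss_density_pos[of w'] gauss_density_pos
          by (subst nn_integral_cmult[symmetric])
            (auto simp: ennreal_mult''[symmetric] less_imp_le mult.assoc[symmetric] intro!: nn_integral_cong)
        finally show ?case .
      qed
    qed
    also have "\<dots> = (\<integral>\<^sup>+y. (\<integral>\<^sup>+(w' :: real ^ 'd). ennreal (gauss_density w' * (norm w' / s) ^ ?d * gauss_density ((norm w' / s) *\<^sub>R (y - sqrt \<rho> *\<^sub>R x))) * ?i y \<partial>lborel) \<partial>lborel)"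
      by (rule lborel_pair.Fubini') measurable
    also have "\<dots> = (\<integral>\<^sup>+y. C * (ennreal (k * mpcn_density \<rho> x y) * ?i y) \<partial>lborel)"
    proof (rule nn_integral_cong)
      fix y :: "real ^ 'd"
      have "(s / (s\<^sup>2 + (norm (y - sqrt \<rho> *\<^sub>R x))\<^sup>2)) ^ ?d = k * mpcn_density \<rho> x y"
        using \<rho> by (simp add: mpcn_density_def mpcn_form_eq s_def k_def power_divide power_mult_distrib)
      moreover have "(\<integral>\<^sup>+(w' :: real ^ 'd). ennreal (gauss_density w' * (norm w' / s) ^ ?d * gauss_density ((norm w' / s) *\<^sub>R (y - sqrt \<rho> *\<^sub>R x))) * ?i y \<partial>lborel)
          = (\<integral>\<^sup>+(w' :: real ^ 'd). ennreal (gauss_density w' * (norm w' / s) ^ ?d * gauss_density ((norm w' / s) *\<^sub>R (y - sqrt \<rho> *\<^sub>R x))) \<partial>lborel) * ?i y"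
        by (rule nn_integral_multc) measurable
      ultimately show "(\<integral>\<^sup>+(w' :: real ^ 'd). ennreal (gauss_density w' * (norm w' / s) ^ ?d * gauss_density ((norm w' / s) *\<^sub>R (y - sqrt \<rho> *\<^sub>R x))) * ?i y \<partial>lborel)
          = C * (ennreal (k * mpcn_density \<rho> x y) * ?i y)"
        by (simp only: gauss_pair_integral[OF s] C_def[symmetric]) (simp only: mult_ac)
    qed
    also have "\<dots> = C * (\<integral>\<^sup>+y. ennreal (k * mpcn_density \<rho> x y) * ?i y \<partial>lborel)"
      by (rule nn_integral_cmult) measurable
    finally show ?thesis .
  qed
  have total: "C * (\<integral>\<^sup>+y. ennreal (k * mpcn_density \<rho> x y) \<partial>lborel) = 1" if "x \<noteq> 0" for x :: "real ^ 'd"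
  proof -
    have "emeasure (mpcn_proposal \<rho> x) UNIV = 1"
      using prob_space.emeasure_space_1[OF NN.prob_space_distr[OF m[of x]]] by (simp add: mpcn_proposal_def)
    then show ?thesis using main[OF that, of UNIV] by simp
  qed
  \<comment> \<open>The value of \<open>C\<close> does not have to be computed: total mass 1 of the
    proposal excludes 0 and infinity.\<close>
  have "C \<noteq> 0" "C \<noteq> \<top>"
    using total[of 1] by (auto simp: ennreal_top_mult split: if_splits)
  then obtain c where c: "C = ennreal c" "0 < c"
    by (cases C) (auto simp: ennreal_eq_0_iff not_le)
  have dens: "C * (\<integral>\<^sup>+y. ennreal (k * mpcn_density \<rho> x y) * f y \<partial>lborel) = (\<integral>\<^sup>+y. ennreal (c * k * mpcn_density \<rho> x y) * f y \<partial>lborel)"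
    if [measurable]: "f \<in> borel_measurable borel" for f and x :: "real ^ 'd"
  proof -
    have "C * (\<integral>\<^sup>+y. ennreal (k * mpcn_density \<rho> x y) * f y \<partial>lborel)
        = (\<integral>\<^sup>+y. C * (ennreal (k * mpcn_density \<rho> x y) * f y) \<partial>lborel)"
      by (rule nn_integral_cmult[symmetric]) measurable
    also have "\<dots> = (\<integral>\<^sup>+y. ennreal (c * k * mpcn_density \<rho> x y) * f y \<partial>lborel)"
    proof (intro nn_integral_cong)
      fix y
      have "ennreal (c * k * mpcn_density \<rho> x y) = C * ennreal (k * mpcn_density \<rho> x y)"
        using c by (simp add: ennreal_mult'[symmetric] mult.assoc)
      then show "C * (ennreal (k * mpcn_density \<rho> x y) * f y) = ennreal (c * k * mpcn_density \<rho> x y) * f y"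
        by (simp add: mult.assoc)
    qed
    finally show ?thesis .
  qed
  show ?thesis
  proof (intro exI[of _ "c * k"] conjI allI impI)
    fix x :: "real ^ 'd" assume x: "x \<noteq> 0"
    show "mpcn_proposal \<rho> x = density lborel (\<lambda>y. ennreal (c * k * mpcn_density \<rho> x y))"
    proof (rule measure_eqI)
      fix A assume "A \<in> sets (mpcn_proposal \<rho> x)"
      then have A [measurable]: "A \<in> sets borel" by (simp add: mpcn_proposal_def)
      show "emeasure (mpcn_proposal \<rho> x) A = emeasure (density lborel (\<lambda>y. ennreal (c * k * mpcn_density \<rho> x y))) A"
        using main[OF x A] by (simp add: emeasure_density dens)
    qed (simp add: mpcn_proposal_def)
    show "(\<integral>\<^sup>+y. ennreal (c * k * mpcn_density \<rho> x y) \<partial>lborel) = 1"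
      using total[OF x] dens[of "\<lambda>_. 1" x] by simp
  qed (use c k in simp)
qed

section \<open>Invariance under inversion\<close>

text \<open>The dilation-invariant measure: in the coordinates \<open>(ln (norm z), sgn z)\<close>
  it is Lebesgue measure times surface measure on the sphere.\<close>

definition conformal :: "'a::euclidean_space measure" where
  "conformal = density lborel (\<lambda>z. ennreal (1 / norm z ^ DIM('a)))"

lemma sets_conformal [measurable_cong, simp]: "sets conformal = sets borel"
  and space_conformal [simp]: "space conformal = UNIV"
  by (simp_all add: conformal_def)

lemma nn_integral_conformal:
  fixes f :: "'a::euclidean_space \<Rightarrow> ennreal"
  assumes [measurable]: "f \<in> borel_measurable borel"
  shows "(\<integral>\<^sup>+z. f z \<partial>conformal) = (\<integral>\<^sup>+z. ennreal (1 / norm z ^ DIM('a)) * f z \<partial>lborel)"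
  unfolding conformal_def by (subst nn_integral_density) auto

lemma AE_conformal_nonzero: "AE z in conformal. (z :: 'a::euclidean_space) \<noteq> 0"
  unfolding conformal_def by (subst AE_density) (use AE_lborel_singleton[of "0::'a"] in auto)

lemma nn_integral_conformal_scale:
  fixes f :: "'a::euclidean_space \<Rightarrow> ennreal"
  assumes f [measurable]: "f \<in> borel_measurable borel" and c: "0 < c"
  shows "(\<integral>\<^sup>+z. f (c *\<^sub>R z) \<partial>conformal) = (\<integral>\<^sup>+z. f z \<partial>conformal)"
proof -
  let ?d = "DIM('a)"
  have "(\<integral>\<^sup>+z. f z \<partial>conformal) = ennreal (c ^ ?d) * (\<integral>\<^sup>+z. ennreal (1 / norm (c *\<^sub>R z) ^ ?d) * f (c *\<^sub>R z) \<partial>lborel)"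
    unfolding nn_integral_conformal[OF f] by (rule nn_integral_lborel_scale[OF _ c]) measurable
  also have "\<dots> = (\<integral>\<^sup>+z. ennreal (c ^ ?d) * (ennreal (1 / norm (c *\<^sub>R z) ^ ?d) * f (c *\<^sub>R z)) \<partial>lborel)"
    by (rule nn_integral_cmult[symmetric]) measurable
  also have "\<dots> = (\<integral>\<^sup>+z. ennreal (1 / norm z ^ ?d) * f (c *\<^sub>R z) \<partial>lborel)"
  proof (rule nn_integral_cong)
    fix z :: 'a
    have "c ^ ?d * (1 / norm (c *\<^sub>R z) ^ ?d) = 1 / norm z ^ ?d"
      using c by (simp add: power_mult_distrib)
    then show "ennreal (c ^ ?d) * (ennreal (1 / norm (c *\<^sub>R z) ^ ?d) * f (c *\<^sub>R z)) = ennreal (1 / norm z ^ ?d) * f (c *\<^sub>R z)"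
      using c by (simp only: mult.assoc[symmetric] ennreal_mult'[symmetric] zero_le_power less_imp_le)
  qed
  also have "\<dots> = (\<integral>\<^sup>+z. f (c *\<^sub>R z) \<partial>conformal)"
    by (rule nn_integral_conformal[symmetric]) measurable
  finally show ?thesis ..
qed

definition inversion :: "'a::euclidean_space \<Rightarrow> 'a" where
  "inversion z = (1 / (norm z)\<^sup>2) *\<^sub>R z"

lemma inversion_measurable [measurable]: "inversion \<in> borel_measurable borel"
  unfolding inversion_def[abs_def] by measurable

lemma norm_inversion: "norm (inversion z) = 1 / norm z"
  by (simp add: inversion_def power2_eq_square)

lemma sgn_inversion: "sgn (inversion z) = sgn z"
  by (cases "z = 0") (simp_all add: inversion_def sgn_scaleR)

lemma Int_stable_open_interval_times:
  "Int_stable {a \<times> b |a b. a \<in> range (\<lambda>(l, u). {l<..<u::real}) \<and> b \<in> sets M}"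
proof (rule Int_stableI, clarify)
  fix l u l' u' :: real and b b' assume "b \<in> sets M" "b' \<in> sets M"
  then show "\<exists>a'' b''. ({l<..<u} \<times> b) \<inter> ({l'<..<u'} \<times> b') = a'' \<times> b'' \<and>
      a'' \<in> range (\<lambda>(l, u). {l<..<u}) \<and> b'' \<in> sets M"
    by (intro exI[of _ "{max l l'<..<min u u'}"] exI[of _ "b \<inter> b'"])
       (auto intro!: image_eqI[of _ _ "(max l l', min u u')"])
qed

lemma sets_borel_open_interval: "sets (borel :: real measure) = sigma_sets UNIV (range (\<lambda>(l, u). {l<..<u}))"
  by (subst borel_eq_box) (auto simp: box_real case_prod_beta intro!: arg_cong[where f = "sigma_sets UNIV"])

text \<open>Products of an interval of log-radii and a set of directions form an intersection-stable
  generator in log-polar coordinates. The map \<Psi> recovers z from its coordinates, at the origin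
  too, because \<open>sgn 0 = 0\<close>.\<close>

lemma polar_measure_eqI:
  fixes M N :: "'a::euclidean_space measure"
  assumes s [measurable_cong, simp]: "sets M = sets borel" "sets N = sets borel"
    and eq: "\<And>l u C. C \<in> sets borel \<Longrightarrow>
      emeasure M {z. l < ln (norm z) \<and> ln (norm z) < u \<and> sgn z \<in> C} =
      emeasure N {z. l < ln (norm z) \<and> ln (norm z) < u \<and> sgn z \<in> C}"
    and fin: "\<And>l u. emeasure M {z. l < ln (norm z) \<and> ln (norm z) < u} \<noteq> \<infinity>"
  shows "M = N"
proof -
  define \<Phi> where "\<Phi> z = (ln (norm z), sgn z)" for z :: 'a
  define \<Psi> where "\<Psi> = (\<lambda>(t, \<theta>). exp t *\<^sub>R (\<theta> :: 'a))"
  have [measurable]: "\<Phi> \<in> borel \<rightarrow>\<^sub>M borel \<Otimes>\<^sub>M borel"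
    unfolding \<Phi>_def[abs_def] sgn_div_norm by measurable
  have [measurable]: "\<Psi> \<in> borel \<Otimes>\<^sub>M borel \<rightarrow>\<^sub>M borel"
    unfolding \<Psi>_def by measurable
  have inv: "\<Psi> (\<Phi> z) = z" for z
    by (cases "z = 0") (simp_all add: \<Phi>_def \<Psi>_def sgn_div_norm)
  have sp: "space M = UNIV" "space N = UNIV"
    using s[THEN sets_eq_imp_space_eq] by simp_all
  let ?B = "borel \<Otimes>\<^sub>M borel :: (real \<times> 'a) measure"
  let ?I = "range (\<lambda>(l, u). {l<..<u::real})"
  let ?E = "{a \<times> b |a b. a \<in> ?I \<and> b \<in> sets (borel :: 'a measure)}"
  have vim: "\<Phi> -` ({l<..<u} \<times> C) = {z. l < ln (norm z) \<and> ln (norm z) < u \<and> sgn z \<in> C}" for l u C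
    by (auto simp: \<Phi>_def)
  have gen: "sets ?B = sigma_sets UNIV ?E"
  proof -
    have ex: "\<Union> (range (\<lambda>n::nat. {- real n<..<real n})) = UNIV"
    proof (intro equalityI subsetI UNIV_I)
      fix t :: real
      obtain n :: nat where "\<bar>t\<bar> < real n" using reals_Archimedean2 by blast
      then have "t \<in> {- real n<..<real n}" by auto
      then show "t \<in> \<Union> (range (\<lambda>n::nat. {- real n<..<real n}))" by blast
    qed
    have "sets ?B = sets (sigma (space borel \<times> space borel) ?E)"
    proof (rule sets_pair_eq)
      show "range (\<lambda>n::nat. {- real n<..<real n}) \<subseteq> ?I" by auto
      show "\<Union> (range (\<lambda>n::nat. {- real n<..<real n})) = space borel" using ex by simp
      show "sets (borel :: 'a measure) = sigma_sets (space borel) (sets borel)"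
        by (metis sets.sigma_sets_eq)
      show "{UNIV} \<subseteq> sets (borel :: 'a measure)" by simp
    qed (auto simp: sets_borel_open_interval)
    then show ?thesis by simp
  qed
  have "distr M ?B \<Phi> = distr N ?B \<Phi>"
  proof (rule measure_eqI_generator_eq[OF Int_stable_open_interval_times[of "borel :: 'a measure"],
        of _ _ _ "\<lambda>n. {- real n<..<real n} \<times> UNIV"])
    show "?E \<subseteq> Pow UNIV" by simp
    show "emeasure (distr M ?B \<Phi>) X = emeasure (distr N ?B \<Phi>) X" if "X \<in> ?E" for X
    proof -
      from that obtain l u C where X: "X = {l<..<u} \<times> C" "C \<in> sets borel" by auto
      then have XB: "X \<in> sets ?B" by auto
      show ?thesis
        using XB eq[OF X(2), of l u] X(1) vim[of l u C] by (simp add: emeasure_distr sp)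
    qed
    show "sets (distr M ?B \<Phi>) = sigma_sets UNIV ?E" "sets (distr N ?B \<Phi>) = sigma_sets UNIV ?E"
      using gen by simp_all
    show "range (\<lambda>n. {- real n<..<real n} \<times> UNIV) \<subseteq> ?E"
    proof (rule image_subsetI, rule CollectI, intro exI conjI)
      show "{- real n<..<real n} \<in> ?I" for n
        by (rule image_eqI[of _ _ "(- real n, real n)"]) auto
    qed auto
    show "\<Union> (range (\<lambda>n. {- real n<..<real n} \<times> (UNIV :: 'a set))) = UNIV"
    proof (intro equalityI subsetI UNIV_I)
      fix p :: "real \<times> 'a"
      obtain n :: nat where "\<bar>fst p\<bar> < real n" using reals_Archimedean2 by blast
      then have "p \<in> {- real n<..<real n} \<times> UNIV" by (cases p) auto
      then show "p \<in> \<Union> (range (\<lambda>n. {- real n<..<real n} \<times> (UNIV :: 'a set)))" by blast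
    qed
    show "emeasure (distr M ?B \<Phi>) ({- real n<..<real n} \<times> UNIV) \<noteq> \<infinity>" for n
      using fin[of "- real n" "real n"] vim[of "- real n" "real n" UNIV] by (simp add: emeasure_distr sp)
  qed
  then have "distr (distr M ?B \<Phi>) borel \<Psi> = distr (distr N ?B \<Phi>) borel \<Psi>" by simp
  then have "distr M borel id = distr N borel id"
    by (simp add: distr_distr comp_def inv id_def)
  then show ?thesis
    by (simp add: id_def distr_id2)
qed

text \<open>No Jacobian of the inversion is computed. On a log-polar box, inversion keeps the
  directions and reflects the interval (l, u) of log-radii to (-u, -l). The dilation by exp (-(l +
  u)) carries (l, u) to the same interval, so dilation invariance already gives equal
  measures.\<close>

theorem distr_conformal_inversion: "conformal = distr conformal borel (inversion :: 'a::euclidean_space \<Rightarrow> 'a)"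
proof -
  let ?c = "conformal :: 'a measure"
  show ?thesis
  proof (rule polar_measure_eqI)
    fix l u :: real and C :: "'a set" assume C [measurable]: "C \<in> sets borel"
    let ?A = "\<lambda>l u. {z :: 'a. l < ln (norm z) \<and> ln (norm z) < u \<and> sgn z \<in> C}"
    have A [measurable]: "?A l u \<in> sets borel" for l u unfolding sgn_div_norm by measurable
    let ?r = "exp (- (l + u))"
    have "emeasure ?c (?A l u) = (\<integral>\<^sup>+z. indicator (?A l u) z \<partial>?c)" by simp
    also have "\<dots> = (\<integral>\<^sup>+z. indicator (?A (-u) (-l)) (?r *\<^sub>R z) \<partial>?c)"
    proof (rule nn_integral_cong_AE)
      show "AE z in ?c. indicator (?A l u) z = (indicator (?A (-u) (-l)) (?r *\<^sub>R z) :: ennreal)"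
        using AE_conformal_nonzero
      proof eventually_elim
        case (elim z)
        then have "ln (norm (?r *\<^sub>R z)) = - (l + u) + ln (norm z)"
          by (simp add: ln_mult)
        moreover have "sgn (?r *\<^sub>R z) = sgn z" by (simp add: sgn_scaleR)
        ultimately show ?case by (auto simp: indicator_def)
      qed
    qed
    also have "\<dots> = (\<integral>\<^sup>+z. indicator (?A (-u) (-l)) z \<partial>?c)"
      by (rule nn_integral_conformal_scale) auto
    also have "\<dots> = (\<integral>\<^sup>+z. indicator (?A l u) (inversion z) \<partial>?c)"
    proof (rule nn_integral_cong_AE)
      show "AE z in ?c. indicator (?A (-u) (-l)) z = (indicator (?A l u) (inversion z) :: ennreal)"
        using AE_conformal_nonzero
      proof eventually_elim
        case (elim z)
        then have "ln (norm (inversion z)) = - ln (norm z)"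
          by (simp add: norm_inversion ln_div)
        then show ?case by (auto simp: indicator_def sgn_inversion)
      qed
    qed
    also have "\<dots> = (\<integral>\<^sup>+z. indicator (?A l u) z \<partial>distr ?c borel inversion)"
      by (rule nn_integral_distr[symmetric]) auto
    also have "\<dots> = emeasure (distr ?c borel inversion) (?A l u)" by (simp)
    finally show "emeasure ?c (?A l u) = emeasure (distr ?c borel inversion) (?A l u)" .
  next
    fix l u :: real
    let ?A = "{z :: 'a. l < ln (norm z) \<and> ln (norm z) < u}"
    have "emeasure ?c ?A = (\<integral>\<^sup>+z. indicator ?A z \<partial>?c)" by simp
    also have "\<dots> = (\<integral>\<^sup>+z. ennreal (1 / norm z ^ DIM('a)) * indicator ?A z \<partial>lborel)"
      by (rule nn_integral_conformal) auto
    also have "\<dots> \<le> (\<integral>\<^sup>+z. ennreal (1 / exp l ^ DIM('a)) * indicator (ball (0::'a) (max 1 (exp u))) z \<partial>lborel)"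
    proof (rule nn_integral_mono)
      fix z :: 'a
      show "ennreal (1 / norm z ^ DIM('a)) * indicator ?A z \<le> ennreal (1 / exp l ^ DIM('a)) * indicator (ball (0::'a) (max 1 (exp u))) z"
      proof (cases "z \<in> ?A \<and> z \<noteq> 0")
        case True
        then have "exp l \<le> norm z" "norm z < exp u"
          by (auto simp: less_imp_le exp_le_cancel_iff intro: ln_ge_iff[THEN iffD1])
            (metis exp_less_mono exp_ln zero_less_norm_iff)
        then show ?thesis using True by (auto simp: indicator_def intro!: ennreal_leI divide_left_mono power_mono)
      next
        case False
        then show ?thesis by (auto simp: indicator_def zero_power)
      qed
    qed
    also have "\<dots> = ennreal (1 / exp l ^ DIM('a)) * emeasure lborel (ball (0::'a) (max 1 (exp u)))"
      by (rule nn_integral_cmult_indicator) auto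
    also have "\<dots> < \<infinity>"
      using emeasure_lborel_ball_finite[of "0::'a" "max 1 (exp u)"] by (simp add: ennreal_mult_less_top)
    finally show "emeasure ?c ?A \<noteq> \<infinity>" by simp
  qed auto
qed

lemma nn_integral_conformal_inversion:
  fixes f :: "'a::euclidean_space \<Rightarrow> ennreal"
  assumes f [measurable]: "f \<in> borel_measurable borel"
  shows "(\<integral>\<^sup>+z. f (inversion z) \<partial>conformal) = (\<integral>\<^sup>+z. f z \<partial>conformal)"
proof -
  have "(\<integral>\<^sup>+z. f z \<partial>conformal) = (\<integral>\<^sup>+z. f z \<partial>distr conformal borel inversion)"
    using distr_conformal_inversion[where 'a = 'a] by simp
  also have "\<dots> = (\<integral>\<^sup>+z. f (inversion z) \<partial>conformal)" by (rule nn_integral_distr) auto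
  finally show ?thesis ..
qed

section \<open>Reversibility\<close>

text \<open>Adding constants reduces bounded functions to nonnegative ones. The cross terms are
  means of f and g or of their images under the kernel, and invariance makes them agree on both
  sides.\<close>

lemma (in invariant_kernel) reversible_kernelI:
  assumes rev: "\<And>f g :: 'a \<Rightarrow> ennreal. f \<in> borel_measurable M \<Longrightarrow> g \<in> borel_measurable M \<Longrightarrow>
    (\<integral>\<^sup>+x. f x * (\<integral>\<^sup>+y. g y \<partial>P x) \<partial>M) = (\<integral>\<^sup>+x. (\<integral>\<^sup>+y. f y \<partial>P x) * g x \<partial>M)"
  shows "reversible_kernel M P"
proof
  have nonneg: "(\<integral>x. f x * kernel_op P g x \<partial>M) = (\<integral>x. kernel_op P f x * g x \<partial>M)"
    if f: "f \<in> bdd_measurable M" "\<And>x. 0 \<le> f x" and g: "g \<in> bdd_measurable M" "\<And>x. 0 \<le> g x" for f g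
  proof -
    have op: "(\<integral>\<^sup>+y. ennreal (h y) \<partial>P x) = ennreal (kernel_op P h x)"
      if "h \<in> bdd_measurable M" "\<And>x. 0 \<le> h x" "x \<in> space M" for h x
      unfolding kernel_op_def using that by (intro nn_integral_eq_integral integrable_P) auto
    have nn: "0 \<le> kernel_op P h x" if "\<And>x. 0 \<le> h x" for h x
      unfolding kernel_op_def using that by (intro Bochner_Integration.integral_nonneg) auto
    have "ennreal (\<integral>x. f x * kernel_op P g x \<partial>M) = (\<integral>\<^sup>+x. ennreal (f x * kernel_op P g x) \<partial>M)"
      using f g nn by (intro nn_integral_eq_integral[symmetric] integrable_M bdd_measurable_mult kernel_op_bdd) auto
    also have "\<dots> = (\<integral>\<^sup>+x. ennreal (f x) * (\<integral>\<^sup>+y. ennreal (g y) \<partial>P x) \<partial>M)"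
      using f g nn by (intro nn_integral_cong) (simp add: op ennreal_mult)
    also have "\<dots> = (\<integral>\<^sup>+x. (\<integral>\<^sup>+y. ennreal (f y) \<partial>P x) * ennreal (g x) \<partial>M)"
      using f g by (intro rev) (auto simp: bdd_measurable_def)
    also have "\<dots> = (\<integral>\<^sup>+x. ennreal (kernel_op P f x * g x) \<partial>M)"
      using f g nn by (intro nn_integral_cong) (simp add: op ennreal_mult)
    also have "\<dots> = ennreal (\<integral>x. kernel_op P f x * g x \<partial>M)"
      using f g nn by (intro nn_integral_eq_integral integrable_M bdd_measurable_mult kernel_op_bdd) auto
    finally show ?thesis
      using f g nn by (subst (asm) ennreal_inj) (auto intro!: Bochner_Integration.integral_nonneg)
  qed
  fix f g assume f: "f \<in> bdd_measurable M" and g: "g \<in> bdd_measurable M"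
  obtain B where B: "0 \<le> B" "\<And>x. x \<in> space M \<Longrightarrow> \<bar>f x\<bar> \<le> B" using bdd_measurableD[OF f] by blast
  obtain C where C: "0 \<le> C" "\<And>x. x \<in> space M \<Longrightarrow> \<bar>g x\<bar> \<le> C" using bdd_measurableD[OF g] by blast
  \<comment> \<open>On \<open>space M\<close> the maximum is f + B; it is there because
    \<open>nonneg\<close> asks for nonnegativity at all points of the type.\<close>
  define f' where "f' x = max 0 (f x + B)" for x
  define g' where "g' x = max 0 (g x + C)" for x
  have f'_eq: "f' x = f x - - B" if "x \<in> space M" for x using B(2)[OF that] by (simp add: f'_def)
  have g'_eq: "g' x = g x - - C" if "x \<in> space M" for x using C(2)[OF that] by (simp add: g'_def)
  have f': "f' \<in> bdd_measurable M"
  proof (rule bdd_measurableI)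
    show "\<bar>f' x\<bar> \<le> 2 * B" if "x \<in> space M" for x using B(2)[OF that] by (simp add: f'_def)
  qed (use f in \<open>auto simp: f'_def[abs_def] bdd_measurable_def\<close>)
  have g': "g' \<in> bdd_measurable M"
  proof (rule bdd_measurableI)
    show "\<bar>g' x\<bar> \<le> 2 * C" if "x \<in> space M" for x using C(2)[OF that] by (simp add: g'_def)
  qed (use g in \<open>auto simp: g'_def[abs_def] bdd_measurable_def\<close>)
  have Pf': "kernel_op P f' x = kernel_op P f x + B" if "x \<in> space M" for x
    using kernel_op_cong[OF that f'_eq] kernel_op_diff[OF f bdd_measurable_const that, of "-B"]
    by (simp add: kernel_op_const[OF that])
  have Pg': "kernel_op P g' x = kernel_op P g x + C" if "x \<in> space M" for x
    using kernel_op_cong[OF that g'_eq] kernel_op_diff[OF g bdd_measurable_const that, of "-C"]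
    by (simp add: kernel_op_const[OF that])
  note ints = integrable_M[OF f] integrable_M[OF g] integrable_M[OF kernel_op_bdd[OF f]]
    integrable_M[OF kernel_op_bdd[OF g]] integrable_M[OF bdd_measurable_mult[OF f kernel_op_bdd[OF g]]]
    integrable_M[OF bdd_measurable_mult[OF kernel_op_bdd[OF f] g]]
  have "(\<integral>x. f' x * kernel_op P g' x \<partial>M)
      = (\<integral>x. f x * kernel_op P g x + C * f x + B * kernel_op P g x + B * C \<partial>M)"
    by (intro Bochner_Integration.integral_cong) (auto simp: f'_eq Pg' algebra_simps)
  also have "\<dots> = (\<integral>x. f x * kernel_op P g x \<partial>M) + C * (\<integral>x. f x \<partial>M) + B * (\<integral>x. g x \<partial>M) + B * C"
    using ints by (simp add: prob_space integral_kernel_op[OF g])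
  finally have 1: "(\<integral>x. f' x * kernel_op P g' x \<partial>M) = \<dots>" .
  have "(\<integral>x. kernel_op P f' x * g' x \<partial>M)
      = (\<integral>x. kernel_op P f x * g x + C * kernel_op P f x + B * g x + B * C \<partial>M)"
    by (intro Bochner_Integration.integral_cong) (auto simp: g'_eq Pf' algebra_simps)
  also have "\<dots> = (\<integral>x. kernel_op P f x * g x \<partial>M) + C * (\<integral>x. f x \<partial>M) + B * (\<integral>x. g x \<partial>M) + B * C"
    using ints by (simp add: prob_space integral_kernel_op[OF f])
  finally have 2: "(\<integral>x. kernel_op P f' x * g' x \<partial>M) = \<dots>" .
  have "(\<integral>x. f' x * kernel_op P g' x \<partial>M) = (\<integral>x. kernel_op P f' x * g' x \<partial>M)"
    by (rule nonneg[OF f' _ g']) (simp_all add: f'_def g'_def)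
  with 1 2 show "(\<integral>x. f x * kernel_op P g x \<partial>M) = (\<integral>x. kernel_op P f x * g x \<partial>M)" by simp
qed

section \<open>The MpCN kernel as a jump density and a holding mass\<close>

locale mpcn =
  fixes \<rho> c :: real and p :: "real ^ 'd \<Rightarrow> real"
  assumes \<rho>: "0 < \<rho>" "\<rho> < 1" and c_pos: "0 < c"
    and proposal: "x \<noteq> 0 \<Longrightarrow> mpcn_proposal \<rho> x = density lborel (\<lambda>y :: real ^ 'd. ennreal (c * mpcn_density \<rho> x y))"
    and proposal_total: "x \<noteq> 0 \<Longrightarrow> (\<integral>\<^sup>+(y :: real ^ 'd). ennreal (c * mpcn_density \<rho> x y) \<partial>lborel) = 1"
    and p_pos: "0 < p x"
    and p_cont: "continuous_on UNIV p"
    and target_prob: "prob_space (density lborel (\<lambda>x. ennreal (p x)))"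
begin

abbreviation target :: "(real ^ 'd) measure" where
  "target \<equiv> density lborel (\<lambda>x. ennreal (p x))"

text \<open>The density of the target with respect to \<open>conformal\<close>. The proposal is
  reversible for that measure, which is why acceptance compares values of \<open>wt\<close>.\<close>

definition wt :: "real ^ 'd \<Rightarrow> real" where "wt x = p x * norm x ^ CARD('d)"

definition jump :: "real ^ 'd \<Rightarrow> real ^ 'd \<Rightarrow> real" where
  "jump x y = c * mpcn_density \<rho> x y * min 1 (wt y / wt x)"

definition hold :: "real ^ 'd \<Rightarrow> ennreal" where
  "hold x = 1 - (\<integral>\<^sup>+y. ennreal (jump x y) \<partial>lborel)"

lemma p_meas [measurable]: "p \<in> borel_measurable borel"
  using p_cont by (rule borel_measurable_continuous_onI)

lemma wt_pos: "x \<noteq> 0 \<Longrightarrow> 0 < wt x"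
  using p_pos[of x] by (simp add: wt_def)

lemma wt_nonneg: "0 \<le> wt x"
  using p_pos[of x] by (simp add: wt_def less_imp_le)

lemma wt_meas [measurable]: "wt \<in> borel_measurable borel"
  unfolding wt_def[abs_def] by measurable

lemma accept_eq: "mpcn_accept p x y = min 1 (wt y / wt x)"
  by (simp add: mpcn_accept_def wt_def)

lemma mpcn_density_nonneg: "0 \<le> mpcn_density \<rho> x y"
proof (cases "x = 0")
  case False
  then show ?thesis using mpcn_form_pos[of \<rho> x y] \<rho> by (simp add: mpcn_density_def)
qed (simp add: mpcn_density_def zero_power)

lemma mpcn_density_meas [measurable]: "case_prod (mpcn_density \<rho> :: real ^ 'd \<Rightarrow> _) \<in> borel_measurable (borel \<Otimes>\<^sub>M borel)"
  unfolding mpcn_density_def by measurable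

lemma jump_meas [measurable]: "case_prod jump \<in> borel_measurable (borel \<Otimes>\<^sub>M borel)"
  unfolding jump_def by measurable

lemma accept_nonneg: "0 \<le> min 1 (wt y / wt x)"
  using wt_nonneg by simp

lemma jump_le: "jump x y \<le> c * mpcn_density \<rho> x y"
  unfolding jump_def using c_pos mpcn_density_nonneg[of x y] by (intro mult_left_le) auto

lemma jump_total_le: "x \<noteq> 0 \<Longrightarrow> (\<integral>\<^sup>+y. ennreal (jump x y) \<partial>lborel) \<le> 1"
  using nn_integral_mono[of lborel "\<lambda>y. ennreal (jump x y)" "\<lambda>y. ennreal (c * mpcn_density \<rho> x y)"]
    jump_le proposal_total[of x] by (simp add: ennreal_leI)

lemma hold_meas [measurable]: "hold \<in> borel_measurable borel"
  unfolding hold_def[abs_def] by measurable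

text \<open>Detailed balance: off the origin both sides are
  \<open>c / mpcn_form \<rho> x y ^ CARD('d) * min (wt x) (wt y)\<close>. If one point is the
  origin, the jump from it vanishes through the numerator of the density and the jump to it through
  \<open>wt 0 = 0\<close>.\<close>

lemma jump_symmetric: "p x * jump x y = p y * jump y x"
proof (cases "x = 0 \<or> y = 0")
  case True
  then have "jump x y = 0" "jump y x = 0"
    by (auto simp: jump_def mpcn_density_def wt_def zero_power)
  then show ?thesis by simp
next
  case False
  have *: "p x * jump x y = c / mpcn_form \<rho> x y ^ CARD('d) * min (wt x) (wt y)" if "x \<noteq> 0" for x y
  proof -
    have "wt x * min 1 (wt y / wt x) = min (wt x) (wt y)"
      using wt_pos[OF that] by (simp add: min_mult_distrib_left)
    moreover have "p x * jump x y = c / mpcn_form \<rho> x y ^ CARD('d) * (wt x * min 1 (wt y / wt x))"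
      by (simp add: jump_def mpcn_density_def wt_def mult_ac)
    ultimately show ?thesis by simp
  qed
  show ?thesis using False by (simp add: * mpcn_form_commute[of \<rho> x y] min.commute)
qed

lemma sets_kernel [simp]: "sets (mpcn_kernel \<rho> p x) = sets borel"
  using sets.sigma_sets_eq[of "borel :: (real ^ 'd) measure"]
  by (simp add: mpcn_kernel_def sets_measure_of)

lemma emeasure_kernel:
  assumes x: "x \<noteq> 0" and A [measurable]: "A \<in> sets borel"
  shows "emeasure (mpcn_kernel \<rho> p x) A = (\<integral>\<^sup>+y. ennreal (jump x y) * indicator A y \<partial>lborel) + indicator A x * hold x"
proof -
  have *: "(\<integral>\<^sup>+y. ennreal (mpcn_accept p x y) * f y \<partial>mpcn_proposal \<rho> x) = (\<integral>\<^sup>+y. ennreal (jump x y) * f y \<partial>lborel)"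
    if [measurable]: "f \<in> borel_measurable borel" for f
  proof -
    have "(\<integral>\<^sup>+y. ennreal (mpcn_accept p x y) * f y \<partial>mpcn_proposal \<rho> x)
       = (\<integral>\<^sup>+y. ennreal (c * mpcn_density \<rho> x y) * (ennreal (mpcn_accept p x y) * f y) \<partial>lborel)"
      unfolding proposal[OF x] by (rule nn_integral_density) (auto simp: accept_eq)
    also have "\<dots> = (\<integral>\<^sup>+y. ennreal (jump x y) * f y \<partial>lborel)"
    proof (intro nn_integral_cong)
      fix y
      have "ennreal (c * mpcn_density \<rho> x y) * ennreal (mpcn_accept p x y) = ennreal (jump x y)"
        unfolding jump_def accept_eq using accept_nonneg by (intro ennreal_mult''[symmetric]) auto
      then show "ennreal (c * mpcn_density \<rho> x y) * (ennreal (mpcn_accept p x y) * f y) = ennreal (jump x y) * f y"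
        by (simp add: mult.assoc[symmetric])
    qed
    finally show ?thesis .
  qed
  show ?thesis
    using emeasure_mpcn_kernel[OF p_meas x A, of \<rho>] *[of "indicator A"] *[of "\<lambda>_. 1"]
    by (simp add: hold_def)
qed

lemma nn_integral_kernel:
  assumes x: "x \<noteq> 0" and f: "f \<in> borel_measurable borel"
  shows "(\<integral>\<^sup>+y. f y \<partial>mpcn_kernel \<rho> p x) = (\<integral>\<^sup>+y. ennreal (jump x y) * f y \<partial>lborel) + f x * hold x"
  using f
proof (induction rule: borel_measurable_induct)
  case (cong f g)
  then have "f = g" by auto
  with cong show ?case by simp
next
  case (set A)
  then show ?case
    using emeasure_kernel[OF x set] by simp
next
  case (mult u c)
  then have [measurable]: "u \<in> borel_measurable borel" by simp
  have "(\<integral>\<^sup>+y. c * u y \<partial>mpcn_kernel \<rho> p x) = c * (\<integral>\<^sup>+y. u y \<partial>mpcn_kernel \<rho> p x)"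
    using mult(2) by (intro nn_integral_cmult) (simp add: measurable_cong_sets[OF sets_kernel refl])
  also have "\<dots> = (\<integral>\<^sup>+y. c * (ennreal (jump x y) * u y) \<partial>lborel) + c * u x * hold x"
    using mult by (subst nn_integral_cmult) (auto simp: distrib_left mult.assoc)
  finally show ?case by (simp add: mult_ac)
next
  case (add u v)
  then have [measurable]: "u \<in> borel_measurable borel" "v \<in> borel_measurable borel" by simp_all
  have "(\<integral>\<^sup>+y. v y + u y \<partial>mpcn_kernel \<rho> p x) = (\<integral>\<^sup>+y. v y \<partial>mpcn_kernel \<rho> p x) + (\<integral>\<^sup>+y. u y \<partial>mpcn_kernel \<rho> p x)"
    by (intro nn_integral_add) (simp_all add: measurable_cong_sets[OF sets_kernel refl])
  then show ?case
    using add by (simp add: distrib_left distrib_right nn_integral_add add_ac)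
next
  case (seq U)
  then have [measurable]: "U i \<in> borel_measurable borel" for i by simp
  have inc: "incseq U" by fact
  have mono: "incseq (\<lambda>i. U i y)" for y using inc by (auto simp: incseq_def le_fun_def)
  have S: "(\<integral>\<^sup>+y. (SUP i. U i y) \<partial>N) = (SUP i. \<integral>\<^sup>+y. U i y \<partial>N)" if "sets N = sets borel" for N
    using inc that by (intro nn_integral_monotone_convergence_SUP) (simp_all add: measurable_cong_sets[OF that refl])
  have S2: "(\<integral>\<^sup>+y. ennreal (jump x y) * (SUP i. U i y) \<partial>lborel) = (SUP i. \<integral>\<^sup>+y. ennreal (jump x y) * U i y \<partial>lborel)"
    unfolding SUP_mult_left_ennreal using inc
    by (intro nn_integral_monotone_convergence_SUP) (auto simp: incseq_def le_fun_def intro!: mult_left_mono)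
  have "(\<integral>\<^sup>+y. (SUP i. U i y) \<partial>mpcn_kernel \<rho> p x) = (SUP i. (\<integral>\<^sup>+y. ennreal (jump x y) * U i y \<partial>lborel) + U i x * hold x)"
    using S[OF sets_kernel] seq by simp
  also have "\<dots> = (SUP i. (\<integral>\<^sup>+y. ennreal (jump x y) * U i y \<partial>lborel)) + (SUP i. U i x * hold x)"
    using inc by (intro ennreal_SUP_add)
      (auto simp: incseq_def le_fun_def intro!: nn_integral_mono mult_left_mono mult_right_mono)
  also have "(SUP i. U i x * hold x) = (SUP i. U i x) * hold x"
    by (rule SUP_mult_right_ennreal[symmetric])
  finally show ?case by (simp add: S2 image_comp)
qed

lemma kernel_0: "mpcn_kernel \<rho> p 0 = return borel 0"
  by (simp add: mpcn_kernel_def)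

lemma kernel_prob_space: "prob_space (mpcn_kernel \<rho> p x)"
proof (cases "x = 0")
  case True
  then show ?thesis by (simp add: kernel_0 prob_space_return)
next
  case False
  show ?thesis
  proof
    have "space (mpcn_kernel \<rho> p x) = UNIV"
      using sets_eq_imp_space_eq[OF sets_kernel[of x]] by simp
    then show "emeasure (mpcn_kernel \<rho> p x) (space (mpcn_kernel \<rho> p x)) = 1"
      using emeasure_kernel[OF False, of UNIV] jump_total_le[OF False]
      by (simp add: hold_def add_diff_inverse_ennreal)
  qed
qed

lemma kernel_measurable: "mpcn_kernel \<rho> p \<in> borel \<rightarrow>\<^sub>M prob_algebra borel"
proof (rule measurable_prob_algebraI[OF kernel_prob_space measurable_subprob_algebra])
  show "subprob_space (mpcn_kernel \<rho> p x)" for x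
    using kernel_prob_space by (rule prob_space_imp_subprob_space)
  fix A :: "(real ^ 'd) set" assume A [measurable]: "A \<in> sets borel"
  have "(\<lambda>x. emeasure (mpcn_kernel \<rho> p x) A) = (\<lambda>x. if x = 0 then indicator A 0 else
      (\<integral>\<^sup>+y. ennreal (jump x y) * indicator A y \<partial>lborel) + indicator A x * hold x)"
    using A by (auto simp: kernel_0 emeasure_kernel)
  also have "\<dots> \<in> borel_measurable borel" by measurable
  finally show "(\<lambda>x. emeasure (mpcn_kernel \<rho> p x) A) \<in> borel_measurable borel" .
qed auto

lemma kernel_measurable_target: "mpcn_kernel \<rho> p \<in> target \<rightarrow>\<^sub>M prob_algebra target"
proof -
  have s: "sets target = sets borel" by simp
  have "sets (prob_algebra target) = sets (prob_algebra (borel :: (real ^ 'd) measure))"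
    unfolding prob_algebra_def using subprob_algebra_cong[OF s] by simp
  then show ?thesis
    using kernel_measurable measurable_cong_sets[OF s] by blast
qed

text \<open>Only the jump part needs detailed balance, through Fubini; the holding part sits on the
  diagonal and is symmetric by itself. The exceptional kernel at the origin is invisible to
  \<open>target\<close>.\<close>

lemma nn_reversible:
  assumes f: "f \<in> borel_measurable target" and g: "g \<in> borel_measurable target"
  shows "(\<integral>\<^sup>+x. f x * (\<integral>\<^sup>+y. g y \<partial>mpcn_kernel \<rho> p x) \<partial>target) = (\<integral>\<^sup>+x. (\<integral>\<^sup>+y. f y \<partial>mpcn_kernel \<rho> p x) * g x \<partial>target)"
proof -
  have expand: "(\<integral>\<^sup>+x. f x * (\<integral>\<^sup>+y. g y \<partial>mpcn_kernel \<rho> p x) \<partial>target)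
      = (\<integral>\<^sup>+x. (\<integral>\<^sup>+y. ennreal (p x * jump x y) * (f x * g y) \<partial>lborel) \<partial>lborel)
        + (\<integral>\<^sup>+x. ennreal (p x) * (f x * g x * hold x) \<partial>lborel)"
    if [measurable]: "f \<in> borel_measurable borel" "g \<in> borel_measurable borel" for f g
  proof -
    have [measurable]: "(\<lambda>x. \<integral>\<^sup>+y. g y \<partial>mpcn_kernel \<rho> p x) \<in> borel_measurable borel"
      using measurable_prob_algebraD[OF kernel_measurable] by measurable
    have "(\<integral>\<^sup>+x. f x * (\<integral>\<^sup>+y. g y \<partial>mpcn_kernel \<rho> p x) \<partial>target)
        = (\<integral>\<^sup>+x. ennreal (p x) * (f x * (\<integral>\<^sup>+y. g y \<partial>mpcn_kernel \<rho> p x)) \<partial>lborel)"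
      by (rule nn_integral_density) auto
    also have "\<dots> = (\<integral>\<^sup>+x. (\<integral>\<^sup>+y. ennreal (p x * jump x y) * (f x * g y) \<partial>lborel) + ennreal (p x) * (f x * g x * hold x) \<partial>lborel)"
    proof (rule nn_integral_cong_AE)
      show "AE x in lborel. ennreal (p x) * (f x * (\<integral>\<^sup>+y. g y \<partial>mpcn_kernel \<rho> p x))
          = (\<integral>\<^sup>+y. ennreal (p x * jump x y) * (f x * g y) \<partial>lborel) + ennreal (p x) * (f x * g x * hold x)"
        using AE_lborel_singleton[of "0 :: real ^ 'd"]
      proof eventually_elim
        case (elim x)
        have "(\<integral>\<^sup>+y. ennreal (p x * jump x y) * (f x * g y) \<partial>lborel)
            = (\<integral>\<^sup>+y. (ennreal (p x) * f x) * (ennreal (jump x y) * g y) \<partial>lborel)"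
          using p_pos[of x] by (intro nn_integral_cong) (simp add: ennreal_mult' mult_ac)
        also have "\<dots> = (ennreal (p x) * f x) * (\<integral>\<^sup>+y. ennreal (jump x y) * g y \<partial>lborel)"
          by (rule nn_integral_cmult) measurable
        finally show ?case
          using nn_integral_kernel[OF elim, of g] by (simp add: distrib_left mult_ac)
      qed
    qed
    also have "\<dots> = (\<integral>\<^sup>+x. (\<integral>\<^sup>+y. ennreal (p x * jump x y) * (f x * g y) \<partial>lborel) \<partial>lborel)
        + (\<integral>\<^sup>+x. ennreal (p x) * (f x * g x * hold x) \<partial>lborel)"
      by (rule nn_integral_add) measurable
    finally show ?thesis .
  qed
  have [measurable]: "f \<in> borel_measurable borel" "g \<in> borel_measurable borel" using f g by simp_all
  have "(\<integral>\<^sup>+x. (\<integral>\<^sup>+y. ennreal (p x * jump x y) * (f x * g y) \<partial>lborel) \<partial>lborel)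
      = (\<integral>\<^sup>+y. (\<integral>\<^sup>+x. ennreal (p x * jump x y) * (f x * g y) \<partial>lborel) \<partial>lborel)"
    by (rule lborel_pair.Fubini'[symmetric]) measurable
  also have "\<dots> = (\<integral>\<^sup>+y. (\<integral>\<^sup>+x. ennreal (p y * jump y x) * (g y * f x) \<partial>lborel) \<partial>lborel)"
    by (simp only: jump_symmetric mult.commute[of "f _"])
  finally show ?thesis
    using expand[of f g] expand[of g f] by (simp add: mult.commute mult.left_commute)
qed

sublocale invariant_kernel target "mpcn_kernel \<rho> p"
proof -
  interpret prob_space target by (rule target_prob)
  show "invariant_kernel target (mpcn_kernel \<rho> p)"
  proof
    show "mpcn_kernel \<rho> p \<in> target \<rightarrow>\<^sub>M prob_algebra target" by (rule kernel_measurable_target)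
    note K = measurable_prob_algebraD[OF kernel_measurable_target]
    have ne: "space target \<noteq> {}" by simp
    show "target \<bind> mpcn_kernel \<rho> p = target"
    proof (rule measure_eqI)
      show s: "sets (target \<bind> mpcn_kernel \<rho> p) = sets target"
        by (rule sets_bind[OF _ ne]) simp
      fix A assume "A \<in> sets (target \<bind> mpcn_kernel \<rho> p)"
      then have A: "A \<in> sets target" using s by simp
      \<comment> \<open>Invariance is reversibility tested against the constant 1; the factor 1 is
        written out to match \<open>nn_reversible\<close>.\<close>
      have "emeasure (target \<bind> mpcn_kernel \<rho> p) A = (\<integral>\<^sup>+x. 1 * (\<integral>\<^sup>+y. indicator A y \<partial>mpcn_kernel \<rho> p x) \<partial>target)"
        using A by (subst emeasure_bind[OF ne K]) (auto)
      also have "\<dots> = (\<integral>\<^sup>+x. (\<integral>\<^sup>+y. 1 \<partial>mpcn_kernel \<rho> p x) * indicator A x \<partial>target)"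
        using A by (intro nn_reversible) auto
      also have "\<dots> = emeasure target A"
        using A prob_space.emeasure_space_1[OF kernel_prob_space] by simp
      finally show "emeasure (target \<bind> mpcn_kernel \<rho> p) A = emeasure target A" .
    qed
  qed
qed

sublocale reversible_kernel target "mpcn_kernel \<rho> p"
  by (rule reversible_kernelI) (rule nn_reversible)

end

section \<open>Finite moments from geometric ergodicity\<close>

text \<open>Splits the values of h into layers between K^n R and K^(n+1) R and picks \<delta> so
  small that the growth of the power does not use up the decay of the layers. It is used twice: for
  the norm under the target and for the inverse norm near the origin.\<close>

lemma moment_of_geometric_tail:
  fixes h :: "'a \<Rightarrow> real"
  assumes fin: "finite_measure M" and h [measurable]: "h \<in> borel_measurable M"
    and nonneg: "\<And>x. 0 \<le> h x"
    and K: "1 < K" and R: "0 < R" and \<eta>: "0 < \<eta>" "\<eta> < 1"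
    and tail: "\<And>n. emeasure M {x\<in>space M. K ^ n * R < h x} \<le> ennreal (B * \<eta> ^ n)"
  shows "\<exists>\<delta>>0. (\<integral>\<^sup>+x. ennreal (h x powr \<delta>) \<partial>M) < \<infinity>"
proof -
  interpret finite_measure M by fact
  \<comment> \<open>This makes K^\<delta> = \<eta>^(-1/2), so the n-th layer contributes a multiple
    of \<eta>^(n/2).\<close>
  define \<delta> where "\<delta> = ln (1 / sqrt \<eta>) / ln K"
  have "1 < 1 / sqrt \<eta>" using \<eta> by simp
  then have \<delta>: "0 < \<delta>" unfolding \<delta>_def using K by (intro divide_pos_pos ln_gt_zero)
  have K\<delta>: "K powr \<delta> = 1 / sqrt \<eta>"
    using K \<eta> by (simp add: \<delta>_def powr_def)
  define A where "A n = {x\<in>space M. K ^ n * R < h x}" for n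
  have A [measurable]: "A n \<in> sets M" for n unfolding A_def by measurable
  define b where "b n = (K ^ Suc n * R) powr \<delta>" for n
  have b: "b n = R powr \<delta> * K powr \<delta> * (1 / sqrt \<eta>) ^ n" for n
  proof -
    have "b n = (K ^ Suc n) powr \<delta> * R powr \<delta>" unfolding b_def using K R by (subst powr_mult) auto
    also have "(K ^ Suc n) powr \<delta> = (K powr \<delta>) ^ Suc n"
    proof -
      have "(K ^ Suc n) powr \<delta> = (K powr real (Suc n)) powr \<delta>" using K by (simp only: powr_realpow)
      also have "\<dots> = (K powr \<delta>) powr real (Suc n)" by (simp only: powr_powr mult.commute)
      also have "\<dots> = (K powr \<delta>) ^ Suc n" using K by (intro powr_realpow) simp
      finally show ?thesis .
    qed
    finally show ?thesis by (simp add: K\<delta>[symmetric] mult_ac)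
  qed
  have term_le: "f k \<le> suminf f" for f :: "nat \<Rightarrow> ennreal" and k
    using sum_le_suminf[OF summableI, of "{k}" f] by simp
  have pt: "ennreal (h x powr \<delta>) \<le> ennreal (R powr \<delta>) + (\<Sum>n. ennreal (b n) * indicator (A n) x)"
    if x: "x \<in> space M" for x
  proof (cases "h x \<le> R")
    case True
    then have "ennreal (h x powr \<delta>) \<le> ennreal (R powr \<delta>)"
      using nonneg \<delta> by (intro ennreal_leI powr_mono2) auto
    then show ?thesis by (rule order_trans) simp
  next
    case False
    obtain n where "h x / R < K ^ n" using real_arch_pow[OF K] by blast
    then have ex: "h x \<le> K ^ n * R" using R by (simp add: divide_less_eq)
    \<comment> \<open>m is positive because h x exceeds R; its predecessor k has K^k R < h x \<le>
      K^(k+1) R. The upper end explains the \<open>Suc\<close> in \<open>b\<close>.\<close>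
    define m where "m = (LEAST n. h x \<le> K ^ n * R)"
    have m: "h x \<le> K ^ m * R" unfolding m_def using ex by (rule LeastI)
    have "m \<noteq> 0" using m False by (intro notI) simp
    then obtain k where k: "m = Suc k" by (cases m) auto
    have "\<not> h x \<le> K ^ k * R" using not_less_Least[of k "\<lambda>n. h x \<le> K ^ n * R"] k by (simp add: m_def)
    then have xA: "x \<in> A k" using x by (simp add: A_def)
    have "ennreal (h x powr \<delta>) \<le> ennreal (b k) * indicator (A k) x"
      using xA m k nonneg \<delta> by (auto simp: b_def intro!: ennreal_leI powr_mono2)
    also have "\<dots> \<le> (\<Sum>n. ennreal (b n) * indicator (A n) x)"
      by (rule term_le)
    finally show ?thesis by (rule order_trans) simp
  qed
  define q where "q = sqrt \<eta>"
  have q: "0 < q" "q < 1" "\<eta> = q * q" using \<eta> by (auto simp: q_def)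
  have "(\<integral>\<^sup>+x. ennreal (h x powr \<delta>) \<partial>M) \<le> (\<integral>\<^sup>+x. ennreal (R powr \<delta>) + (\<Sum>n. ennreal (b n) * indicator (A n) x) \<partial>M)"
    by (intro nn_integral_mono pt)
  also have "\<dots> = ennreal (R powr \<delta>) * emeasure M (space M) + (\<Sum>n. ennreal (b n) * emeasure M (A n))"
    by (subst nn_integral_add) (auto simp: nn_integral_suminf nn_integral_cmult_indicator)
  also have "(\<Sum>n. ennreal (b n) * emeasure M (A n)) \<le> (\<Sum>n. ennreal (R powr \<delta> * K powr \<delta> * \<bar>B\<bar> * q ^ n))"
  proof (intro suminf_le summableI)
    fix n
    have "ennreal (b n) * emeasure M (A n) \<le> ennreal (b n) * ennreal (\<bar>B\<bar> * \<eta> ^ n)"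
    proof (rule mult_left_mono)
      have "B * \<eta> ^ n \<le> \<bar>B\<bar> * \<eta> ^ n" using \<eta> by (intro mult_right_mono) auto
      then show "emeasure M (A n) \<le> ennreal (\<bar>B\<bar> * \<eta> ^ n)"
        using tail[of n] unfolding A_def by (meson ennreal_leI order_trans)
    qed simp
    also have "\<dots> = ennreal (b n * (\<bar>B\<bar> * \<eta> ^ n))"
      using \<eta> by (intro ennreal_mult[symmetric]) (auto simp: b_def)
    also have "b n * (\<bar>B\<bar> * \<eta> ^ n) = R powr \<delta> * K powr \<delta> * \<bar>B\<bar> * q ^ n"
      using q by (simp add: b q_def[symmetric] power_mult_distrib power_divide)
    finally show "ennreal (b n) * emeasure M (A n) \<le> ennreal (R powr \<delta> * K powr \<delta> * \<bar>B\<bar> * q ^ n)" .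
  qed
  also have "(\<Sum>n. ennreal (R powr \<delta> * K powr \<delta> * \<bar>B\<bar> * q ^ n)) = ennreal (\<Sum>n. R powr \<delta> * K powr \<delta> * \<bar>B\<bar> * q ^ n)"
    using q by (intro suminf_ennreal2 summable_mult summable_geometric) auto
  finally have "(\<integral>\<^sup>+x. ennreal (h x powr \<delta>) \<partial>M) \<le> ennreal (R powr \<delta>) * emeasure M (space M) + ennreal (\<Sum>n. R powr \<delta> * K powr \<delta> * \<bar>B\<bar> * q ^ n)"
    by (simp add: add_left_mono)
  also have "\<dots> < \<infinity>"
  proof -
    have "emeasure M (space M) < \<top>" using emeasure_finite[of "space M"] by (simp only: infinity_ennreal_def less_top)
    then show ?thesis by (simp add: ennreal_mult_less_top)
  qed
  finally show ?thesis using \<delta> by blast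
qed

context mpcn
begin

text \<open>The holding mass stays at x, outside the ball, so only jumps count, and their density is
  at most c / ((1 - sqrt \<rho>) norm x)^d whatever the acceptance probability.\<close>

lemma kernel_escape_le:
  assumes R: "0 < R" and x: "R < norm x"
  shows "measure (mpcn_kernel \<rho> p x) (cball 0 R)
    \<le> c * unit_ball_vol CARD('d) / (1 - sqrt \<rho>) ^ CARD('d) * (R / norm x) ^ CARD('d)"
proof -
  let ?d = "CARD('d)" and ?s = "1 - sqrt \<rho>"
  have s: "0 < ?s" using \<rho> by simp
  have x0: "x \<noteq> 0" and xp: "0 < norm x" using x R by auto
  have le: "c * mpcn_density \<rho> x y \<le> c / (?s ^ ?d * norm x ^ ?d)" for y
  proof -
    have "?s * (norm x)\<^sup>2 \<le> ?s * ((norm x)\<^sup>2 + (norm y)\<^sup>2)" using s by (intro mult_left_mono) auto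
    also have "\<dots> \<le> mpcn_form \<rho> x y" using \<rho> by (intro mpcn_form_lower) simp
    finally have "(?s * (norm x)\<^sup>2) ^ ?d \<le> mpcn_form \<rho> x y ^ ?d" using s by (intro power_mono) auto
    then have "mpcn_density \<rho> x y \<le> norm x ^ ?d / (?s * (norm x)\<^sup>2) ^ ?d"
      unfolding mpcn_density_def using s xp mpcn_form_pos[of \<rho> x y] \<rho> x0
      by (intro divide_left_mono mult_pos_pos) auto
    also have "\<dots> = 1 / (?s ^ ?d * norm x ^ ?d)"
      using xp by (simp add: power_mult_distrib power2_eq_square)
    finally show ?thesis using mult_left_mono[of _ _ c] c_pos by fastforce
  qed
  have "emeasure (mpcn_kernel \<rho> p x) (cball 0 R) = (\<integral>\<^sup>+y. ennreal (jump x y) * indicator (cball 0 R) y \<partial>lborel)"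
    using emeasure_kernel[OF x0, of "cball 0 R"] x by simp
  also have "\<dots> \<le> (\<integral>\<^sup>+y. ennreal (c / (?s ^ ?d * norm x ^ ?d)) * indicator (cball 0 R) (y :: real ^ 'd) \<partial>lborel)"
    using jump_le le by (intro nn_integral_mono mult_right_mono ennreal_leI) (auto intro: order_trans)
  also have "\<dots> = ennreal (c / (?s ^ ?d * norm x ^ ?d)) * emeasure lborel (cball (0 :: real ^ 'd) R)"
    by (rule nn_integral_cmult_indicator) simp
  also have "\<dots> = ennreal (c / (?s ^ ?d * norm x ^ ?d) * (unit_ball_vol ?d * R ^ ?d))"
  proof -
    have "emeasure lborel (cball (0 :: real ^ 'd) R) = ennreal (unit_ball_vol ?d * R ^ ?d)"
      using emeasure_cball[of R "0 :: real ^ 'd"] R by simp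
    then show ?thesis
      using R c_pos s by (simp only:) (intro ennreal_mult[symmetric], auto)
  qed
  also have "c / (?s ^ ?d * norm x ^ ?d) * (unit_ball_vol ?d * R ^ ?d) = c * unit_ball_vol ?d / ?s ^ ?d * (R / norm x) ^ ?d"
    by (simp add: power_divide)
  finally show ?thesis
    unfolding measure_def using R c_pos s by (intro enn2real_leI) auto
qed

text \<open>Conductance is applied to the complements of balls. It bounds the tail at K r by \<eta>
  times the tail at r, so the tail is geometric along powers of K.\<close>

theorem moment_if_geometrically_ergodic:
  assumes "geometrically_ergodic target (mpcn_kernel \<rho> p)"
  shows "\<exists>\<delta>>0. (\<integral>\<^sup>+x. ennreal (norm x powr \<delta>) \<partial>target) < \<infinity>"
proof (rule geometrically_ergodic_conductance[OF assms])
  fix \<gamma> assume \<gamma>: "0 < \<gamma>" "\<gamma> < (1::real)"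
    and cond: "\<And>A. A \<in> events \<Longrightarrow> (1 - \<gamma>) * prob A * (1 - prob A)
      \<le> (\<integral>x. indicator A x * measure (mpcn_kernel \<rho> p x) (space target - A) \<partial>target)"
  let ?d = "CARD('d)"
  define T where "T R = {x :: real ^ 'd. R < norm x}" for R
  have T [measurable]: "T R \<in> sets borel" for R unfolding T_def by measurable
  define G where "G R = prob (T R)" for R
  have G_mono: "G R' \<le> G R" if "R \<le> R'" for R R'
    unfolding G_def using that by (intro finite_measure_mono) (auto simp: T_def)
  have G01: "0 \<le> G R" "G R \<le> 1" for R by (auto simp: G_def)
  define D where "D = c * unit_ball_vol ?d / (1 - sqrt \<rho>) ^ ?d"
  have D: "0 \<le> D" using c_pos \<rho> by (simp add: D_def)
  \<comment> \<open>The tail at \<open>R\<close> and beyond is at most 1/2, so the conductance bound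
    there is at least \<epsilon> times the tail.\<close>
  define \<epsilon> where "\<epsilon> = (1 - \<gamma>) / 2"
  have \<epsilon>: "0 < \<epsilon>" "\<epsilon> < 1 / 2" using \<gamma> by (auto simp: \<epsilon>_def)
  \<comment> \<open>K \<ge> 2D / \<epsilon> makes the escape probability from beyond K r at most
    \<epsilon> / 2; the summand 2 ensures K > 1.\<close>
  define K where "K = 2 + 2 * D / \<epsilon>"
  have K: "1 < K" using D \<epsilon> by (simp add: K_def add_pos_nonneg)
  have KD: "D / K ^ ?d \<le> \<epsilon> / 2"
  proof -
    have "K ^ 1 \<le> K ^ ?d" using K by (intro power_increasing) (auto simp: Suc_le_eq)
    moreover have "2 * D / \<epsilon> \<le> K" by (simp add: K_def)
    ultimately have "2 * D / \<epsilon> \<le> K ^ ?d" by simp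
    then show ?thesis using \<epsilon> K by (simp add: field_simps)
  qed
  obtain R where R: "1 \<le> R" "G R \<le> 1 / 2"
  proof -
    have "(\<lambda>n. prob (T (real n))) \<longlonglongrightarrow> prob (\<Inter>n. T (real n))"
      by (rule finite_Lim_measure_decseq) (auto simp: T_def decseq_def)
    moreover have "(\<Inter>n. T (real n)) = {}"
      unfolding T_def using real_arch_simple by (fastforce simp: not_less[symmetric])
    ultimately have "(\<lambda>n. G (real n)) \<longlonglongrightarrow> 0" by (simp add: G_def)
    then have "\<forall>\<^sub>F n in sequentially. G (real n) < 1 / 2" by (rule order_tendstoD) simp
    then obtain n where "\<forall>m\<ge>n. G (real m) < 1 / 2" by (auto simp: eventually_sequentially)
    then have "G (real (max n 1)) < 1 / 2" by (meson max.cobounded1)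
    then show ?thesis by (intro that[of "real (max n 1)"]) auto
  qed
  \<comment> \<open>Comes from solving \<epsilon> G(r) \<le> G(r) - G(K r) + (\<epsilon> / 2) G(K r)
    for G(K r).\<close>
  define \<eta> where "\<eta> = (1 - \<epsilon>) / (1 - \<epsilon> / 2)"
  have \<eta>: "0 < \<eta>" "\<eta> < 1" using \<epsilon> by (auto simp: \<eta>_def)
  have step: "G (K * r) \<le> \<eta> * G r" if r: "R \<le> r" for r
  proof -
    have r0: "0 < r" using r R by simp
    have Kr: "r \<le> K * r" using K r0 by simp
    have "\<epsilon> * G r \<le> (1 - \<gamma>) * G r * (1 - G r)"
    proof -
      have "1 / 2 \<le> 1 - G r" using G_mono[OF r] R by linarith
      from mult_left_mono[OF this, of "(1 - \<gamma>) * G r"] \<gamma> G01[of r] show ?thesis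
        by (simp add: \<epsilon>_def)
    qed
    also have "\<dots> \<le> (\<integral>x. indicator (T r) x * measure (mpcn_kernel \<rho> p x) (space target - T r) \<partial>target)"
      unfolding G_def by (rule cond) simp
    \<comment> \<open>From the shell between r and K r the chain may enter the ball with probability
      up to 1; from beyond K r the probability is at most \<open>D / K ^ CARD('d)\<close>.\<close>
    also have "\<dots> \<le> (\<integral>x. indicator (T r) x - indicator (T (K * r)) x + D / K ^ ?d * indicator (T (K * r)) x \<partial>target)"
    proof (rule integral_mono')
      have i: "integrable target (indicator (T r) :: _ \<Rightarrow> real)" for r
        by (intro integrable_M bdd_measurable_indicator) simp
      show "integrable target (\<lambda>x. indicator (T r) x - indicator (T (K * r)) x + D / K ^ ?d * indicator (T (K * r)) x)"
        using i by auto
      fix x :: "real ^ 'd"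
      have c1: "measure (mpcn_kernel \<rho> p x) A \<le> 1" for A
        by (rule prob_space.prob_le_1[OF kernel_prob_space])
      have TK: "T (K * r) \<subseteq> T r" using Kr by (auto simp: T_def)
      have co: "space target - T r = cball 0 r" by (auto simp: T_def)
      show "0 \<le> indicator (T r) x - indicator (T (K * r)) x + D / K ^ ?d * (indicator (T (K * r)) x :: real)"
        using TK D K by (auto simp: indicator_def)
      show "indicator (T r) x * measure (mpcn_kernel \<rho> p x) (space target - T r)
          \<le> indicator (T r) x - indicator (T (K * r)) x + D / K ^ ?d * indicator (T (K * r)) x"
      proof (cases "x \<in> T (K * r)")
        case True
        then have xK: "K * r < norm x" by (simp add: T_def)
        have "measure (mpcn_kernel \<rho> p x) (cball 0 r) \<le> D * (r / norm x) ^ ?d"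
          unfolding D_def using r0 le_less_trans[OF Kr xK] by (intro kernel_escape_le) auto
        also have "\<dots> \<le> D * (1 / K) ^ ?d"
        proof (intro mult_left_mono power_mono D)
          show "r / norm x \<le> 1 / K"
            using xK r0 K less_trans[OF r0 le_less_trans[OF Kr xK]] by (simp add: pos_divide_le_eq pos_le_divide_eq mult.commute)
        qed (use r0 in auto)
        finally show ?thesis using True subsetD[OF TK True] unfolding co by (simp add: power_divide)
      next
        case False
        then show ?thesis using c1 by (auto simp: indicator_def)
      qed
    qed
    also have "\<dots> = G r - G (K * r) + D / K ^ ?d * G (K * r)"
      using integrable_M[OF bdd_measurable_indicator[of "T _" target]]
      by (simp add: G_def)
    also have "\<dots> \<le> G r - G (K * r) + \<epsilon> / 2 * G (K * r)"
      using KD G01 by (intro add_left_mono mult_right_mono) auto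
    finally have "(1 - \<epsilon> / 2) * G (K * r) \<le> (1 - \<epsilon>) * G r" by (simp add: algebra_simps)
    then show ?thesis using \<epsilon> by (simp add: \<eta>_def field_simps)
  qed
  have tail: "G (K ^ n * R) \<le> \<eta> ^ n" for n
  proof (induction n)
    case (Suc n)
    have "1 * R \<le> K ^ n * R" using K R by (intro mult_right_mono) auto
    then have "G (K * (K ^ n * R)) \<le> \<eta> * G (K ^ n * R)" by (intro step) simp
    also have "\<dots> \<le> \<eta> * \<eta> ^ n" using Suc \<eta> by (intro mult_left_mono) auto
    finally show ?case by (simp add: mult_ac)
  qed (use G01 in simp)
  show ?thesis
  proof (rule moment_of_geometric_tail[OF finite_measure_axioms _ _ K _ \<eta>])
    show "emeasure target {x \<in> space target. K ^ n * R < norm x} \<le> ennreal (1 * \<eta> ^ n)" for n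
      using tail[of n] unfolding G_def T_def by (simp add: emeasure_eq_measure ennreal_leI)
  qed (use R in auto)
qed

end

section \<open>Regular variation\<close>

lemma norm_unit_diag: "norm (unit_diag :: real ^ 'd) = 1"
proof -
  have "(norm (unit_diag :: real ^ 'd))\<^sup>2 = (\<Sum>i\<in>(UNIV :: 'd set). (1 / sqrt (real CARD('d)))\<^sup>2)"
    by (simp add: norm_vec_def L2_set_def sum_nonneg unit_diag_def)
  also have "\<dots> = 1" by (simp add: power_divide)
  finally show ?thesis by (rule power2_eq_imp_eq[OF trans]) simp_all
qed

text \<open>A sphere is compact, so finitely many of the neighbourhoods of locally uniform
  convergence cover it, and uniform convergence passes to finite unions.\<close>

lemma regularly_varying_uniform_sphere:
  fixes h :: "real ^ 'd \<Rightarrow> real"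
  assumes "symmetrically_regularly_varying h"
  obtains l where "\<And>x. x \<noteq> 0 \<Longrightarrow> 0 < l x" "\<And>x. norm x = 1 \<Longrightarrow> l x = 1"
    "\<And>t. 0 < t \<Longrightarrow> uniform_limit (sphere 0 t) (\<lambda>r y. h (r *\<^sub>R y) / h (r *\<^sub>R unit_diag)) l at_top"
proof -
  from assms obtain l where l: "\<And>x. x \<noteq> 0 \<Longrightarrow> 0 < l x" "\<And>x. norm x = 1 \<Longrightarrow> l x = 1"
    and K: "\<forall>x. x \<noteq> 0 \<longrightarrow> (\<exists>K. compact K \<and> 0 \<notin> K \<and> x \<in> interior K \<and>
      uniform_limit K (\<lambda>r y. h (r *\<^sub>R y) / h (r *\<^sub>R unit_diag)) l at_top)"
    unfolding symmetrically_regularly_varying_def by fastforce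
  let ?U = "\<lambda>S. uniform_limit S (\<lambda>r y. h (r *\<^sub>R y) / h (r *\<^sub>R unit_diag)) l at_top"
  have "?U (sphere 0 t)" if "0 < t" for t
  proof -
    let ?C = "{interior K |K. ?U K}"
    have "sphere 0 t \<subseteq> \<Union> ?C"
    proof
      fix x :: "real ^ 'd" assume "x \<in> sphere 0 t"
      then have "x \<noteq> 0" using that by auto
      with K obtain K where "x \<in> interior K" "?U K" by blast
      then show "x \<in> \<Union> ?C" by blast
    qed
    then obtain D where D: "D \<subseteq> ?C" "finite D" "sphere 0 t \<subseteq> \<Union> D"
      using compactE[of "sphere 0 t" ?C] by auto
    have "?U (\<Union> D)"
    proof (rule uniform_limit_on_Union[OF D(2)])
      fix J assume "J \<in> D"
      then obtain K where "J = interior K" "?U K" using D(1) by blast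
      then show "?U J" using uniform_limit_on_subset interior_subset by blast
    qed
    then show ?thesis using D(3) uniform_limit_on_subset by blast
  qed
  with l show ?thesis by (rule that)
qed

text \<open>Factoring h(r t x) / h(r e) through h(r t e) gives l(t x) = l(x) m(t). With l = 1 on the
  unit sphere this makes l radial, and x = e / t yields m(t) m(1/t) = 1. The third fact is a
  comparison valid in all directions at once, as needed under an integral; the fourth allows the
  direction of x n to vary with n.\<close>

lemma regularly_varying_radial_limit:
  fixes h :: "real ^ 'd \<Rightarrow> real"
  assumes srv: "symmetrically_regularly_varying h"
  obtains m where "\<And>t. 0 < t \<Longrightarrow> 0 < m t" "\<And>t. 0 < t \<Longrightarrow> m t * m (1 / t) = (1 :: real)"
    and "\<And>t b. 0 < t \<Longrightarrow> 0 \<le> b \<Longrightarrow> b < m t \<Longrightarrow> \<exists>X>0. \<forall>x. X \<le> norm x \<longrightarrow> b * h x \<le> h (t *\<^sub>R x)"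
    and "\<And>x z. filterlim (\<lambda>n. norm (x n)) at_top sequentially \<Longrightarrow> z \<noteq> 0 \<Longrightarrow>
      (\<lambda>n. h (norm (x n) *\<^sub>R z) / h (x n)) \<longlonglongrightarrow> m (norm z)"
proof (rule regularly_varying_uniform_sphere[OF srv])
  fix l :: "real ^ 'd \<Rightarrow> real"
  assume l_pos: "\<And>x. x \<noteq> 0 \<Longrightarrow> 0 < l x" and l_1: "\<And>x. norm x = 1 \<Longrightarrow> l x = 1"
    and unif: "\<And>t. 0 < t \<Longrightarrow> uniform_limit (sphere 0 t) (\<lambda>r y. h (r *\<^sub>R y) / h (r *\<^sub>R unit_diag)) l at_top"
  let ?e = "unit_diag :: real ^ 'd"
  have h: "0 < h x" for x using srv by (simp add: symmetrically_regularly_varying_def)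
  then have h_nz [simp]: "h x \<noteq> 0" for x by (metis less_irrefl)
  have e0: "?e \<noteq> 0" using norm_unit_diag[where 'd = 'd] by auto
  define m where "m t = l (t *\<^sub>R ?e)" for t
  have lim: "((\<lambda>r. h (r *\<^sub>R x) / h (r *\<^sub>R ?e)) \<longlongrightarrow> l x) at_top" if "x \<noteq> 0" for x
    using tendsto_uniform_limitI[OF unif[of "norm x"]] that by simp
  have mult: "l (t *\<^sub>R x) = l x * m t" if t: "0 < t" and x: "x \<noteq> 0" for t x
  proof (rule tendsto_unique)
    have "filterlim (\<lambda>r. r * t) at_top at_top"
      by (rule filterlim_at_top_mult_tendsto_pos[OF tendsto_const t filterlim_ident])
    from filterlim_compose[OF lim[OF x] this]
    have "((\<lambda>r. h ((r * t) *\<^sub>R x) / h ((r * t) *\<^sub>R ?e)) \<longlongrightarrow> l x) at_top" .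
    moreover have "((\<lambda>r. h (r *\<^sub>R (t *\<^sub>R ?e)) / h (r *\<^sub>R ?e)) \<longlongrightarrow> m t) at_top"
      unfolding m_def using t e0 by (intro lim) simp
    ultimately have "((\<lambda>r. h ((r * t) *\<^sub>R x) / h ((r * t) *\<^sub>R ?e) * (h (r *\<^sub>R (t *\<^sub>R ?e)) / h (r *\<^sub>R ?e))) \<longlongrightarrow> l x * m t) at_top"
      by (rule tendsto_mult)
    moreover have "h ((r * t) *\<^sub>R x) / h ((r * t) *\<^sub>R ?e) * (h (r *\<^sub>R (t *\<^sub>R ?e)) / h (r *\<^sub>R ?e)) = h (r *\<^sub>R (t *\<^sub>R x)) / h (r *\<^sub>R ?e)" for r
      using h[of "(r * t) *\<^sub>R ?e"] by simp
    ultimately show "((\<lambda>r. h (r *\<^sub>R (t *\<^sub>R x)) / h (r *\<^sub>R ?e)) \<longlongrightarrow> l x * m t) at_top" by simp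
    show "((\<lambda>r. h (r *\<^sub>R (t *\<^sub>R x)) / h (r *\<^sub>R ?e)) \<longlongrightarrow> l (t *\<^sub>R x)) at_top"
      using t x by (intro lim) simp
  qed simp
  have radial: "l x = m (norm x)" if "x \<noteq> 0" for x
    using mult[of "norm x" "(1 / norm x) *\<^sub>R x"] l_1[of "(1 / norm x) *\<^sub>R x"] that by simp
  have m_pos: "0 < m t" if "0 < t" for t
    unfolding m_def using that e0 by (intro l_pos) simp
  have m_inv: "m t * m (1 / t) = 1" if t: "0 < t" for t
    using mult[of t "(1 / t) *\<^sub>R ?e"] t e0 l_1[OF norm_unit_diag] by (simp add: m_def mult.commute)
  have lower: "\<exists>X>0. \<forall>x. X \<le> norm x \<longrightarrow> b * h x \<le> h (t *\<^sub>R x)" if t: "0 < t" and b: "0 \<le> b" "b < m t" for t b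
  proof -
    \<comment> \<open>Relative to h(r e), the value at t y is at least m t - \<eta> and the value at
      y is at most 1 + \<eta>; this \<eta> leaves room for b (1 + \<eta>) \<le> m t -
      \<eta>.\<close>
    define \<eta> where "\<eta> = (m t - b) / (2 * (1 + b))"
    have \<eta>: "0 < \<eta>" using b by (simp add: \<eta>_def)
    have \<eta>2: "b * (1 + \<eta>) \<le> m t - \<eta>"
    proof -
      have "\<eta> * (1 + b) = (m t - b) / 2" using b by (simp add: \<eta>_def field_simps)
      then show ?thesis using b by (simp add: algebra_simps)
    qed
    have "\<forall>\<^sub>F r in at_top. \<forall>y\<in>sphere 0 t. dist (h (r *\<^sub>R y) / h (r *\<^sub>R ?e)) (l y) < \<eta>"
      using uniform_limitD[OF unif[OF t] \<eta>] .
    moreover have "\<forall>\<^sub>F r in at_top. \<forall>y\<in>sphere 0 1. dist (h (r *\<^sub>R y) / h (r *\<^sub>R ?e)) (l y) < \<eta>"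
      using uniform_limitD[OF unif[of 1] \<eta>] by simp
    ultimately have "\<forall>\<^sub>F r in at_top. \<forall>y\<in>sphere 0 1. b * h (r *\<^sub>R y) \<le> h (t *\<^sub>R (r *\<^sub>R y))"
    proof eventually_elim
      case (elim r)
      show ?case
      proof
        fix y :: "real ^ 'd" assume y: "y \<in> sphere 0 1"
        then have ty: "t *\<^sub>R y \<in> sphere 0 t" and ny: "norm y = 1" "y \<noteq> 0" using t by auto
        have "l (t *\<^sub>R y) = m t" using mult[OF t, of y] l_1[OF ny(1)] ny by simp
        then have 1: "m t - \<eta> \<le> h (r *\<^sub>R (t *\<^sub>R y)) / h (r *\<^sub>R ?e)"
          using bspec[OF elim(1) ty] by (simp add: dist_real_def abs_less_iff)
        have 2: "h (r *\<^sub>R y) / h (r *\<^sub>R ?e) \<le> 1 + \<eta>"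
          using bspec[OF elim(2) y] l_1[OF ny(1)] by (simp add: dist_real_def abs_less_iff)
        have "b * (h (r *\<^sub>R y) / h (r *\<^sub>R ?e)) \<le> b * (1 + \<eta>)"
          using 2 b by (intro mult_left_mono) auto
        with 1 \<eta>2 have "b * (h (r *\<^sub>R y) / h (r *\<^sub>R ?e)) \<le> h (r *\<^sub>R (t *\<^sub>R y)) / h (r *\<^sub>R ?e)"
          by linarith
        then show "b * h (r *\<^sub>R y) \<le> h (t *\<^sub>R (r *\<^sub>R y))"
          using h[of "r *\<^sub>R ?e"] by (simp add: divide_right_mono_neg field_simps)
      qed
    qed
    then obtain X where X: "\<And>r. X \<le> r \<Longrightarrow> \<forall>y\<in>sphere 0 1. b * h (r *\<^sub>R y) \<le> h (t *\<^sub>R (r *\<^sub>R y))"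
      by (auto simp: eventually_at_top_linorder)
    show ?thesis
    proof (intro exI[of _ "max X 1"] conjI allI impI)
      fix x :: "real ^ 'd" assume x: "max X 1 \<le> norm x"
      then have "x \<noteq> 0" by auto
      then have "(1 / norm x) *\<^sub>R x \<in> sphere 0 1" "norm x *\<^sub>R ((1 / norm x) *\<^sub>R x) = x" by auto
      with X[of "norm x"] x show "b * h x \<le> h (t *\<^sub>R x)" by (metis max.boundedE)
    qed simp
  qed
  have seq: "(\<lambda>n. h (norm (x n) *\<^sub>R z) / h (x n)) \<longlonglongrightarrow> m (norm z)"
    if x: "filterlim (\<lambda>n. norm (x n)) at_top sequentially" and z: "z \<noteq> 0" for x z
  proof -
    have num: "(\<lambda>n. h (norm (x n) *\<^sub>R z) / h (norm (x n) *\<^sub>R ?e)) \<longlonglongrightarrow> m (norm z)"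
      using filterlim_compose[OF lim[OF z] x] radial[OF z] by simp
    \<comment> \<open>The direction of x n changes with n, so pointwise convergence would not do;
      uniformity on the unit sphere replaces the reference direction by that of x n.\<close>
    have den: "(\<lambda>n. h (x n) / h (norm (x n) *\<^sub>R ?e)) \<longlonglongrightarrow> 1"
    proof (rule tendstoI)
      fix \<eta> :: real assume \<eta>: "0 < \<eta>"
      have "\<forall>\<^sub>F n in sequentially. \<forall>y\<in>sphere 0 1. dist (h (norm (x n) *\<^sub>R y) / h (norm (x n) *\<^sub>R ?e)) (l y) < \<eta>"
        using uniform_limitD[OF unif[of 1] \<eta>] x by (auto simp: filterlim_iff)
      moreover have "\<forall>\<^sub>F n in sequentially. 1 \<le> norm (x n)"
        using x by (auto simp: filterlim_at_top)
      ultimately show "\<forall>\<^sub>F n in sequentially. dist (h (x n) / h (norm (x n) *\<^sub>R ?e)) 1 < \<eta>"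
      proof eventually_elim
        case (elim n)
        then have "x n \<noteq> 0" by auto
        then have "(1 / norm (x n)) *\<^sub>R x n \<in> sphere 0 1"
          and "norm (x n) *\<^sub>R ((1 / norm (x n)) *\<^sub>R x n) = x n"
          and "l ((1 / norm (x n)) *\<^sub>R x n) = 1" using l_1 by auto
        with elim(1) show ?case by metis
      qed
    qed
    have "(\<lambda>n. (h (norm (x n) *\<^sub>R z) / h (norm (x n) *\<^sub>R ?e)) / (h (x n) / h (norm (x n) *\<^sub>R ?e))) \<longlonglongrightarrow> m (norm z) / 1"
      by (rule tendsto_divide[OF num den]) simp
    moreover have "(h (norm (x n) *\<^sub>R z) / h (norm (x n) *\<^sub>R ?e)) / (h (x n) / h (norm (x n) *\<^sub>R ?e)) = h (norm (x n) *\<^sub>R z) / h (x n)" for n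
      using h[of "norm (x n) *\<^sub>R ?e"] h[of "x n"] by simp
    ultimately show ?thesis by simp
  qed
  show ?thesis
    by (rule that[of m]) (fact m_pos m_inv lower seq)+
qed

section \<open>Drift of the Lyapunov function\<close>

lemma open_AE_lborel_notin:
  fixes S :: "'a::euclidean_space set"
  assumes "open S" "AE z in lborel. z \<notin> S"
  shows "S = {}"
proof -
  have "S \<in> null_sets lborel"
    using assms by (simp add: AE_iff_null_sets)
  then have "negligible S"
    by (simp add: negligible_iff_null_sets null_sets_completionI)
  with assms(1) show ?thesis using open_not_negligible by blast
qed

text \<open>Large at both ends, so that its sublevel sets in the punctured space are compact. At the
  origin itself the value is 0, since \<open>0 powr a = 0\<close>; that point is excluded from the
  drift condition.\<close>

definition lyap :: "real \<Rightarrow> 'a::real_normed_vector \<Rightarrow> real" where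
  "lyap \<delta> x = norm x powr \<delta> + norm x powr - \<delta>"

lemma lyap_meas [measurable]: "lyap \<delta> \<in> borel_measurable (borel :: 'a::euclidean_space measure)"
  unfolding lyap_def[abs_def] by measurable

lemma lyap_nonneg [simp]: "0 \<le> lyap \<delta> x"
  by (simp add: lyap_def)

lemma lyap_ge_1: "x \<noteq> 0 \<Longrightarrow> 0 \<le> \<delta> \<Longrightarrow> 1 \<le> lyap \<delta> x"
  by (cases "1 \<le> norm x")
    (auto simp: lyap_def ge_one_powr_ge_zero powr_minus one_le_inverse powr_le1 intro: add_increasing add_increasing2)

text \<open>The product on the right has two further, nonnegative cross terms. Submultiplicativity
  bounds the Lyapunov ratio at x by a function of z alone.\<close>

lemma lyap_scale_le: "lyap \<delta> (r *\<^sub>R z) \<le> lyap \<delta> r * lyap \<delta> z"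
  by (simp add: lyap_def powr_mult algebra_simps)

text \<open>Used to decrease the exponent. On either side of the unit sphere both terms on the left
  are at most the larger power with exponent \<delta>' in absolute value, hence the factor
  2.\<close>

lemma lyap_mono:
  assumes "0 \<le> \<delta>" "\<delta> \<le> \<delta>'"
  shows "lyap \<delta> z \<le> 2 * lyap \<delta>' z"
proof (cases "1 \<le> norm z")
  case True
  then have "norm z powr \<delta> \<le> norm z powr \<delta>'" "norm z powr - \<delta> \<le> norm z powr \<delta>'"
    using assms by (auto intro!: powr_mono)
  then show ?thesis unfolding lyap_def by (smt (verit) powr_ge_zero)
next
  case False
  then have "norm z powr \<delta> \<le> norm z powr - \<delta>'" "norm z powr - \<delta> \<le> norm z powr - \<delta>'"
    using assms by (auto intro!: powr_mono')
  then show ?thesis unfolding lyap_def by (smt (verit) powr_ge_zero)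
qed

text \<open>An unnormalised, centred Student density that is comparable to the proposal from every
  unit vector, with constants independent of the direction.\<close>

definition student :: "real ^ 'd \<Rightarrow> real" where
  "student z = 1 / (1 + (norm z)\<^sup>2) ^ CARD('d)"

lemma student_meas [measurable]: "student \<in> borel_measurable borel"
  unfolding student_def[abs_def] by measurable

lemma student_pos: "0 < student z"
  by (simp add: student_def add_pos_nonneg)

lemma student_nonneg [simp]: "0 \<le> student z"
  using student_pos by (rule less_imp_le)

lemma student_le_1: "student z \<le> 1"
proof -
  have "1 \<le> (1 + (norm z)\<^sup>2) ^ CARD('a)" by (rule one_le_power) simp
  then show ?thesis by (simp add: student_def divide_le_eq_1 add_pos_nonneg)
qed

text \<open>Both sides are the d-th power of 1 / (|z| + 1/|z|), which is symmetric under |z| ->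
  1/|z|.\<close>

lemma student_inversion:
  assumes "z \<noteq> 0"
  shows "norm (inversion z) ^ CARD('d) * student (inversion z) = norm z ^ CARD('d) * student (z :: real ^ 'd)"
proof -
  have 1: "1 + (norm z)\<^sup>2 > 0" by (simp add: add_pos_nonneg)
  have "norm (inversion z) / (1 + (norm (inversion z))\<^sup>2) = norm z / (1 + (norm z)\<^sup>2)"
    using assms 1 by (simp add: norm_inversion field_simps power2_eq_square)
  then have "(norm (inversion z) / (1 + (norm (inversion z))\<^sup>2)) ^ CARD('d) = (norm z / (1 + (norm z)\<^sup>2)) ^ CARD('d)"
    by simp
  then show ?thesis by (simp add: student_def power_divide)
qed

lemma nn_integral_eq_conformal:
  fixes f :: "'a::euclidean_space \<Rightarrow> real"
  assumes [measurable]: "f \<in> borel_measurable borel"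
  shows "(\<integral>\<^sup>+z. ennreal (f z) \<partial>lborel) = (\<integral>\<^sup>+z. ennreal (norm z ^ DIM('a) * f z) \<partial>conformal)"
proof -
  have "(\<integral>\<^sup>+z. ennreal (norm z ^ DIM('a) * f z) \<partial>conformal)
      = (\<integral>\<^sup>+z. ennreal (1 / norm z ^ DIM('a)) * ennreal (norm z ^ DIM('a) * f z) \<partial>lborel)"
    by (rule nn_integral_conformal) measurable
  also have "\<dots> = (\<integral>\<^sup>+z. ennreal (f z) \<partial>lborel)"
  proof (rule nn_integral_cong_AE)
    show "AE z in lborel. ennreal (1 / norm z ^ DIM('a)) * ennreal (norm z ^ DIM('a) * f z) = ennreal (f z)"
      using AE_lborel_singleton[of "0 :: 'a"] by eventually_elim (simp add: ennreal_mult'[symmetric])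
  qed
  finally show ?thesis ..
qed

context mpcn
begin

lemma density_unit_le:
  fixes z :: "real ^ 'd"
  assumes "norm \<theta> = 1"
  shows "mpcn_density \<rho> \<theta> z \<le> 1 / (1 - sqrt \<rho>) ^ CARD('d) * student z"
proof -
  have "((1 - sqrt \<rho>) * (1 + (norm z)\<^sup>2)) ^ CARD('d) \<le> mpcn_form \<rho> \<theta> z ^ CARD('d)"
    using mpcn_form_lower[of \<rho> \<theta> z] assms \<rho> by (intro power_mono) auto
  then have "1 / mpcn_form \<rho> \<theta> z ^ CARD('d) \<le> 1 / ((1 - sqrt \<rho>) * (1 + (norm z)\<^sup>2)) ^ CARD('d)"
    using \<rho> by (intro divide_left_mono mult_pos_pos zero_less_power) (auto simp: add_pos_nonneg intro!: mpcn_form_pos, use assms in auto)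
  then show ?thesis using assms by (simp add: mpcn_density_def student_def power_mult_distrib)
qed

lemma density_unit_ge:
  fixes z :: "real ^ 'd"
  assumes "norm \<theta> = 1"
  shows "student z \<le> 2 ^ CARD('d) * mpcn_density \<rho> \<theta> z"
proof -
  have "\<theta> \<noteq> 0" using assms by auto
  then have f: "0 < mpcn_form \<rho> \<theta> z" using \<rho> by (intro mpcn_form_pos) auto
  have "mpcn_form \<rho> \<theta> z ^ CARD('d) \<le> (2 * (1 + (norm z)\<^sup>2)) ^ CARD('d)"
    using mpcn_form_upper[of \<rho> \<theta> z] assms \<rho> f by (intro power_mono) auto
  then have "1 / (2 * (1 + (norm z)\<^sup>2)) ^ CARD('d) \<le> 1 / mpcn_form \<rho> \<theta> z ^ CARD('d)"
    using f by (intro divide_left_mono mult_pos_pos zero_less_power) (auto simp: add_pos_nonneg)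
  then have "2 ^ CARD('d) * (1 / (2 * (1 + (norm z)\<^sup>2)) ^ CARD('d)) \<le> 2 ^ CARD('d) * (1 / mpcn_form \<rho> \<theta> z ^ CARD('d))"
    by (rule mult_left_mono) simp
  also have "2 ^ CARD('d) * (1 / (2 * (1 + (norm z)\<^sup>2)) ^ CARD('d)) = student z"
    unfolding student_def power_mult_distrib by simp
  finally show ?thesis using assms by (simp add: mpcn_density_def)
qed

text \<open>Finiteness is inherited from a proposal from a unit vector: it has mass 1 and dominates
  \<open>student\<close> up to a constant.\<close>

lemma student_finite: "(\<integral>\<^sup>+(z :: real ^ 'd). ennreal (student (z :: real ^ 'd)) \<partial>lborel) < \<infinity>"
proof -
  let ?e = "unit_diag :: real ^ 'd"
  have e: "?e \<noteq> 0" using norm_unit_diag[where 'd = 'd] by auto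
  have "(\<integral>\<^sup>+(z :: real ^ 'd). ennreal (student (z :: real ^ 'd)) \<partial>lborel)
      \<le> (\<integral>\<^sup>+(z :: real ^ 'd). ennreal (2 ^ CARD('d) / c) * ennreal (c * mpcn_density \<rho> ?e z) \<partial>lborel)"
    using density_unit_ge[OF norm_unit_diag] c_pos
    by (intro nn_integral_mono) (simp add: ennreal_mult'[symmetric] ennreal_leI)
  also have "\<dots> = ennreal (2 ^ CARD('d) / c) * 1"
    using proposal_total[OF e] by (subst nn_integral_cmult) auto
  finally show ?thesis by (rule le_less_trans) simp
qed

text \<open>Volumes of small balls give a finite negative moment through
  \<open>moment_of_geometric_tail\<close>. The positive moment of the same order is its image under
  the inversion, so the tail at infinity needs no estimate.\<close>

lemma student_lyap_finite:
  obtains \<delta> where "0 < \<delta>" "(\<integral>\<^sup>+(z :: real ^ 'd). ennreal (lyap \<delta> z * student (z :: real ^ 'd)) \<partial>lborel) < \<infinity>"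
proof -
  let ?M = "density lborel (\<lambda>z :: real ^ 'd. ennreal (student z))" and ?d = "CARD('d)"
  have "\<exists>\<delta>>0. (\<integral>\<^sup>+(z :: real ^ 'd). ennreal ((1 / norm z) powr \<delta>) \<partial>?M) < \<infinity>"
  \<comment> \<open>The set where 1 / norm z exceeds 2^n lies in the ball of radius 2^(-n), whose
    volume is a multiple of (2^(-d))^n.\<close>
  proof (rule moment_of_geometric_tail[where K = 2 and R = 1 and \<eta> = "(1 / 2) ^ ?d" and B = "unit_ball_vol ?d"])
    show "finite_measure ?M"
      using student_finite by (intro finite_measureI) (simp add: emeasure_density)
    show "(1 / 2) ^ ?d < (1 :: real)" by (rule power_Suc_less_one[of _ "?d - 1", simplified]) auto
    show "emeasure ?M {z \<in> space ?M. 2 ^ n * 1 < 1 / norm z} \<le> ennreal (unit_ball_vol ?d * ((1 / 2) ^ ?d) ^ n)" for n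
    proof -
      have "emeasure ?M {z \<in> space ?M. 2 ^ n * 1 < 1 / norm z} = (\<integral>\<^sup>+(z :: real ^ 'd). ennreal (student z) * indicator {z. 2 ^ n < 1 / norm z} z \<partial>lborel)"
        by (subst emeasure_density) auto
      also have "\<dots> \<le> (\<integral>\<^sup>+(z :: real ^ 'd). indicator (cball (0 :: real ^ 'd) ((1 / 2) ^ n)) z \<partial>lborel)"
      proof (rule nn_integral_mono)
        fix z :: "real ^ 'd"
        have "norm z \<le> (1 / 2) ^ n" if "2 ^ n < 1 / norm z"
        proof -
          have "0 < norm z" using that by (cases "z = 0") (auto simp: not_less)
          with that show ?thesis by (simp add: field_simps power_divide)
        qed
        then show "ennreal (student z) * indicator {z. 2 ^ n < 1 / norm z} z \<le> indicator (cball 0 ((1 / 2) ^ n)) z"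
          using student_le_1[of z] by (auto simp: indicator_def)
      qed
      also have "\<dots> = ennreal (unit_ball_vol ?d * ((1 / 2) ^ n) ^ ?d)"
        using emeasure_cball[of "(1 / 2) ^ n" "0 :: real ^ 'd"] by simp
      finally show ?thesis by (simp only: power_mult[symmetric] mult.commute[of n])
    qed
  qed auto
  then obtain \<delta> where \<delta>: "0 < \<delta>" and fin: "(\<integral>\<^sup>+(z :: real ^ 'd). ennreal ((1 / norm z) powr \<delta>) \<partial>?M) < \<infinity>" by blast
  have inv: "(\<integral>\<^sup>+(z :: real ^ 'd). ennreal ((1 / norm z) powr \<delta> * student z) \<partial>lborel) = (\<integral>\<^sup>+(z :: real ^ 'd). ennreal (norm z powr \<delta> * student (z :: real ^ 'd)) \<partial>lborel)"
  proof -
    have "(\<integral>\<^sup>+(z :: real ^ 'd). ennreal (norm z powr \<delta> * student (z :: real ^ 'd)) \<partial>lborel)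
        = (\<integral>\<^sup>+(z :: real ^ 'd). ennreal (norm z ^ DIM(real ^ 'd) * (norm z powr \<delta> * student z)) \<partial>conformal)"
      by (rule nn_integral_eq_conformal) measurable
    also have "\<dots> = (\<integral>\<^sup>+(z :: real ^ 'd). ennreal (norm (inversion z) ^ DIM(real ^ 'd) * (norm (inversion z) powr \<delta> * student (inversion z))) \<partial>conformal)"
      by (rule nn_integral_conformal_inversion[symmetric]) measurable
    also have "\<dots> = (\<integral>\<^sup>+(z :: real ^ 'd). ennreal (norm z ^ DIM(real ^ 'd) * ((1 / norm z) powr \<delta> * student z)) \<partial>conformal)"
    proof (rule nn_integral_cong_AE)
      show "AE z :: real ^ 'd in conformal. ennreal (norm (inversion z) ^ DIM(real ^ 'd) * (norm (inversion z) powr \<delta> * student (inversion z)))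
          = ennreal (norm z ^ DIM(real ^ 'd) * ((1 / norm z) powr \<delta> * student z))"
        using AE_conformal_nonzero
      proof eventually_elim
        case (elim z)
        from student_inversion[OF elim] show ?case
          by (simp add: norm_inversion mult.left_commute)
      qed
    qed
    also have "\<dots> = (\<integral>\<^sup>+(z :: real ^ 'd). ennreal ((1 / norm z) powr \<delta> * student z) \<partial>lborel)"
      by (rule nn_integral_eq_conformal[symmetric]) measurable
    finally show ?thesis ..
  qed
  have fin': "(\<integral>\<^sup>+(z :: real ^ 'd). ennreal ((1 / norm z) powr \<delta> * student (z :: real ^ 'd)) \<partial>lborel) < \<infinity>"
    using fin by (simp add: nn_integral_density ennreal_mult' mult.commute)
  have "(\<integral>\<^sup>+(z :: real ^ 'd). ennreal (lyap \<delta> z * student (z :: real ^ 'd)) \<partial>lborel)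
     = (\<integral>\<^sup>+(z :: real ^ 'd). ennreal (norm z powr \<delta> * student z) + ennreal ((1 / norm z) powr \<delta> * student (z :: real ^ 'd)) \<partial>lborel)"
    by (intro nn_integral_cong)
      (simp add: lyap_def distrib_right powr_divide powr_minus_divide ennreal_plus[symmetric] del: ennreal_plus)
  also have "\<dots> = (\<integral>\<^sup>+(z :: real ^ 'd). ennreal (norm z powr \<delta> * student (z :: real ^ 'd)) \<partial>lborel) + (\<integral>\<^sup>+(z :: real ^ 'd). ennreal ((1 / norm z) powr \<delta> * student (z :: real ^ 'd)) \<partial>lborel)"
    by (rule nn_integral_add) measurable
  also have "\<dots> < \<infinity>" using fin' inv by simp
  finally show ?thesis using \<delta> that by blast
qed

end

section \<open>The relative drift in scaled coordinates\<close>

locale mpcn_lyap = mpcn \<rho> c p for \<rho> c :: real and p :: "real ^ 'd \<Rightarrow> real" +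
  fixes \<delta> :: real
  assumes \<delta>_pos: "0 < \<delta>"
    and lyap_student: "(\<integral>\<^sup>+(z :: real ^ 'd). ennreal (lyap \<delta> z * student z) \<partial>lborel) < \<infinity>"
begin

definition accept_ratio :: "real ^ 'd \<Rightarrow> real ^ 'd \<Rightarrow> real" where
  "accept_ratio x z = wt (norm x *\<^sub>R z) / wt x"

definition flow :: "real ^ 'd \<Rightarrow> real ^ 'd \<Rightarrow> real" where
  "flow x z = c * mpcn_density \<rho> (sgn x) z * min 1 (accept_ratio x z)"

text \<open>The integrand of the relative drift (P W)(x) / W(x) - 1 for W =
  \<open>lyap \<delta>\<close>. A rejected proposal leaves W unchanged, so the holding mass does not
  appear.\<close>

definition drift :: "real ^ 'd \<Rightarrow> real ^ 'd \<Rightarrow> real" where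
  "drift x z = flow x z * (lyap \<delta> (norm x *\<^sub>R z) / lyap \<delta> x - 1)"

text \<open>An integrable bound for \<open>drift x\<close> that is the same for all nonzero x; it
  licenses the limit under the integral at both ends.\<close>

definition envelope :: "real ^ 'd \<Rightarrow> real" where
  "envelope z = c / (1 - sqrt \<rho>) ^ CARD('d) * student z * (lyap \<delta> z + 1)"

lemma accept_ratio_nonneg [simp]: "0 \<le> accept_ratio x z"
  using wt_nonneg by (simp add: accept_ratio_def)

lemma accept_ratio_meas [measurable]: "accept_ratio x \<in> borel_measurable borel"
  unfolding accept_ratio_def[abs_def] by measurable

lemma flow_meas [measurable]: "flow x \<in> borel_measurable borel"
  unfolding flow_def[abs_def] by measurable

lemma drift_meas [measurable]: "drift x \<in> borel_measurable borel"
  unfolding drift_def[abs_def] by measurable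

lemma envelope_meas [measurable]: "envelope \<in> borel_measurable borel"
  unfolding envelope_def[abs_def] by measurable

lemma flow_nonneg [simp]: "0 \<le> flow x z"
  unfolding flow_def using c_pos mpcn_density_nonneg accept_ratio_nonneg by (intro mult_nonneg_nonneg) auto

lemma flow_le:
  assumes "x \<noteq> 0"
  shows "flow x z \<le> c / (1 - sqrt \<rho>) ^ CARD('d) * student z"
proof -
  have "flow x z \<le> c * mpcn_density \<rho> (sgn x) z"
    unfolding flow_def using c_pos mpcn_density_nonneg[of "sgn x" z] by (intro mult_left_le) auto
  also have "\<dots> \<le> c * (1 / (1 - sqrt \<rho>) ^ CARD('d) * student z)"
    using assms c_pos by (intro mult_left_mono density_unit_le) (auto simp: norm_sgn)
  finally show ?thesis by simp
qed

lemma lyap_ratio_le: "x \<noteq> 0 \<Longrightarrow> lyap \<delta> (norm x *\<^sub>R z) / lyap \<delta> x \<le> lyap \<delta> z"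
  using lyap_scale_le[of \<delta> "norm x" z] lyap_ge_1[of x \<delta>] \<delta>_pos
  by (simp add: lyap_def[of \<delta> "norm x"] lyap_def[of \<delta> x] pos_divide_le_eq mult.commute)

lemma lyap_ratio_nonneg: "0 \<le> lyap \<delta> (norm x *\<^sub>R z) / lyap \<delta> x"
  by (intro divide_nonneg_nonneg lyap_nonneg)

lemma drift_bound:
  assumes "x \<noteq> 0"
  shows "\<bar>drift x z\<bar> \<le> envelope z"
proof -
  have "\<bar>lyap \<delta> (norm x *\<^sub>R z) / lyap \<delta> x - 1\<bar> \<le> lyap \<delta> z + 1"
    using lyap_ratio_le[OF assms, of z] lyap_ratio_nonneg[of x z] by linarith
  then have "flow x z * \<bar>lyap \<delta> (norm x *\<^sub>R z) / lyap \<delta> x - 1\<bar>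
      \<le> c / (1 - sqrt \<rho>) ^ CARD('d) * student z * (lyap \<delta> z + 1)"
    using flow_nonneg flow_le[OF assms] c_pos \<rho> by (intro mult_mono) auto
  then show ?thesis using flow_nonneg[of x z] by (simp add: drift_def envelope_def abs_mult)
qed

lemma student_integrable: "integrable lborel (student :: real ^ 'd \<Rightarrow> real)"
  using student_finite by (intro integrableI_nonneg) auto

lemma lyap_student_integrable: "integrable lborel (\<lambda>z :: real ^ 'd. lyap \<delta> z * student z)"
  using lyap_student lyap_nonneg by (intro integrableI_nonneg) auto

lemma envelope_integrable: "integrable lborel envelope"
proof -
  have "envelope = (\<lambda>z. c / (1 - sqrt \<rho>) ^ CARD('d) * (lyap \<delta> z * student z + student z))"
    by (simp add: fun_eq_iff envelope_def algebra_simps)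
  then show ?thesis using lyap_student_integrable student_integrable by auto
qed

lemma drift_integrable: "x \<noteq> 0 \<Longrightarrow> integrable lborel (drift x)"
  by (intro Bochner_Integration.integrable_bound[OF envelope_integrable])
    (auto intro!: AE_I2 order_trans[OF drift_bound abs_ge_self])

lemma jump_scaled:
  assumes x: "x \<noteq> 0"
  shows "norm x ^ CARD('d) * jump x (norm x *\<^sub>R z) = flow x z"
proof -
  have "mpcn_form \<rho> x (norm x *\<^sub>R z) = (norm x)\<^sup>2 * mpcn_form \<rho> (sgn x) z"
    using mpcn_form_scale[of \<rho> "norm x" "sgn x" z] x by (simp add: sgn_div_norm)
  then have "norm x ^ CARD('d) * mpcn_density \<rho> x (norm x *\<^sub>R z) = mpcn_density \<rho> (sgn x) z"
    using x by (simp add: mpcn_density_def norm_sgn power_mult_distrib power2_eq_square)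
  then show ?thesis by (simp add: jump_def flow_def accept_ratio_def mult_ac)
qed

lemma nn_integral_jump_scaled:
  fixes f :: "real ^ 'd \<Rightarrow> real"
  assumes x: "x \<noteq> 0" and [measurable]: "f \<in> borel_measurable borel" and f: "\<And>y. 0 \<le> f y"
  shows "(\<integral>\<^sup>+y. ennreal (jump x y * f y) \<partial>lborel) = (\<integral>\<^sup>+z. ennreal (flow x z * f (norm x *\<^sub>R z)) \<partial>lborel)"
proof -
  have n: "0 < norm x" using x by simp
  have "(\<integral>\<^sup>+y. ennreal (jump x y * f y) \<partial>lborel)
      = ennreal (norm x ^ CARD('d)) * (\<integral>\<^sup>+z. ennreal (jump x (norm x *\<^sub>R z) * f (norm x *\<^sub>R z)) \<partial>lborel)"
    using nn_integral_lborel_scale[OF _ n, of "\<lambda>y :: real ^ 'd. ennreal (jump x y * f y)"] by simp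
  also have "\<dots> = (\<integral>\<^sup>+z. ennreal (norm x ^ CARD('d)) * ennreal (jump x (norm x *\<^sub>R z) * f (norm x *\<^sub>R z)) \<partial>lborel)"
    by (rule nn_integral_cmult[symmetric]) measurable
  also have "\<dots> = (\<integral>\<^sup>+z. ennreal (flow x z * f (norm x *\<^sub>R z)) \<partial>lborel)"
    by (intro nn_integral_cong) (simp add: ennreal_mult'[symmetric] jump_scaled[OF x, symmetric] mult.assoc)
  finally show ?thesis .
qed

lemma nn_integral_lyap_kernel:
  assumes x: "x \<noteq> 0"
  shows "(\<integral>\<^sup>+y. ennreal (lyap \<delta> y) \<partial>mpcn_kernel \<rho> p x) = ennreal (lyap \<delta> x * (1 + (\<integral>z. drift x z \<partial>lborel)))"
    and "0 \<le> 1 + (\<integral>z. drift x z \<partial>lborel)"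
proof -
  let ?W = "lyap \<delta> :: real ^ 'd \<Rightarrow> real" and ?r = "norm x"
  have W1: "1 \<le> ?W x" using x \<delta>_pos by (intro lyap_ge_1) auto
  have flow_int: "integrable lborel (flow x)"
  proof (rule Bochner_Integration.integrable_bound)
    show "integrable lborel (\<lambda>z :: real ^ 'd. c / (1 - sqrt \<rho>) ^ CARD('d) * student z)"
      by (intro integrable_mult_right student_integrable)
    show "AE z in lborel. norm (flow x z) \<le> norm (c / (1 - sqrt \<rho>) ^ CARD('d) * student z)"
    proof (rule AE_I2)
      show "norm (flow x z) \<le> norm (c / (1 - sqrt \<rho>) ^ CARD('d) * student z)" for z
        unfolding real_norm_def using flow_le[OF x, of z] flow_nonneg[of x z] by linarith
    qed
  qed simp
  have q_int: "integrable lborel (\<lambda>z. flow x z * (?W (?r *\<^sub>R z) / ?W x))"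
    using Bochner_Integration.integrable_add[OF drift_integrable[OF x] flow_int]
    by (simp add: drift_def right_diff_distrib)
  have fW_int: "integrable lborel (\<lambda>z. flow x z * ?W (?r *\<^sub>R z))"
    using integrable_mult_left[OF q_int, of "?W x"] W1 by (simp add: mult.assoc)
  have I: "(\<integral>\<^sup>+y. ennreal (jump x y) \<partial>lborel) = ennreal (\<integral>z. flow x z \<partial>lborel)"
    using nn_integral_jump_scaled[OF x, of "\<lambda>_. 1"] nn_integral_eq_integral[OF flow_int] flow_nonneg by simp
  have f1: "(\<integral>z. flow x z \<partial>lborel) \<le> 1"
    using jump_total_le[OF x] I by simp
  have hold: "hold x = ennreal (1 - (\<integral>z. flow x z \<partial>lborel))"
    unfolding hold_def I using f1 flow_nonneg
    by (subst ennreal_minus[symmetric]) (auto intro!: Bochner_Integration.integral_nonneg)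
  have J: "(\<integral>\<^sup>+y. ennreal (jump x y) * ennreal (?W y) \<partial>lborel) = ennreal (\<integral>z. flow x z * ?W (?r *\<^sub>R z) \<partial>lborel)"
  proof -
    have "(\<integral>\<^sup>+y. ennreal (jump x y) * ennreal (?W y) \<partial>lborel) = (\<integral>\<^sup>+z. ennreal (flow x z * ?W (?r *\<^sub>R z)) \<partial>lborel)"
      using nn_integral_jump_scaled[OF x, of ?W] lyap_nonneg by (simp add: ennreal_mult''[symmetric])
    also have "\<dots> = ennreal (\<integral>z. flow x z * ?W (?r *\<^sub>R z) \<partial>lborel)"
      using flow_nonneg lyap_nonneg by (intro nn_integral_eq_integral fW_int) auto
    finally show ?thesis .
  qed
  have "(\<integral>z. drift x z \<partial>lborel) = (\<integral>z. flow x z * (?W (?r *\<^sub>R z) / ?W x) - flow x z \<partial>lborel)"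
    by (simp add: drift_def right_diff_distrib)
  also have "\<dots> = (\<integral>z. flow x z * ?W (?r *\<^sub>R z) \<partial>lborel) / ?W x - (\<integral>z. flow x z \<partial>lborel)"
    using q_int flow_int by simp
  finally have d: "(\<integral>z. drift x z \<partial>lborel) = \<dots>" .
  have n1: "0 \<le> (\<integral>z. flow x z * ?W (?r *\<^sub>R z) \<partial>lborel)"
    using flow_nonneg lyap_nonneg by (intro Bochner_Integration.integral_nonneg) auto
  have "(\<integral>\<^sup>+y. ennreal (?W y) \<partial>mpcn_kernel \<rho> p x)
      = ennreal (\<integral>z. flow x z * ?W (?r *\<^sub>R z) \<partial>lborel) + ennreal (?W x) * ennreal (1 - (\<integral>z. flow x z \<partial>lborel))"
    by (subst nn_integral_kernel[OF x]) (simp_all add: J hold)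
  also have "\<dots> = ennreal ((\<integral>z. flow x z * ?W (?r *\<^sub>R z) \<partial>lborel) + ?W x * (1 - (\<integral>z. flow x z \<partial>lborel)))"
    using n1 f1 W1 by (subst ennreal_mult[symmetric]) (auto simp: ennreal_plus[symmetric] simp del: ennreal_plus)
  also have "(\<integral>z. flow x z * ?W (?r *\<^sub>R z) \<partial>lborel) + ?W x * (1 - (\<integral>z. flow x z \<partial>lborel)) = ?W x * (1 + (\<integral>z. drift x z \<partial>lborel))"
    unfolding d using W1 by (simp add: field_simps)
  finally show "(\<integral>\<^sup>+y. ennreal (?W y) \<partial>mpcn_kernel \<rho> p x) = ennreal (?W x * (1 + (\<integral>z. drift x z \<partial>lborel)))" .
  show "0 \<le> 1 + (\<integral>z. drift x z \<partial>lborel)"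
    unfolding d using f1 n1 W1 by (smt (verit) divide_nonneg_nonneg)
qed

text \<open>Here a is a Lyapunov ratio and b an acceptance ratio; the second summand belongs to the
  inverted point. The hypothesis puts a and b a strictly on opposite sides of 1. It decides which of
  the minima is 1, and the sum becomes (a - 1)(b a - 1) over a positive number.\<close>

lemma accept_drift_neg:
  assumes "(1 < a \<and> b * a < 1) \<or> (a < 1 \<and> 1 < b * a)" "0 < a" "0 < (b :: real)"
  shows "min 1 b * (a - 1) + min 1 (1 / b) * (1 / a - 1) < 0"
  using assms(1)
proof
  assume *: "1 < a \<and> b * a < 1"
  have "b * 1 < b * a" using * assms by (intro mult_strict_left_mono) auto
  then have "b < 1" using * by linarith
  then have "min 1 b * (a - 1) + min 1 (1 / b) * (1 / a - 1) = (a - 1) * (b * a - 1) / a"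
    using assms by (simp add: field_simps min_def)
  also have "\<dots> < 0" using * assms by (intro divide_neg_pos mult_pos_neg) auto
  finally show ?thesis .
next
  assume *: "a < 1 \<and> 1 < b * a"
  have "b * a < b * 1" using * assms by (intro mult_strict_left_mono) auto
  then have b: "1 < b" using * by linarith
  then have "min 1 b * (a - 1) + min 1 (1 / b) * (1 / a - 1) = (a - 1) * (b * a - 1) / (b * a)"
    using assms by (simp add: field_simps min_def)
  also have "\<dots> < 0" using * assms by (intro divide_neg_pos mult_neg_pos) auto
  finally show ?thesis .
qed

text \<open>Against \<open>conformal\<close> the proposal has the weight \<open>A\<close>, which
  inversion preserves since \<theta> is a unit vector. Twice the integral is therefore the integral
  of A times \<Phi> z + \<Phi> (inversion z), which is negative off the unit sphere by
  \<open>accept_drift_neg\<close> and zero on it.\<close>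

lemma limit_drift_neg:
  fixes L :: "real ^ 'd \<Rightarrow> real"
  assumes \<theta>: "norm \<theta> = 1" and [measurable]: "L \<in> borel_measurable borel"
    and L_pos: "\<And>z. z \<noteq> 0 \<Longrightarrow> 0 < L z" and L_inv: "\<And>z. z \<noteq> 0 \<Longrightarrow> L (inversion z) = 1 / L z"
    and sign: "\<And>z. 1 < norm z \<Longrightarrow>
      (1 < norm z powr s \<and> L z * norm z powr s < 1) \<or> (norm z powr s < 1 \<and> 1 < L z * norm z powr s)"
    and int: "integrable lborel (\<lambda>z. c * mpcn_density \<rho> \<theta> z * min 1 (L z) * (norm z powr s - 1))"
  shows "(\<integral>z. c * mpcn_density \<rho> \<theta> z * min 1 (L z) * (norm z powr s - 1) \<partial>lborel) < 0"
proof -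
  let ?d = "DIM(real ^ 'd)" and ?m = "conformal :: (real ^ 'd) measure"
  define \<Phi> where "\<Phi> z = min 1 (L z) * (norm z powr s - 1)" for z
  define A where "A z = norm z ^ ?d * (c * mpcn_density \<rho> \<theta> z)" for z
  let ?G = "\<lambda>z. c * mpcn_density \<rho> \<theta> z * min 1 (L z) * (norm z powr s - 1)"
  have [measurable]: "\<Phi> \<in> borel_measurable borel" "A \<in> borel_measurable borel"
    unfolding \<Phi>_def A_def by measurable
  have \<theta>0: "\<theta> \<noteq> 0" using \<theta> by auto
  have A_pos: "0 < A z" if "z \<noteq> 0" for z
    using that \<theta> c_pos \<rho> mpcn_form_pos[of \<rho> \<theta> z] \<theta>0 by (simp add: A_def mpcn_density_def)
  have A_inv: "A (inversion z) = A z" if z: "z \<noteq> 0" for z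
  proof -
    have "mpcn_form \<rho> \<theta> (inversion z) = mpcn_form \<rho> \<theta> z / (norm z)\<^sup>2"
      using z \<theta> by (simp add: mpcn_form_def norm_inversion inversion_def field_simps power2_eq_square)
    then have "norm (inversion z) / mpcn_form \<rho> \<theta> (inversion z) = norm z / mpcn_form \<rho> \<theta> z"
      using z by (simp add: norm_inversion power2_eq_square)
    then have "c * (norm (inversion z) / mpcn_form \<rho> \<theta> (inversion z)) ^ ?d = c * (norm z / mpcn_form \<rho> \<theta> z) ^ ?d" by simp
    then show ?thesis using \<theta> by (simp add: A_def mpcn_density_def power_divide mult_ac)
  qed
  have A\<Phi>: "AE z in lborel. (1 / norm z ^ ?d) *\<^sub>R (A z * \<Phi> z) = ?G z"
    using AE_lborel_singleton[of "0 :: real ^ 'd"]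
    by eventually_elim (simp add: A_def \<Phi>_def mult_ac)
  have int': "integrable ?m (\<lambda>z. A z * \<Phi> z)"
    unfolding conformal_def
    by (subst integrable_density) (use int A\<Phi> in \<open>auto intro: integrable_cong_AE_imp\<close>)
  have eq: "(\<integral>z. ?G z \<partial>lborel) = (\<integral>z. A z * \<Phi> z \<partial>?m)"
    unfolding conformal_def by (subst integral_density) (use A\<Phi> in \<open>auto intro!: integral_cong_AE\<close>)
  have int2: "integrable ?m (\<lambda>z. A (inversion z) * \<Phi> (inversion z))"
    and eq2: "(\<integral>z. A (inversion z) * \<Phi> (inversion z) \<partial>?m) = (\<integral>z. A z * \<Phi> z \<partial>?m)"
  proof -
    have "integrable (distr ?m borel inversion) (\<lambda>z. A z * \<Phi> z)"
      using int' distr_conformal_inversion[where 'a = "real ^ 'd"] by simp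
    then show "integrable ?m (\<lambda>z. A (inversion z) * \<Phi> (inversion z))"
      by (subst (asm) integrable_distr_eq) auto
    have "(\<integral>z. A z * \<Phi> z \<partial>?m) = (\<integral>z. A z * \<Phi> z \<partial>distr ?m borel inversion)"
      using distr_conformal_inversion[where 'a = "real ^ 'd"] by simp
    also have "\<dots> = (\<integral>z. A (inversion z) * \<Phi> (inversion z) \<partial>?m)"
      by (rule integral_distr) auto
    finally show "(\<integral>z. A (inversion z) * \<Phi> (inversion z) \<partial>?m) = (\<integral>z. A z * \<Phi> z \<partial>?m)" ..
  qed
  let ?S = "\<lambda>z. - (A z * \<Phi> z + A (inversion z) * \<Phi> (inversion z))"
  have S_int: "integrable ?m ?S" using int' int2 by auto
  have S_val: "(\<integral>z. ?S z \<partial>?m) = - (2 * (\<integral>z. ?G z \<partial>lborel))"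
    using int' int2 eq eq2 by simp
  have sym: "\<Phi> z + \<Phi> (inversion z) < 0" if z: "1 < norm z" for z
  proof -
    have z0: "z \<noteq> 0" using z by auto
    have "\<Phi> (inversion z) = min 1 (1 / L z) * (1 / norm z powr s - 1)"
      using z0 by (simp add: \<Phi>_def L_inv norm_inversion powr_divide)
    then show ?thesis
      using accept_drift_neg[OF sign[OF z]] L_pos[OF z0] z0 by (simp add: \<Phi>_def)
  qed
  have S_pos: "0 < ?S z" if z: "1 < norm z" for z
  proof -
    have z0: "z \<noteq> 0" using z by auto
    have "?S z = A z * - (\<Phi> z + \<Phi> (inversion z))" using A_inv[OF z0] by (simp add: algebra_simps)
    then show ?thesis using sym[OF z] A_pos[OF z0] by (simp add: mult_pos_neg)
  qed
  have S_nonneg: "0 \<le> ?S z" if z0: "z \<noteq> 0" for z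
  proof -
    have ii: "inversion (inversion z) = z"
      using z0 by (simp add: inversion_def power2_eq_square)
    consider "1 < norm z" | "norm z = 1" | "1 < norm (inversion z)"
      using z0 by (cases "norm z" "1 :: real" rule: linorder_cases) (auto simp: norm_inversion)
    then show ?thesis
    proof cases
      case 1
      then show ?thesis using S_pos by (simp add: less_imp_le)
    next
      case 2
      then show ?thesis by (simp add: \<Phi>_def norm_inversion)
    next
      case 3
      then show ?thesis using S_pos[OF 3] by (simp add: ii add.commute less_imp_le)
    qed
  qed
  have S_AE: "AE z in ?m. 0 \<le> ?S z"
    using AE_conformal_nonzero by eventually_elim (rule S_nonneg)
  show ?thesis
  proof (rule ccontr)
    assume "\<not> ?thesis"
    then have "(\<integral>z. ?S z \<partial>?m) \<le> 0" using S_val by simp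
    then have "(\<integral>z. ?S z \<partial>?m) = 0" using integral_nonneg_AE[OF S_AE] by simp
    \<comment> \<open>Strictness: a vanishing integral would make \<open>?S\<close> zero almost
      everywhere, but it is positive on the nonempty open set outside the closed unit ball.\<close>
    then have "AE z in ?m. ?S z = 0"
      using integral_nonneg_eq_0_iff_AE[OF S_int S_AE] by simp
    then have "AE z in lborel. 0 < ennreal (1 / norm z ^ ?d) \<longrightarrow> ?S z = 0"
      unfolding conformal_def by (subst (asm) AE_density) auto
    then have "AE z in lborel. z \<notin> {z :: real ^ 'd. 1 < norm z}"
    proof eventually_elim
      case (elim z)
      show ?case
      proof
        assume "z \<in> {z. 1 < norm z}"
        then have z: "1 < norm z" by simp
        then have "0 < 1 / norm z ^ ?d" by (intro divide_pos_pos zero_less_power) auto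
        then have "?S z = 0" using elim by simp
        with S_pos[OF z] show False by simp
      qed
    qed
    moreover have "open {z :: real ^ 'd. 1 < norm z}" by (intro open_Collect_less continuous_intros)
    ultimately have "{z :: real ^ 'd. 1 < norm z} = {}" by (intro open_AE_lborel_notin)
    moreover have "2 *\<^sub>R \<theta> \<in> {z. 1 < norm z}" using \<theta> by simp
    ultimately show False by blast
  qed
qed

text \<open>Serves both ends: s is the exponent of the limiting Lyapunov ratio, \<delta> at infinity
  and -\<delta> at the origin. Along a subsequence the directions converge to some \<theta>, and
  dominated convergence gives a limit of the drifts that is nonnegative by \<open>ge\<close> and
  negative by \<open>limit_drift_neg\<close>.\<close>

lemma drift_sequence_contradiction:
  fixes L :: "real ^ 'd \<Rightarrow> real" and x :: "nat \<Rightarrow> real ^ 'd"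
  assumes x: "\<And>n. x n \<noteq> 0"
    and L: "\<And>z. (\<lambda>n. accept_ratio (x n) z) \<longlonglongrightarrow> L z"
    and W: "\<And>z :: real ^ 'd. z \<noteq> 0 \<Longrightarrow> (\<lambda>n. lyap \<delta> (norm (x n) *\<^sub>R z) / lyap \<delta> (x n)) \<longlonglongrightarrow> norm z powr s"
    and L_pos: "\<And>z. z \<noteq> 0 \<Longrightarrow> 0 < L z" and L_inv: "\<And>z. z \<noteq> 0 \<Longrightarrow> L (inversion z) = 1 / L z"
    and sign: "\<And>z. 1 < norm z \<Longrightarrow>
      (1 < norm z powr s \<and> L z * norm z powr s < 1) \<or> (norm z powr s < 1 \<and> 1 < L z * norm z powr s)"
    and ge: "\<And>n. - (1 / real (Suc n)) \<le> (\<integral>z. drift (x n) z \<partial>lborel)"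
  shows False
proof -
  have Lm [measurable]: "L \<in> borel_measurable borel"
    by (rule borel_measurable_LIMSEQ_real[OF L]) measurable
  have "\<forall>n. sgn (x n) \<in> sphere 0 1" using x by (simp add: norm_sgn)
  then have "\<exists>l\<in>sphere 0 1. \<exists>r. strict_mono (r :: nat \<Rightarrow> nat) \<and> ((\<lambda>n. sgn (x n)) \<circ> r) \<longlonglongrightarrow> l"
    by (rule mp[OF spec[where x = "\<lambda>n. sgn (x n)"], rotated])
      (rule compact_sphere[of "0 :: real ^ 'd" 1, unfolded compact_def])
  then obtain \<theta> \<sigma> where \<theta>: "\<theta> \<in> sphere 0 1" and \<sigma>: "strict_mono (\<sigma> :: nat \<Rightarrow> nat)"
    and lim: "((\<lambda>n. sgn (x n)) \<circ> \<sigma>) \<longlonglongrightarrow> \<theta>"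
    by blast
  have \<theta>1: "norm \<theta> = 1" "\<theta> \<noteq> 0" using \<theta> by auto
  let ?G = "\<lambda>z. c * mpcn_density \<rho> \<theta> z * min 1 (L z) * (norm z powr s - 1)"
  have pt: "(\<lambda>n. drift (x (\<sigma> n)) z) \<longlonglongrightarrow> ?G z" if z: "z \<noteq> 0" for z
  proof -
    have "(\<lambda>n. mpcn_density \<rho> (sgn (x (\<sigma> n))) z) \<longlonglongrightarrow> mpcn_density \<rho> \<theta> z"
      unfolding mpcn_density_def mpcn_form_def
    proof (intro tendsto_intros lim[unfolded comp_def])
      show "((norm \<theta>)\<^sup>2 + (norm z)\<^sup>2 - 2 * sqrt \<rho> * (\<theta> \<bullet> z)) ^ CARD('d) \<noteq> 0"
        using mpcn_form_pos[of \<rho> \<theta> z] \<rho> \<theta>1 by (simp add: mpcn_form_def)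
    qed
    moreover have "(\<lambda>n. accept_ratio (x (\<sigma> n)) z) \<longlonglongrightarrow> L z"
      using LIMSEQ_subseq_LIMSEQ[OF L \<sigma>] by (simp add: comp_def)
    moreover have "(\<lambda>n. lyap \<delta> (norm (x (\<sigma> n)) *\<^sub>R z) / lyap \<delta> (x (\<sigma> n))) \<longlonglongrightarrow> norm z powr s"
      using LIMSEQ_subseq_LIMSEQ[OF W[OF z] \<sigma>] by (simp add: comp_def)
    ultimately show ?thesis
      unfolding drift_def flow_def by (intro tendsto_intros)
  qed
  have AE: "AE z in lborel. (\<lambda>n. drift (x (\<sigma> n)) z) \<longlonglongrightarrow> ?G z"
    using AE_lborel_singleton[of "0 :: real ^ 'd"] by eventually_elim (rule pt)
  have Gm: "?G \<in> borel_measurable lborel" by measurable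
  have bd: "AE z in lborel. norm (drift (x (\<sigma> n)) z) \<le> envelope z" for n
    using drift_bound[OF x] by simp
  have dm: "drift (x (\<sigma> n)) \<in> borel_measurable lborel" for n by simp
  have int: "integrable lborel ?G"
    by (rule integrable_dominated_convergence[OF Gm dm envelope_integrable AE bd])
  have conv: "(\<lambda>n. \<integral>z. drift (x (\<sigma> n)) z \<partial>lborel) \<longlonglongrightarrow> (\<integral>z. ?G z \<partial>lborel)"
    by (rule integral_dominated_convergence[OF Gm dm envelope_integrable AE bd])
  have "(\<lambda>n. - (1 / real (Suc (\<sigma> n)))) \<longlonglongrightarrow> - 0"
    using LIMSEQ_subseq_LIMSEQ[OF LIMSEQ_Suc[OF lim_1_over_n] \<sigma>] by (intro tendsto_minus) (simp add: comp_def)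
  then have "0 \<le> (\<integral>z. ?G z \<partial>lborel)"
    using LIMSEQ_le[OF _ conv] ge by fastforce
  moreover have "(\<integral>z. ?G z \<partial>lborel) < 0"
    by (rule limit_drift_neg[OF \<theta>1(1) Lm L_pos L_inv sign int])
  ultimately show False by simp
qed

end

section \<open>Geometric ergodicity from a finite moment\<close>

context mpcn
begin

lemma nn_integral_target:
  assumes [measurable]: "f \<in> borel_measurable borel"
  shows "(\<integral>\<^sup>+x. f x \<partial>target) = (\<integral>\<^sup>+x. ennreal (p x) * f x \<partial>lborel)"
  by (rule nn_integral_density) auto

text \<open>Otherwise some b < m has t^(d + \<delta>) b > 1. Let F be the \<delta>-moment over the
  region where the comparison with b holds. Dilation by t maps that region into itself, and changing
  variables gives F \<ge> t^(d + \<delta>) b F: t^d from the Jacobian, t^\<delta> from the norm, b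
  from the density. This is impossible as F is finite and positive.\<close>

lemma radial_limit_le:
  assumes mom: "(\<integral>\<^sup>+x. ennreal (norm x powr \<delta>) \<partial>target) < \<infinity>" and t: "1 < t" and m: "0 < m"
    and low: "\<And>b. 0 \<le> b \<Longrightarrow> b < m \<Longrightarrow> \<exists>X>0. \<forall>x. X \<le> norm x \<longrightarrow> b * p x \<le> p (t *\<^sub>R x)"
  shows "t ^ CARD('d) * m \<le> t powr - \<delta>"
proof (rule ccontr)
  assume "\<not> ?thesis"
  let ?s = "t ^ CARD('d) * t powr \<delta>"
  have s: "0 < ?s" using t by simp
  from \<open>\<not> ?thesis\<close> have "1 / ?s < m"
    using t s by (simp add: powr_minus_divide field_simps)
  then obtain b where b: "1 / ?s < b" "b < m" using dense by blast
  have b0: "0 < b" using b s by (meson divide_pos_pos less_trans zero_less_one)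
  obtain X where X: "0 < X" "\<And>x. X \<le> norm x \<Longrightarrow> b * p x \<le> p (t *\<^sub>R x)"
    using low[of b] b b0 by auto
  let ?f = "\<lambda>x. ennreal (norm x powr \<delta> * p x) * indicator {x. X \<le> norm x} x"
  define F where "F = (\<integral>\<^sup>+x. ?f x \<partial>lborel)"
  have fm: "?f \<in> borel_measurable borel" by measurable
  have "F \<le> (\<integral>\<^sup>+x. ennreal (p x) * ennreal (norm x powr \<delta>) \<partial>lborel)"
    unfolding F_def using p_pos
    by (intro nn_integral_mono) (auto simp: indicator_def ennreal_mult'[symmetric] mult.commute less_imp_le)
  also have "\<dots> < \<infinity>" using mom by (subst (asm) nn_integral_target) auto
  finally have F_fin: "F < \<infinity>" .
  have F_pos: "F \<noteq> 0"
  proof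
    assume "F = 0"
    then have "AE x in lborel. ?f x = 0" unfolding F_def by (subst (asm) nn_integral_0_iff_AE) auto
    then have "AE x in lborel. x \<notin> {x :: real ^ 'd. X < norm x}"
    proof eventually_elim
      case (elim x)
      show ?case
      proof
        assume x: "x \<in> {x. X < norm x}"
        then have "0 < norm x powr \<delta> * p x" using X(1) p_pos[of x] by (intro mult_pos_pos) auto
        then show False using elim x by auto
      qed
    qed
    moreover have "open {x :: real ^ 'd. X < norm x}" by (intro open_Collect_less continuous_intros)
    ultimately have "{x :: real ^ 'd. X < norm x} = {}" by (intro open_AE_lborel_notin)
    moreover have "(2 * X) *\<^sub>R unit_diag \<in> {x :: real ^ 'd. X < norm x}" using X(1) by (simp add: norm_unit_diag)
    ultimately show False by blast
  qed
  have "ennreal (?s * b) * F = ennreal (t ^ CARD('d)) * (\<integral>\<^sup>+x. ennreal (t powr \<delta> * b) * ?f x \<partial>lborel)"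
    using t b0 by (subst nn_integral_cmult) (auto simp: F_def ennreal_mult mult.assoc)
  also have "\<dots> \<le> ennreal (t ^ CARD('d)) * (\<integral>\<^sup>+x. ?f (t *\<^sub>R x) \<partial>lborel)"
  proof (intro mult_left_mono nn_integral_mono)
    fix x :: "real ^ 'd"
    show "ennreal (t powr \<delta> * b) * ?f x \<le> ?f (t *\<^sub>R x)"
    proof (cases "X \<le> norm x")
      case True
      then have "1 * X \<le> t * norm x" using t X(1) by (intro mult_mono) auto
      then have in2: "X \<le> norm (t *\<^sub>R x)" using t by simp
      have "t powr \<delta> * b * (norm x powr \<delta> * p x) = norm (t *\<^sub>R x) powr \<delta> * (b * p x)"
        using t by (simp add: powr_mult)
      also have "\<dots> \<le> norm (t *\<^sub>R x) powr \<delta> * p (t *\<^sub>R x)"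
        using X(2)[OF True] by (intro mult_left_mono) auto
      finally show ?thesis
        using True in2 t b0 by (simp add: ennreal_mult'[symmetric] ennreal_leI del: norm_scaleR)
    next
      case False
      then show ?thesis by simp
    qed
  qed simp
  also have "\<dots> = F"
    unfolding F_def using nn_integral_lborel_scale[OF fm, of t] t by simp
  finally have le: "ennreal (?s * b) * F \<le> F" .
  obtain r where r: "F = ennreal r" "0 < r" using F_fin F_pos
    by (cases F) (auto simp: less_le)
  have "?s * b * r \<le> r"
    using le r s b0 by (simp add: ennreal_mult'[symmetric])
  moreover have "1 < ?s * b" using b(1) s by (simp add: field_simps)
  ultimately show False using r by (simp add: mult_le_cancel_right1)
qed

end

text \<open>Cancels the dominant power r of \<open>lyap\<close> from a ratio; q = s / r is the
  relative size of the other power and tends to 0 in both applications.\<close>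

lemma ratio_rescale:
  fixes q r s a b :: real
  assumes "0 \<le> q" "0 < r" "q * r = s"
  shows "(a + q * b) / (1 + q) = (a * r + b * s) / (r + s)"
proof -
  have "a * r + b * s = (a + q * b) * r" "r + s = (1 + q) * r"
    using assms(3) by (simp_all add: algebra_simps)
  then show ?thesis using assms(2) by simp
qed

lemma lyap_ratio_tendsto_at_top:
  assumes x: "filterlim (\<lambda>n. norm (x n)) at_top sequentially" and \<delta>: "0 < \<delta>"
  shows "(\<lambda>n. lyap \<delta> (norm (x n) *\<^sub>R z) / lyap \<delta> (x n)) \<longlonglongrightarrow> norm z powr \<delta>"
proof -
  let ?q = "\<lambda>n. norm (x n) powr - (2 * \<delta>)"
  have q: "?q \<longlonglongrightarrow> 0" using x \<delta> by (intro tendsto_neg_powr) auto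
  have "(\<lambda>n. (norm z powr \<delta> + ?q n * norm z powr - \<delta>) / (1 + ?q n)) \<longlonglongrightarrow> (norm z powr \<delta> + 0 * norm z powr - \<delta>) / (1 + 0)"
    by (intro tendsto_intros q) simp
  moreover have "\<forall>\<^sub>F n in sequentially. (norm z powr \<delta> + ?q n * norm z powr - \<delta>) / (1 + ?q n) = lyap \<delta> (norm (x n) *\<^sub>R z) / lyap \<delta> (x n)"
  proof -
    have "\<forall>\<^sub>F n in sequentially. 1 \<le> norm (x n)" using x by (auto simp: filterlim_at_top)
    then show ?thesis
    proof eventually_elim
      case (elim n)
      let ?r = "norm (x n)"
      have r: "0 < ?r powr \<delta>" "?q n * ?r powr \<delta> = ?r powr - \<delta>" using elim by (auto simp: powr_add[symmetric])
      show ?case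
        using ratio_rescale[OF _ r, of "norm z powr \<delta>" "norm z powr - \<delta>"]
        by (simp add: lyap_def powr_mult mult.commute)
    qed
  qed
  ultimately show ?thesis by (simp add: tendsto_cong)
qed

lemma lyap_ratio_tendsto_0:
  assumes x: "(\<lambda>n. norm (x n)) \<longlonglongrightarrow> 0" and x0: "\<And>n. x n \<noteq> 0" and \<delta>: "0 < \<delta>"
  shows "(\<lambda>n. lyap \<delta> (norm (x n) *\<^sub>R z) / lyap \<delta> (x n)) \<longlonglongrightarrow> norm z powr - \<delta>"
proof -
  let ?q = "\<lambda>n. norm (x n) powr (2 * \<delta>)"
  have "?q \<longlonglongrightarrow> 0 powr (2 * \<delta>)" using \<delta> by (intro tendsto_powr' x tendsto_const) auto
  then have q: "?q \<longlonglongrightarrow> 0" by simp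
  have "(\<lambda>n. (?q n * norm z powr \<delta> + norm z powr - \<delta>) / (?q n + 1)) \<longlonglongrightarrow> (0 * norm z powr \<delta> + norm z powr - \<delta>) / (0 + 1)"
    by (intro tendsto_intros q) simp
  moreover have "(?q n * norm z powr \<delta> + norm z powr - \<delta>) / (?q n + 1) = lyap \<delta> (norm (x n) *\<^sub>R z) / lyap \<delta> (x n)" for n
  proof -
    let ?r = "norm (x n)"
    have r: "0 < ?r powr - \<delta>" "?q n * ?r powr - \<delta> = ?r powr \<delta>" using x0[of n] by (auto simp: powr_add[symmetric])
    show ?thesis
      using ratio_rescale[OF _ r, of "norm z powr - \<delta>" "norm z powr \<delta>"]
      by (simp add: lyap_def powr_mult add.commute mult.commute)
  qed
  ultimately show ?thesis by simp
qed

context mpcn_lyap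
begin

lemma accept_ratio_eq:
  assumes "x \<noteq> 0"
  shows "accept_ratio x z = norm z ^ CARD('d) * (p (norm x *\<^sub>R z) / p x)"
  using assms by (simp add: accept_ratio_def wt_def power_mult_distrib)

text \<open>The limiting acceptance ratio is L z = |z|^d m(|z|), and \<open>radial_limit_le\<close>
  bounds it by |z|^(-\<delta>1) for |z| > 1. So a = |z|^\<delta> exceeds 1 while L a \<le>
  |z|^(\<delta> - \<delta>1) < 1; the gap between \<delta> and \<delta>1 makes this strict.\<close>

lemma drift_far:
  assumes \<delta>1: "\<delta> < \<delta>1" and mom: "(\<integral>\<^sup>+x. ennreal (norm x powr \<delta>1) \<partial>target) < \<infinity>"
    and srv: "symmetrically_regularly_varying p"
  shows "\<exists>\<gamma><1. \<exists>X>0. \<forall>x. X \<le> norm x \<longrightarrow> 1 + (\<integral>z. drift x z \<partial>lborel) \<le> \<gamma>"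
proof (rule ccontr)
  assume neg: "\<not> ?thesis"
  have "\<exists>x. real (Suc n) \<le> norm x \<and> - (1 / real (Suc n)) \<le> (\<integral>z. drift x z \<partial>lborel)" for n
  proof (rule ccontr)
    assume "\<not> ?thesis"
    \<comment> \<open>If no such x existed, 1 - 1/(n+1) and n+1 would serve as \<gamma> and
      X.\<close>
    then have "\<forall>x. real (Suc n) \<le> norm x \<longrightarrow> 1 + (\<integral>z. drift x z \<partial>lborel) \<le> 1 - 1 / real (Suc n)"
      by (fastforce simp: not_le)
    moreover have "1 - 1 / real (Suc n) < 1" "0 < real (Suc n)" by auto
    ultimately show False using neg by blast
  qed
  then obtain x where x: "\<And>n. real (Suc n) \<le> norm (x n)"
    and ge: "\<And>n. - (1 / real (Suc n)) \<le> (\<integral>z. drift (x n) z \<partial>lborel)" by metis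
  have x0: "x n \<noteq> 0" for n using x[of n] by auto
  have inf: "filterlim (\<lambda>n. norm (x n)) at_top sequentially"
  proof (rule filterlim_at_top_mono[OF filterlim_real_sequentially])
    have "real n \<le> norm (x n)" for n using x[of n] by simp
    then show "\<forall>\<^sub>F n in sequentially. real n \<le> norm (x n)" by simp
  qed
  show False
  proof (rule regularly_varying_radial_limit[OF srv])
    fix m assume m_pos: "\<And>t. 0 < t \<Longrightarrow> 0 < m t" and m_inv: "\<And>t. 0 < t \<Longrightarrow> m t * m (1 / t) = (1 :: real)"
      and low: "\<And>t b. 0 < t \<Longrightarrow> 0 \<le> b \<Longrightarrow> b < m t \<Longrightarrow> \<exists>X>0. \<forall>x. X \<le> norm x \<longrightarrow> b * p x \<le> p (t *\<^sub>R x)"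
      and seq: "\<And>x z. filterlim (\<lambda>n. norm (x n)) at_top sequentially \<Longrightarrow> z \<noteq> 0 \<Longrightarrow>
        (\<lambda>n. p (norm (x n) *\<^sub>R z) / p (x n)) \<longlonglongrightarrow> m (norm z)"
    define L where "L z = norm z ^ CARD('d) * m (norm z)" for z :: "real ^ 'd"
    show False
    proof (rule drift_sequence_contradiction[of x L \<delta>])
      show "(\<lambda>n. accept_ratio (x n) z) \<longlonglongrightarrow> L z" for z
      proof (cases "z = 0")
        case True
        then show ?thesis by (simp add: accept_ratio_eq[OF x0] L_def zero_power)
      next
        case False
        then show ?thesis unfolding accept_ratio_eq[OF x0] L_def by (intro tendsto_intros seq inf)
      qed
      show "0 < L z" if "z \<noteq> 0" for z using that m_pos[of "norm z"] by (simp add: L_def)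
      show "L (inversion z) = 1 / L z" if "z \<noteq> 0" for z
      proof -
        have "m (1 / norm z) = 1 / m (norm z)"
          using m_inv[of "norm z"] m_pos[of "norm z"] that by (simp add: field_simps)
        then show ?thesis by (simp add: L_def norm_inversion power_divide)
      qed
      show "(1 < norm z powr \<delta> \<and> L z * norm z powr \<delta> < 1) \<or> (norm z powr \<delta> < 1 \<and> 1 < L z * norm z powr \<delta>)"
        if z: "1 < norm z" for z
      proof -
        have "norm z powr 0 < norm z powr \<delta>" using z \<delta>_pos by (intro powr_less_mono) auto
        then have 1: "1 < norm z powr \<delta>" using z by (cases "z = 0") auto
        have "L z \<le> norm z powr - \<delta>1"
        proof -
          have zp: "0 < norm z" using z by linarith
          show ?thesis
            unfolding L_def by (rule radial_limit_le[OF mom z m_pos[OF zp] low[OF zp]])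
        qed
        then have "L z * norm z powr \<delta> \<le> norm z powr - \<delta>1 * norm z powr \<delta>" by (rule mult_right_mono) simp
        also have "\<dots> = norm z powr (\<delta> - \<delta>1)" using z by (simp add: powr_add[symmetric])
        also have "\<dots> < norm z powr 0" using z \<delta>1 by (intro powr_less_mono) auto
        also have "\<dots> = 1" using z by (cases "z = 0") auto
        finally show ?thesis using 1 by blast
      qed
      show "(\<lambda>n. lyap \<delta> (norm (x n) *\<^sub>R z) / lyap \<delta> (x n)) \<longlonglongrightarrow> norm z powr \<delta>" for z :: "real ^ 'd"
        by (rule lyap_ratio_tendsto_at_top[OF inf \<delta>_pos])
    qed (fact x0 ge)+
  qed
qed

text \<open>Continuity and positivity of p at 0 make it locally constant in the limit, so the
  acceptance ratio tends to L z = |z|^d. For |z| > 1 now a = |z|^(-\<delta>) is below 1 and L a =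
  |z|^(d - \<delta>) is above 1, because \<delta> < 1 \<le> d.\<close>

lemma drift_near:
  assumes \<delta>1: "\<delta> < 1"
  shows "\<exists>\<gamma><1. \<exists>\<epsilon>>0. \<forall>x. x \<noteq> 0 \<longrightarrow> norm x \<le> \<epsilon> \<longrightarrow> 1 + (\<integral>z. drift x z \<partial>lborel) \<le> \<gamma>"
proof (rule ccontr)
  assume neg: "\<not> ?thesis"
  have "\<exists>x. x \<noteq> 0 \<and> norm x \<le> 1 / real (Suc n) \<and> - (1 / real (Suc n)) \<le> (\<integral>z. drift x z \<partial>lborel)" for n
  proof (rule ccontr)
    assume "\<not> ?thesis"
    then have "\<forall>x. x \<noteq> 0 \<longrightarrow> norm x \<le> 1 / real (Suc n) \<longrightarrow> 1 + (\<integral>z. drift x z \<partial>lborel) \<le> 1 - 1 / real (Suc n)"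
      by (fastforce simp: not_le)
    moreover have "1 - 1 / real (Suc n) < 1" "0 < 1 / real (Suc n)" by auto
    ultimately show False using neg by blast
  qed
  then obtain x where x0: "\<And>n. x n \<noteq> 0" and x: "\<And>n. norm (x n) \<le> 1 / real (Suc n)"
    and ge: "\<And>n. - (1 / real (Suc n)) \<le> (\<integral>z. drift (x n) z \<partial>lborel)" by metis
  have lim0: "(\<lambda>n. norm (x n)) \<longlonglongrightarrow> 0"
    by (rule tendsto_sandwich[OF _ _ tendsto_const LIMSEQ_Suc[OF lim_1_over_n]]) (use x in auto)
  then have xlim: "x \<longlonglongrightarrow> 0" by (simp add: tendsto_norm_zero_iff)
  have pc: "isCont p 0" using p_cont by (simp add: continuous_on_eq_continuous_at)
  show False
  proof (rule drift_sequence_contradiction[of x "\<lambda>z. norm z ^ CARD('d)" "- \<delta>"])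
    show "(\<lambda>n. accept_ratio (x n) z) \<longlonglongrightarrow> norm z ^ CARD('d)" for z
    proof -
      have "(\<lambda>n. norm (x n) *\<^sub>R z) \<longlonglongrightarrow> 0 *\<^sub>R z" by (intro tendsto_intros lim0)
      then have 1: "(\<lambda>n. p (norm (x n) *\<^sub>R z)) \<longlonglongrightarrow> p 0" using isCont_tendsto_compose[OF pc] by simp
      have 2: "(\<lambda>n. p (x n)) \<longlonglongrightarrow> p 0" using isCont_tendsto_compose[OF pc xlim] .
      have "(\<lambda>n. norm z ^ CARD('d) * (p (norm (x n) *\<^sub>R z) / p (x n))) \<longlonglongrightarrow> norm z ^ CARD('d) * (p 0 / p 0)"
        using p_pos[of 0] by (intro tendsto_intros 1 2) auto
      then show ?thesis using p_pos[of 0] by (simp add: accept_ratio_eq[OF x0])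
    qed
    show "norm (inversion z) ^ CARD('d) = 1 / norm z ^ CARD('d)" for z :: "real ^ 'd"
      by (simp add: norm_inversion power_divide)
    show "(1 < norm z powr - \<delta> \<and> norm z ^ CARD('d) * norm z powr - \<delta> < 1) \<or> (norm z powr - \<delta> < 1 \<and> 1 < norm z ^ CARD('d) * norm z powr - \<delta>)"
      if z: "1 < norm z" for z :: "real ^ 'd"
    proof -
      have z0: "z \<noteq> 0" using z by auto
      have "norm z powr - \<delta> < norm z powr 0" using z \<delta>_pos by (intro powr_less_mono) auto
      then have 1: "norm z powr - \<delta> < 1" using z0 by simp
      have "1 \<le> real CARD('d)" by (simp add: Suc_le_eq)
      then have "0 < real CARD('d) - \<delta>" using \<delta>1 by linarith
      then have "norm z powr 0 < norm z powr (real CARD('d) - \<delta>)" using z by (rule powr_less_mono)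
      also have "\<dots> = norm z ^ CARD('d) * norm z powr - \<delta>"
        using z0 by (simp add: powr_diff powr_realpow powr_minus_divide)
      finally show ?thesis using 1 z0 by simp
    qed
    show "(\<lambda>n. lyap \<delta> (norm (x n) *\<^sub>R z) / lyap \<delta> (x n)) \<longlonglongrightarrow> norm z powr - \<delta>" for z :: "real ^ 'd"
      by (rule lyap_ratio_tendsto_0[OF lim0 x0 \<delta>_pos])
  qed (use x0 ge in auto)
qed

lemma drift_integral_le: "x \<noteq> 0 \<Longrightarrow> (\<integral>z. drift x z \<partial>lborel) \<le> (\<integral>z. envelope z \<partial>lborel)"
  using drift_bound by (intro integral_mono drift_integrable envelope_integrable) (auto dest: abs_le_D1)

text \<open>Far from the origin the moment controls \<open>lyap\<close>. On the unit ball p is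
  bounded and \<open>student\<close> is at least 2^(-d), so the singular power is controlled by
  \<open>lyap_student\<close>.\<close>

lemma lyap_integrable:
  assumes \<delta>1: "\<delta> \<le> \<delta>1" and mom: "(\<integral>\<^sup>+x. ennreal (norm x powr \<delta>1) \<partial>target) < \<infinity>"
  shows "integrable target (lyap \<delta>)"
proof -
  have "compact (cball (0 :: real ^ 'd) 1)" by simp
  moreover have "continuous_on (cball 0 1) p" using p_cont continuous_on_subset by blast
  ultimately obtain B where B: "\<And>x. norm x \<le> 1 \<Longrightarrow> p x \<le> B"
    using compact_continuous_image[THEN compact_imp_bounded, of "cball 0 1" p]
    unfolding bounded_iff by (metis abs_le_D1 dist_0_norm imageI mem_cball real_norm_def)
  have B0: "0 < B" using B[of 0] p_pos[of 0] by simp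
  let ?C = "B * 2 ^ CARD('d)"
  have le: "p x * lyap \<delta> x \<le> p x * (1 + norm x powr \<delta>1) + ?C * (lyap \<delta> x * student x)" for x
  proof (cases "norm x \<le> 1")
    case True
    have "(1 + (norm x)\<^sup>2) ^ CARD('d) \<le> 2 ^ CARD('d)"
      using True by (intro power_mono) (auto simp: power_le_one)
    then have "1 \<le> 2 ^ CARD('d) * student x"
      by (simp add: student_def add_pos_nonneg)
    then have "lyap \<delta> x * 1 \<le> lyap \<delta> x * (2 ^ CARD('d) * student x)" by (rule mult_left_mono) simp
    then have "B * lyap \<delta> x \<le> ?C * (lyap \<delta> x * student x)" using B0 by (simp add: mult_ac)
    moreover have "p x * lyap \<delta> x \<le> B * lyap \<delta> x" using B[OF True] by (intro mult_right_mono) auto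
    moreover have "0 \<le> p x * (1 + norm x powr \<delta>1)" using p_pos[of x] by (simp add: less_imp_le add_nonneg_nonneg)
    ultimately show ?thesis by linarith
  next
    case False
    then have n1: "1 \<le> norm x" by simp
    have "norm x powr - \<delta> \<le> norm x powr 0" by (rule powr_mono[OF _ n1]) (use \<delta>_pos in simp)
    moreover have "norm x powr \<delta> \<le> norm x powr \<delta>1" by (rule powr_mono[OF \<delta>1 n1])
    moreover have "norm x powr 0 = 1" using False by (cases "x = 0") auto
    ultimately have "lyap \<delta> x \<le> 1 + norm x powr \<delta>1" unfolding lyap_def by linarith
    then have "p x * lyap \<delta> x \<le> p x * (1 + norm x powr \<delta>1)" using p_pos[of x] by (intro mult_left_mono) auto
    moreover have "0 \<le> ?C * (lyap \<delta> x * student x)" using B0 by simp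
    ultimately show ?thesis by linarith
  qed
  have "(\<integral>\<^sup>+x. ennreal (lyap \<delta> x) \<partial>target) = (\<integral>\<^sup>+x. ennreal (p x * lyap \<delta> x) \<partial>lborel)"
    using p_pos by (subst nn_integral_target) (auto simp: ennreal_mult' less_imp_le)
  also have "\<dots> \<le> (\<integral>\<^sup>+x. ennreal (p x) * (1 + ennreal (norm x powr \<delta>1)) + ennreal ?C * ennreal (lyap \<delta> x * student x) \<partial>lborel)"
  proof (rule nn_integral_mono)
    fix x
    have "ennreal (p x * lyap \<delta> x) \<le> ennreal (p x * (1 + norm x powr \<delta>1) + ?C * (lyap \<delta> x * student x))"
      using le by (rule ennreal_leI)
    also have "\<dots> = ennreal (p x) * (1 + ennreal (norm x powr \<delta>1)) + ennreal ?C * ennreal (lyap \<delta> x * student x)"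
      using p_pos[of x] B0 by (simp add: ennreal_mult ennreal_plus less_imp_le)
    finally show "ennreal (p x * lyap \<delta> x) \<le> \<dots>" .
  qed
  also have "\<dots> = (\<integral>\<^sup>+x. ennreal (p x) * (1 + ennreal (norm x powr \<delta>1)) \<partial>lborel) + ennreal ?C * (\<integral>\<^sup>+(x :: real ^ 'd). ennreal (lyap \<delta> x * student x) \<partial>lborel)"
    by (subst nn_integral_add) (auto simp: nn_integral_cmult)
  also have "(\<integral>\<^sup>+x. ennreal (p x) * (1 + ennreal (norm x powr \<delta>1)) \<partial>lborel) = (\<integral>\<^sup>+x. 1 + ennreal (norm x powr \<delta>1) \<partial>target)"
    by (rule nn_integral_target[symmetric]) measurable
  also have "\<dots> = 1 + (\<integral>\<^sup>+x. ennreal (norm x powr \<delta>1) \<partial>target)"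
    using emeasure_space_1 by (subst nn_integral_add) auto
  also have "\<dots> + ennreal ?C * (\<integral>\<^sup>+(x :: real ^ 'd). ennreal (lyap \<delta> x * student x) \<partial>lborel) < \<infinity>"
    using mom lyap_student by (simp add: ennreal_mult_less_top)
  finally show ?thesis by (intro integrableI_nonneg) auto
qed

section \<open>Compact sublevel sets and minorization\<close>

lemma lyap_sublevel:
  assumes "x \<noteq> 0" "lyap \<delta> x \<le> R"
  shows "norm x \<le> (max 1 R) powr (1 / \<delta>)" "1 / (max 1 R) powr (1 / \<delta>) \<le> norm x"
proof -
  have *: "t \<le> (max 1 R) powr (1 / \<delta>)" if "0 < t" "t powr \<delta> \<le> R" for t
  proof -
    have "t = (t powr \<delta>) powr (1 / \<delta>)" using that \<delta>_pos by (simp add: powr_powr)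
    also have "\<dots> \<le> (max 1 R) powr (1 / \<delta>)" using that \<delta>_pos by (intro powr_mono2) auto
    finally show ?thesis .
  qed
  have "norm x powr \<delta> \<le> R" "norm x powr - \<delta> \<le> R"
    using assms(2) powr_ge_zero[of "norm x" \<delta>] powr_ge_zero[of "norm x" "- \<delta>"] unfolding lyap_def by linarith+
  moreover have "(1 / norm x) powr \<delta> = norm x powr - \<delta>" by (simp add: powr_divide powr_minus_divide)
  ultimately have "norm x \<le> (max 1 R) powr (1 / \<delta>)" "1 / norm x \<le> (max 1 R) powr (1 / \<delta>)"
    using assms(1) by (auto intro!: *)
  then show "norm x \<le> (max 1 R) powr (1 / \<delta>)" "1 / (max 1 R) powr (1 / \<delta>) \<le> norm x"
    using assms(1) by (auto simp: field_simps)
qed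

text \<open>The sublevel set lies in a compact annulus \<open>C\<close> away from the origin. There
  \<open>wt\<close> is continuous and positive, hence the jump density is bounded below by a
  constant on C x C, and N is that constant times Lebesgue measure on C.\<close>

lemma minorization:
  "\<exists>N. sets N = sets target \<and> finite_measure N \<and> 0 < measure N (space N) \<and>
    (\<forall>x\<in>{x. x \<noteq> 0}. lyap \<delta> x \<le> R \<longrightarrow> (\<forall>A\<in>sets target. emeasure N A \<le> emeasure (mpcn_kernel \<rho> p x) A))"
proof -
  let ?d = "CARD('d)"
  \<comment> \<open>The lower bound 2 keeps the unit sphere in the open annulus, so C has positive
    measure whatever R is.\<close>
  define b where "b = max 2 ((max 1 R) powr (1 / \<delta>))"
  have b: "2 \<le> b" "0 < b" by (auto simp: b_def)
  define C where "C = cball (0 :: real ^ 'd) b - ball 0 (1 / b)"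
  have C_iff: "y \<in> C \<longleftrightarrow> 1 / b \<le> norm y \<and> norm y \<le> b" for y by (auto simp: C_def)
  have C_nz: "y \<noteq> 0" if "y \<in> C" for y using that b by (auto simp: C_iff)
  have C_compact: "compact C" unfolding C_def by (intro compact_diff) auto
  have C_sets [measurable]: "C \<in> sets borel" unfolding C_def by measurable
  have eC: "unit_diag \<in> C" using b by (simp add: C_iff norm_unit_diag)
  then have C_ne: "C \<noteq> {}" by blast
  have wt_cont: "continuous_on C wt"
    unfolding wt_def using p_cont by (auto intro!: continuous_intros intro: continuous_on_subset)
  obtain y1 where y1: "y1 \<in> C" "\<And>y. y \<in> C \<Longrightarrow> wt y1 \<le> wt y"
    using continuous_attains_inf[OF C_compact C_ne wt_cont] by blast
  obtain y2 where y2: "y2 \<in> C" "\<And>y. y \<in> C \<Longrightarrow> wt y \<le> wt y2"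
    using continuous_attains_sup[OF C_compact C_ne wt_cont] by blast
  have w1: "0 < wt y1" and w2: "0 < wt y2" using wt_pos C_nz y1 y2 by auto
  \<comment> \<open>On C x C the numerator of the density is at least (1/b)^d, the form at most 2
    (b^2 + b^2), and the acceptance probability at least the minimum of \<open>wt\<close> over its
    maximum.\<close>
  define \<epsilon> where "\<epsilon> = c * ((1 / b) ^ ?d / (4 * b\<^sup>2) ^ ?d) * (wt y1 / wt y2)"
  have \<epsilon>: "0 < \<epsilon>" using c_pos b w1 w2 by (simp add: \<epsilon>_def)
  have lower: "\<epsilon> \<le> jump x y" if x: "x \<in> C" and y: "y \<in> C" for x y
  proof -
    have f: "0 < mpcn_form \<rho> x y" using \<rho> C_nz[OF x] by (intro mpcn_form_pos) auto
    have "(norm x)\<^sup>2 \<le> b\<^sup>2" "(norm y)\<^sup>2 \<le> b\<^sup>2" using x y by (auto simp: C_iff intro!: power_mono)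
    then have "mpcn_form \<rho> x y \<le> 4 * b\<^sup>2"
      using mpcn_form_upper[of \<rho> x y] \<rho> by simp
    then have d: "(1 / b) ^ ?d / (4 * b\<^sup>2) ^ ?d \<le> mpcn_density \<rho> x y"
      unfolding mpcn_density_def using f x b by (intro frac_le power_mono) (auto simp: C_iff)
    have "wt y1 / wt y2 \<le> wt y / wt x"
      using y1(2)[OF y] y2(2)[OF x] w1 w2 wt_pos[OF C_nz[OF x]] by (intro frac_le) auto
    moreover have "wt y1 / wt y2 \<le> 1" using y1(2)[OF y2(1)] w2 by simp
    ultimately have "wt y1 / wt y2 \<le> min 1 (wt y / wt x)" by simp
    with d show ?thesis
      unfolding \<epsilon>_def jump_def using c_pos b w1 w2 mpcn_density_nonneg[of x y]
      by (intro mult_mono mult_left_mono mult_nonneg_nonneg) auto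
  qed
  define N where "N = density lborel (\<lambda>y. ennreal \<epsilon> * indicator C y)"
  have N_em: "emeasure N A = ennreal \<epsilon> * emeasure lborel (C \<inter> A)" if "A \<in> sets borel" for A
  proof -
    have "emeasure N A = (\<integral>\<^sup>+y. ennreal \<epsilon> * indicator (C \<inter> A) y \<partial>lborel)"
      unfolding N_def using that by (subst emeasure_density) (auto simp: indicator_inter_arith mult.assoc)
    then show ?thesis using that by (subst (asm) nn_integral_cmult_indicator) auto
  qed
  have N_space: "emeasure N (space N) = ennreal \<epsilon> * emeasure lborel C"
    using N_em[of UNIV] by (simp add: N_def)
  have C_fin: "emeasure lborel C < \<infinity>"
    using emeasure_compact_finite[OF C_compact] by simp
  have C_pos: "emeasure lborel C \<noteq> 0"
  proof
    let ?O = "{y :: real ^ 'd. 1 / b < norm y \<and> norm y < b}"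
    assume "emeasure lborel C = 0"
    then have "C \<in> null_sets lborel" by auto
    then have "AE y in lborel. y \<notin> C" by (rule AE_not_in)
    then have "AE y in lborel. y \<notin> ?O" by eventually_elim (auto simp: C_iff)
    moreover have "open ?O" by (intro open_Collect_conj open_Collect_less continuous_intros)
    ultimately have "?O = {}" by (intro open_AE_lborel_notin)
    moreover have "unit_diag \<in> ?O" using b by (simp add: norm_unit_diag)
    ultimately show False by blast
  qed
  show ?thesis
  proof (intro exI[of _ N] conjI ballI impI)
    show "sets N = sets target" by (simp add: N_def)
    show fin: "finite_measure N"
      using N_space C_fin by (intro finite_measureI) (auto simp: ennreal_mult_eq_top_iff)
    interpret finite_measure N by fact
    have "emeasure N (space N) \<noteq> 0" using N_space C_pos \<epsilon> by simp
    then show "0 < measure N (space N)" by (simp add: emeasure_eq_measure zero_less_measure_iff)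
    fix x :: "real ^ 'd" and A assume "x \<in> {x. x \<noteq> 0}" and R: "lyap \<delta> x \<le> R" and "A \<in> sets target"
    then have x0: "x \<noteq> 0" and A [measurable]: "A \<in> sets borel" by auto
    have "norm x \<le> b" "1 / b \<le> norm x"
    proof -
      show "norm x \<le> b" using lyap_sublevel(1)[OF x0 R] by (simp add: b_def)
      have "1 / b \<le> 1 / (max 1 R) powr (1 / \<delta>)" using b by (intro divide_left_mono) (auto simp: b_def)
      then show "1 / b \<le> norm x" using lyap_sublevel(2)[OF x0 R] by linarith
    qed
    then have xC: "x \<in> C" by (simp add: C_iff)
    have "emeasure N A = (\<integral>\<^sup>+y. ennreal \<epsilon> * indicator C y * indicator A y \<partial>lborel)"
      unfolding N_def by (subst emeasure_density) auto
    also have "\<dots> \<le> (\<integral>\<^sup>+y. ennreal (jump x y) * indicator A y \<partial>lborel)"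
      using lower[OF xC] by (intro nn_integral_mono) (auto simp: indicator_def ennreal_leI)
    also have "\<dots> \<le> emeasure (mpcn_kernel \<rho> p x) A"
      unfolding emeasure_kernel[OF x0 A] by simp
    finally show "emeasure N A \<le> emeasure (mpcn_kernel \<rho> p x) A" .
  qed
qed

lemma geometrically_ergodic_if_lyap:
  assumes \<delta>1: "\<delta> < \<delta>1" "\<delta> < 1" and mom: "(\<integral>\<^sup>+x. ennreal (norm x powr \<delta>1) \<partial>target) < \<infinity>"
    and srv: "symmetrically_regularly_varying p"
  shows "geometrically_ergodic target (mpcn_kernel \<rho> p)"
proof -
  obtain \<gamma>1 X where \<gamma>1: "\<gamma>1 < 1" and X: "0 < X" "\<And>x. X \<le> norm x \<Longrightarrow> 1 + (\<integral>z. drift x z \<partial>lborel) \<le> \<gamma>1"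
    using drift_far[OF \<delta>1(1) mom srv] by blast
  obtain \<gamma>2 \<epsilon> where \<gamma>2: "\<gamma>2 < 1" and \<epsilon>: "0 < \<epsilon>" "\<And>x. x \<noteq> 0 \<Longrightarrow> norm x \<le> \<epsilon> \<Longrightarrow> 1 + (\<integral>z. drift x z \<partial>lborel) \<le> \<gamma>2"
    using drift_near[OF \<delta>1(2)] by blast
  define \<gamma> where "\<gamma> = max 0 (max \<gamma>1 \<gamma>2)"
  define E where "E = (\<integral>z. envelope z \<partial>lborel)"
  \<comment> \<open>Bounds P W on the shell between \<epsilon> and X: there W is at most X^\<delta>
    + \<epsilon>^(-\<delta>), and P W / W is at most 1 + E by the envelope.\<close>
  define K where "K = (X powr \<delta> + \<epsilon> powr - \<delta>) * (1 + E)"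
  have "unit_diag \<noteq> (0 :: real ^ 'd)" using norm_unit_diag[where 'd = 'd] by auto
  then have E: "-1 \<le> E"
    using drift_integral_le[of unit_diag] nn_integral_lyap_kernel(2)[of unit_diag] unfolding E_def by linarith
  have K: "0 \<le> K" unfolding K_def using E by (intro mult_nonneg_nonneg) auto
  show ?thesis
  \<comment> \<open>The punctured space is absorbing: from x \<noteq> 0 jumps have a density and
    rejection keeps the chain at x.\<close>
  proof (rule harris[of "{x. x \<noteq> 0}" "lyap \<delta>" \<gamma> K])
    show "AE x in target. x \<in> {x. x \<noteq> 0}"
      using AE_lborel_singleton[of "0 :: real ^ 'd"] by (subst AE_density) auto
    show "AE y in mpcn_kernel \<rho> p x. y \<in> {x. x \<noteq> 0}" if "x \<in> {x. x \<noteq> 0}" for x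
    proof (rule AE_I[where N = "{0}"])
      have "(\<integral>\<^sup>+y. ennreal (jump x y) * indicator {0} y \<partial>lborel) = 0"
        using AE_lborel_singleton[of "0 :: real ^ 'd"] by (subst nn_integral_0_iff_AE) (auto elim: AE_mp)
      then show "emeasure (mpcn_kernel \<rho> p x) {0} = 0"
        using emeasure_kernel[of x "{0}"] that by simp
    qed auto
    show "(\<integral>\<^sup>+y. ennreal (lyap \<delta> y) \<partial>mpcn_kernel \<rho> p x) \<le> ennreal (\<gamma> * lyap \<delta> x + K)" if "x \<in> {x. x \<noteq> 0}" for x
    proof -
      have x: "x \<noteq> 0" using that by simp
      have "lyap \<delta> x * (1 + (\<integral>z. drift x z \<partial>lborel)) \<le> \<gamma> * lyap \<delta> x + K"
      proof (cases "norm x \<le> \<epsilon> \<or> X \<le> norm x")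
        case True
        then have "1 + (\<integral>z. drift x z \<partial>lborel) \<le> \<gamma>"
          using X(2)[of x] \<epsilon>(2)[OF x] unfolding \<gamma>_def by linarith
        then have "lyap \<delta> x * (1 + (\<integral>z. drift x z \<partial>lborel)) \<le> lyap \<delta> x * \<gamma>" by (rule mult_left_mono) simp
        then show ?thesis using K by (simp add: mult.commute)
      next
        case False
        then have "norm x powr \<delta> \<le> X powr \<delta>"
          using \<delta>_pos by (intro powr_mono2) auto
        moreover have "norm x powr - \<delta> \<le> \<epsilon> powr - \<delta>"
          using False \<delta>_pos \<epsilon>(1) by (intro powr_mono2') auto
        ultimately have "lyap \<delta> x \<le> X powr \<delta> + \<epsilon> powr - \<delta>" by (simp add: lyap_def)
        moreover have "1 + (\<integral>z. drift x z \<partial>lborel) \<le> 1 + E" using drift_integral_le[OF x] by (simp add: E_def)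
        ultimately have "lyap \<delta> x * (1 + (\<integral>z. drift x z \<partial>lborel)) \<le> K"
          unfolding K_def using nn_integral_lyap_kernel(2)[OF x] by (intro mult_mono) auto
        moreover have "0 \<le> \<gamma> * lyap \<delta> x" by (simp add: \<gamma>_def)
        ultimately show ?thesis by linarith
      qed
      then show ?thesis unfolding nn_integral_lyap_kernel(1)[OF x] by (rule ennreal_leI)
    qed
    show "integrable target (lyap \<delta>)" using \<delta>1 by (intro lyap_integrable[OF _ mom]) simp
  qed (use minorization \<gamma>1 \<gamma>2 K in \<open>auto simp: \<gamma>_def\<close>)
qed

end

lemma (in mpcn) geometrically_ergodic_if_moment:
  assumes \<delta>1: "0 < \<delta>1" and mom: "(\<integral>\<^sup>+x. ennreal (norm x powr \<delta>1) \<partial>target) < \<infinity>"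
    and srv: "symmetrically_regularly_varying p"
  shows "geometrically_ergodic target (mpcn_kernel \<rho> p)"
proof (rule student_lyap_finite)
  fix \<delta>0 :: real
  assume \<delta>0: "0 < \<delta>0" and fin: "(\<integral>\<^sup>+(z :: real ^ 'd). ennreal (lyap \<delta>0 z * student z) \<partial>lborel) < \<infinity>"
  \<comment> \<open>Half of \<delta>1 leaves the strict gap used at infinity, \<delta>0 gives
    integrability against \<open>student\<close>, and 1/2 keeps \<delta> below 1 for the
    origin.\<close>
  define \<delta> where "\<delta> = min (min (\<delta>1 / 2) \<delta>0) (1 / 2)"
  have \<delta>: "0 < \<delta>" "\<delta> < \<delta>1" "\<delta> \<le> \<delta>0" "\<delta> < 1" using \<delta>0 \<delta>1 by (auto simp: \<delta>_def)
  interpret mpcn_lyap \<rho> c p \<delta>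
  proof
    have "(\<integral>\<^sup>+(z :: real ^ 'd). ennreal (lyap \<delta> z * student z) \<partial>lborel)
        \<le> (\<integral>\<^sup>+(z :: real ^ 'd). ennreal 2 * ennreal (lyap \<delta>0 z * student z) \<partial>lborel)"
    proof (rule nn_integral_mono)
      fix z :: "real ^ 'd"
      have "lyap \<delta> z * student z \<le> 2 * lyap \<delta>0 z * student z"
        using \<delta> by (intro mult_right_mono lyap_mono) auto
      then show "ennreal (lyap \<delta> z * student z) \<le> ennreal 2 * ennreal (lyap \<delta>0 z * student z)"
        by (subst ennreal_mult[symmetric]) (auto intro!: ennreal_leI simp: mult.assoc)
    qed
    also have "\<dots> = ennreal 2 * (\<integral>\<^sup>+(z :: real ^ 'd). ennreal (lyap \<delta>0 z * student z) \<partial>lborel)"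
      by (rule nn_integral_cmult) measurable
    also have "\<dots> < \<infinity>" using fin by (simp add: ennreal_mult_less_top)
    finally show "(\<integral>\<^sup>+(z :: real ^ 'd). ennreal (lyap \<delta> z * student z) \<partial>lborel) < \<infinity>" .
  qed (fact \<delta>(1))
  show ?thesis
    by (rule geometrically_ergodic_if_lyap[OF \<delta>(2) \<delta>(4) mom srv])
qed

theorem proposition3p4:
  fixes \<rho> :: real and p :: "real ^ 'd \<Rightarrow> real" and target :: "(real ^ 'd) measure"
  assumes "CARD('d) \<ge> 2"
    and "0 < \<rho>" "\<rho> < 1"
    and "\<forall>x. 0 < p x"
    and "continuous_on UNIV p"
    and "symmetrically_regularly_varying p"
    and "target = density lborel (\<lambda>x. ennreal (p x))"
    and "prob_space target"
  shows "geometrically_ergodic target (mpcn_kernel \<rho> p) \<longleftrightarrow>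
    (\<exists>\<delta>>0. (\<integral>\<^sup>+ x. ennreal (norm x powr \<delta>) \<partial>target) < \<infinity>)"
proof -
  obtain c where c: "0 < c"
    and cp: "\<forall>x. x \<noteq> 0 \<longrightarrow>
      mpcn_proposal \<rho> x = density lborel (\<lambda>y :: real ^ 'd. ennreal (c * mpcn_density \<rho> x y)) \<and>
      (\<integral>\<^sup>+y. ennreal (c * mpcn_density \<rho> x y) \<partial>lborel) = 1"
    using mpcn_proposal_density[OF assms(2,3), where 'd = 'd] by blast
  interpret mpcn \<rho> c p
  proof (rule mpcn.intro)
    show "0 < \<rho>" "\<rho> < 1" "0 < c" "continuous_on UNIV p" by fact+
    show "0 < p x" for x using assms(4) by blast
    show "prob_space (density lborel (\<lambda>x. ennreal (p x)))" using assms(8) unfolding assms(7) .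
    fix x :: "real ^ 'd" assume "x \<noteq> 0"
    with cp show "mpcn_proposal \<rho> x = density lborel (\<lambda>y. ennreal (c * mpcn_density \<rho> x y))"
      and "(\<integral>\<^sup>+y. ennreal (c * mpcn_density \<rho> x y) \<partial>lborel) = 1" by blast+
  qed
  show ?thesis
    unfolding assms(7)
  proof
    assume "geometrically_ergodic (density lborel (\<lambda>x. ennreal (p x))) (mpcn_kernel \<rho> p)"
    then show "\<exists>\<delta>>0. (\<integral>\<^sup>+ x. ennreal (norm x powr \<delta>) \<partial>density lborel (\<lambda>x. ennreal (p x))) < \<infinity>"
      by (rule moment_if_geometrically_ergodic)
  next
    assume "\<exists>\<delta>>0. (\<integral>\<^sup>+ x. ennreal (norm x powr \<delta>) \<partial>density lborel (\<lambda>x. ennreal (p x))) < \<infinity>"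
    then obtain \<delta> where "0 < \<delta>" "(\<integral>\<^sup>+ x. ennreal (norm x powr \<delta>) \<partial>density lborel (\<lambda>x. ennreal (p x))) < \<infinity>"
      by (elim exE conjE)
    then show "geometrically_ergodic (density lborel (\<lambda>x. ennreal (p x))) (mpcn_kernel \<rho> p)"
      by (rule geometrically_ergodic_if_moment[OF _ _ assms(6)])
  qed
qed

end
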